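(* Let $\Bbbk$ be an algebraically closed field of characteristic zero and let $D$ be a nonzero $\Bbbk$-derivation of $\Bbbk[x,y]$. Assume $D$ satisfies one of the following properties: a) $0<\mathbb{e}(D)<\infty$ and $D$ admits an eigenvector which is not equivalent to an element in $\Bbbk[x]$. b) $D$ admits an eigenvector with null eigenvalue which is not equivalent to an element in $\Bbbk[x]$ (in particular $\mathbb{e}(D)=\infty$). Then $\operatorname{Aut}(D)$ is an algebraic group.
   Context: $\operatorname{Aut}_\Bbbk(\Bbbk[x,y])$ is the group of $\Bbbk$-algebra automorphisms of $\Bbbk[x,y]$. For a $\Bbbk$-derivation $D$ of $\Bbbk[x,y]$, the isotropy group is $\operatorname{Aut}(D)=\{\rho\in\operatorname{Aut}_\Bbbk(\Bbbk[x,y]) : \rho D=D\rho\}$. An eigenvector of $D$ is a polynomial $f\in\Bbbk[x,y]\setminus\Bbbk$ such that $D(f)=\lambda f$ for some $\lambda\in\Bbbk[x,y]$; $\lambda$ is its eigenvalue. $\mathbb{e}(D)$ is the number of $D$-stable reduced principal ideals of height 1, i.e. the number of square-free eigenvectors of $D$ counted up to multiplication by elements of $\Bbbk^*$. A polynomial $f$ is equivalent to $g$ if there is $\varphi\in\operatorname{Aut}_\Bbbk(\Bbbk[x,y])$ with $\varphi(g)=f$. The degree of $\rho\in\operatorname{Aut}_\Bbbk(\Bbbk[x,y])$ is $\max\{\deg\rho(x),\deg\rho(y)\}$. The set $\operatorname{Aut}(\Bbbk[x,y])_d$ of automorphisms of degree $\le d$ is an affine algebraic variety (structure given by the coefficients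 of $\rho(x),\rho(y)$), closed in $\operatorname{Aut}(\Bbbk[x,y])_{d+1}$; $\operatorname{Aut}_\Bbbk(\Bbbk[x,y])=\bigcup_d\operatorname{Aut}(\Bbbk[x,y])_d$ carries the inductive topology (a set is closed iff its intersection with every $\operatorname{Aut}(\Bbbk[x,y])_d$ is closed). A subgroup of $\operatorname{Aut}_\Bbbk(\Bbbk[x,y])$ is an algebraic group iff it is closed and contained in $\operatorname{Aut}(\Bbbk[x,y])_d$ for some $d$. *)

theory Defs
  imports
    "HOL-Computational_Algebra.Computational_Algebra"
    "HOL-Library.Extended_Nat"
    "HOL-Algebra.Group"
begin

(* k[x,y] is represented as (k[x])[y]: the coefficient of x^i y^j in p is
   poly.coeff (poly.coeff p j) i. *)
type_synonym 'a bpoly = "'a poly poly"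

abbreviation kconst :: "'a::field \<Rightarrow> 'a bpoly" where
  "kconst c \<equiv> [:[:c:]:]"

abbreviation var_x :: "'a::field bpoly" where
  "var_x \<equiv> [:[:0, 1:]:]"

abbreviation var_y :: "'a::field bpoly" where
  "var_y \<equiv> [:0, 1:]"

definition bcoeff :: "'a::field bpoly \<Rightarrow> nat \<Rightarrow> nat \<Rightarrow> 'a" where
  "bcoeff p i j = poly.coeff (poly.coeff p j) i"

(* Total degree in x and y, with the convention that 0 has degree 0. *)
definition total_deg :: "'a::field bpoly \<Rightarrow> nat" where
  "total_deg p = Max (insert 0 {i + j |i j. bcoeff p i j \<noteq> 0})"

definition poly_in_x :: "'a::field bpoly set" where
  "poly_in_x = {[:q:] |q. True}"

definition is_aut :: "('a::field bpoly \<Rightarrow> 'a bpoly) \<Rightarrow> bool" where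
  "is_aut \<rho> \<longleftrightarrow> bij \<rho> \<and>
     (\<forall>p q. \<rho> (p + q) = \<rho> p + \<rho> q) \<and>
     (\<forall>p q. \<rho> (p * q) = \<rho> p * \<rho> q) \<and>
     (\<forall>c. \<rho> (kconst c) = kconst c)"

definition aut_group :: "('a::field bpoly \<Rightarrow> 'a bpoly) monoid" where
  "aut_group = \<lparr>carrier = {\<rho>. is_aut \<rho>}, monoid.mult = (\<circ>), one = id\<rparr>"

definition is_derivation :: "('a::field bpoly \<Rightarrow> 'a bpoly) \<Rightarrow> bool" where
  "is_derivation D \<longleftrightarrow>
     (\<forall>p q. D (p + q) = D p + D q) \<and>
     (\<forall>c p. D (kconst c * p) = kconst c * D p) \<and>
     (\<forall>p q. D (p * q) = p * D q + q * D p)"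

definition isotropy :: "('a::field bpoly \<Rightarrow> 'a bpoly) \<Rightarrow> ('a bpoly \<Rightarrow> 'a bpoly) set" where
  "isotropy D = {\<rho>. is_aut \<rho> \<and> \<rho> \<circ> D = D \<circ> \<rho>}"

definition eigenvector_with ::
    "('a::field bpoly \<Rightarrow> 'a bpoly) \<Rightarrow> 'a bpoly \<Rightarrow> 'a bpoly \<Rightarrow> bool" where
  "eigenvector_with D f h \<longleftrightarrow> f \<notin> range kconst \<and> D f = h * f"

definition eigenvector :: "('a::field bpoly \<Rightarrow> 'a bpoly) \<Rightarrow> 'a bpoly \<Rightarrow> bool" where
  "eigenvector D f \<longleftrightarrow> (\<exists>h. eigenvector_with D f h)"

definition scalar_rel :: "('a::field bpoly \<times> 'a bpoly) set" where
  "scalar_rel = {(f, g). \<exists>c. c \<noteq> 0 \<and> g = kconst c * f}"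

(* Square-free eigenvectors modulo multiplication by nonzero scalars. *)
definition eigen_classes :: "('a::field bpoly \<Rightarrow> 'a bpoly) \<Rightarrow> 'a bpoly set set" where
  "eigen_classes D = {f. eigenvector D f \<and> squarefree f} // scalar_rel"

definition eigen_number :: "('a::field bpoly \<Rightarrow> 'a bpoly) \<Rightarrow> enat" where
  "eigen_number D =
     (if finite (eigen_classes D) then enat (card (eigen_classes D)) else \<infinity>)"

definition equivalent :: "'a::field bpoly \<Rightarrow> 'a bpoly \<Rightarrow> bool" where
  "equivalent f g \<longleftrightarrow> (\<exists>\<phi>. is_aut \<phi> \<and> \<phi> g = f)"

definition aut_degree :: "('a::field bpoly \<Rightarrow> 'a bpoly) \<Rightarrow> nat" where
  "aut_degree \<rho> = max (total_deg (\<rho> var_x)) (total_deg (\<rho> var_y))"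

definition aut_upto :: "nat \<Rightarrow> ('a::field bpoly \<Rightarrow> 'a bpoly) set" where
  "aut_upto d = {\<rho>. is_aut \<rho> \<and> aut_degree \<rho> \<le> d}"

(* The polynomial functions in the coefficients of \<rho>(x) and \<rho>(y).  On aut_upto d the
   coordinates with i + j > d vanish, so only finitely many coordinates matter there. *)
inductive_set coeff_polyfun :: "(('a::field bpoly \<Rightarrow> 'a bpoly) \<Rightarrow> 'a) set" where
  const: "(\<lambda>\<rho>. c) \<in> coeff_polyfun"
| coord_x: "(\<lambda>\<rho>. bcoeff (\<rho> var_x) i j) \<in> coeff_polyfun"
| coord_y: "(\<lambda>\<rho>. bcoeff (\<rho> var_y) i j) \<in> coeff_polyfun"
| add: "F \<in> coeff_polyfun \<Longrightarrow> G \<in> coeff_polyfun \<Longrightarrow> (\<lambda>\<rho>. F \<rho> + G \<rho>) \<in> coeff_polyfun"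
| mult: "F \<in> coeff_polyfun \<Longrightarrow> G \<in> coeff_polyfun \<Longrightarrow> (\<lambda>\<rho>. F \<rho> * G \<rho>) \<in> coeff_polyfun"

(* The Zariski topology of the affine variety aut_upto d: it is locally closed in the affine
   space of pairs of polynomials of degree at most d, being a closed subset of the principal
   open subset of a closed set where the (constant) Jacobian determinant is nonzero.  Its
   Zariski topology is therefore the subspace topology; the inverse of the Jacobian, although
   regular, yields no further closed sets. *)
definition zariski_closed_in ::
    "nat \<Rightarrow> ('a::field bpoly \<Rightarrow> 'a bpoly) set \<Rightarrow> bool" where
  "zariski_closed_in d S \<longleftrightarrow>
     (\<exists>P \<subseteq> coeff_polyfun. S = {\<rho> \<in> aut_upto d. \<forall>F\<in>P. F \<rho> = 0})"

definition ind_closed :: "('a::field bpoly \<Rightarrow> 'a bpoly) set \<Rightarrow> bool" where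
  "ind_closed S \<longleftrightarrow> S \<subseteq> {\<rho>. is_aut \<rho>} \<and> (\<forall>d. zariski_closed_in d (S \<inter> aut_upto d))"

definition algebraic_group :: "('a::field bpoly \<Rightarrow> 'a bpoly) set \<Rightarrow> bool" where
  "algebraic_group H \<longleftrightarrow>
     subgroup H aut_group \<and> ind_closed H \<and> (\<exists>d. H \<subseteq> aut_upto d)"

end

theory Submission
  imports Defs
begin

text \<open>
  Write \<open>u = \<rho>(x)\<close> for an automorphism \<open>\<rho>\<close>. The derivation \<open>Jac(u, \<cdot>)\<close> is locally nilpotent, and so is the
  derivation of every weighted top form of \<open>u\<close>; this forces the Newton polygon of \<open>u\<close> to be a triangle with one
  leg dividing the other and yields the Jung--van der Kulk decomposition of \<open>\<rho>\<close> into affine maps, shears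
  \<open>y \<mapsto> y + Q(x)\<close> and swaps. Let \<open>f\<close> be not equivalent to an element of \<open>k[x]\<close> and follow the
  word of shears \<open>Q\<^sub>1, Q\<^sub>2, \<dots>\<close> of degrees at least 2 that leads from \<open>\<rho>(f)\<close> back to \<open>f\<close>. A shear either lowers the degree in \<open>x\<close>, and then its degree is
  bounded by that degree, or it puts a monomial on an edge whose exponent is from then on multiplied by
  \<open>deg Q\<^sub>i\<close> in every step. Hence \<open>deg \<rho>\<close> is bounded in terms of \<open>deg f\<close> and \<open>deg \<rho>(f)\<close>.

  It remains to bound \<open>deg \<rho>(f)\<close> for \<open>\<rho>\<close> in the isotropy group. In case a) the irreducible factors of \<open>f\<close> are mapped
  into finitely many classes of square-free eigenvectors. In case b) \<open>\<rho>\<close> acts on \<open>R = ker D\<close>, where elements of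
  equal degree are proportional up to lower degree; so \<open>deg \<rho>(r) / deg r\<close> is constant on \<open>R\<close>, and comparing elements of
  least positive degree shows that the constant is 1.
\<close>

subsection \<open>Evaluation homomorphisms\<close>

text \<open>The content is the bound on degrees; closedness is easy, because
  \<open>\<rho> D = D \<rho>\<close> holds once it holds on x and y. The condition on f is forced: a
  shear y -> y + Q(x) fixes all of k[x] and has arbitrary degree, so for f in k[x] the degrees of f
  and \<open>\<rho>(f)\<close> say nothing about \<rho>. The obstacle in the bound is cancellation,
  since a shear may well lower the degree of \<open>\<rho>(f)\<close>. On an edge of the Newton
  polygon a shear acts as a translation T -> T + c of a one-variable polynomial, and a polynomial of
  degree n divisible by T^l has, after a translation by nonzero c, order at most n - l at 0. This
  makes growth permanent once a point of the edge has left the y-axis; until then each shear costs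
  at least one unit of degree in x. In case b) no structure theorem for the kernel is used.
  Proportionality of top forms bounds \<open>deg \<rho>(r)\<close> linearly in \<open>deg r\<close>
  up to an additive constant, and passing to powers of r removes the constant.\<close>

definition rhom :: "('b::comm_ring_1 \<Rightarrow> 'c::comm_ring_1) \<Rightarrow> bool" where
  "rhom \<kappa> \<longleftrightarrow> \<kappa> 1 = 1 \<and> (\<forall>a b. \<kappa> (a + b) = \<kappa> a + \<kappa> b) \<and> (\<forall>a b. \<kappa> (a * b) = \<kappa> a * \<kappa> b)"

lemma rhom_1: "rhom \<kappa> \<Longrightarrow> \<kappa> 1 = 1"
  and rhom_add: "rhom \<kappa> \<Longrightarrow> \<kappa> (a + b) = \<kappa> a + \<kappa> b"
  and rhom_mult: "rhom \<kappa> \<Longrightarrow> \<kappa> (a * b) = \<kappa> a * \<kappa> b"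
  by (auto simp: rhom_def)

lemma rhom_0: assumes "rhom \<kappa>" shows "\<kappa> 0 = 0"
  using rhom_add[OF assms, of 0 0] by simp

lemma rhom_uminus: assumes "rhom \<kappa>" shows "\<kappa> (- a) = - \<kappa> a"
  using rhom_add[OF assms, of a "- a"] rhom_0[OF assms] by (simp add: eq_neg_iff_add_eq_0 add.commute)

lemma rhom_diff: assumes "rhom \<kappa>" shows "\<kappa> (a - b) = \<kappa> a - \<kappa> b"
  using rhom_add[OF assms, of a "- b"] rhom_uminus[OF assms] by simp

lemma rhom_power: assumes "rhom \<kappa>" shows "\<kappa> (a ^ n) = \<kappa> a ^ n"
  by (induction n) (auto simp: rhom_1[OF assms] rhom_mult[OF assms])

lemma rhom_comp: "rhom \<kappa> \<Longrightarrow> rhom \<mu> \<Longrightarrow> rhom (\<lambda>a. \<kappa> (\<mu> a))"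
  by (auto simp: rhom_def)

definition ev1 :: "('b::comm_ring_1 \<Rightarrow> 'c::comm_ring_1) \<Rightarrow> 'c \<Rightarrow> 'b poly \<Rightarrow> 'c" where
  "ev1 \<kappa> u q = poly (map_poly \<kappa> q) u"

lemma ev1_0 [simp]: "ev1 \<kappa> u 0 = 0"
  by (simp add: ev1_def)

lemma ev1_pCons: "rhom \<kappa> \<Longrightarrow> ev1 \<kappa> u (pCons a q) = \<kappa> a + u * ev1 \<kappa> u q"
  by (simp add: ev1_def map_poly_pCons rhom_0)

lemma rhom_ev1: assumes \<kappa>: "rhom \<kappa>" shows "rhom (ev1 \<kappa> u)"
proof -
  have add: "ev1 \<kappa> u (p + q) = ev1 \<kappa> u p + ev1 \<kappa> u q" for p q
    by (induction p q rule: poly_induct2)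
      (auto simp: ev1_pCons[OF \<kappa>] rhom_add[OF \<kappa>] algebra_simps)
  have smult: "ev1 \<kappa> u (smult a q) = \<kappa> a * ev1 \<kappa> u q" for a q
    by (induction q) (auto simp: ev1_pCons[OF \<kappa>] rhom_mult[OF \<kappa>] algebra_simps)
  have "ev1 \<kappa> u (p * q) = ev1 \<kappa> u p * ev1 \<kappa> u q" for p q
    by (induction p) (auto simp: ev1_pCons[OF \<kappa>] add smult rhom_0[OF \<kappa>] algebra_simps)
  moreover have "ev1 \<kappa> u 1 = 1"
    by (simp add: one_pCons ev1_pCons[OF \<kappa>] rhom_1[OF \<kappa>])
  ultimately show ?thesis
    using add by (simp add: rhom_def)
qed

text \<open>Universal property of k[x,y]: the homomorphism over \<kappa> with x -> u and y -> v. The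
  target is left general because it is k[x,y] itself for substitutions (\<open>sub\<close>) and
  k[x,y][T] for weight gradings (\<open>wt\<close>).\<close>

definition bev :: "('a::field \<Rightarrow> 'c::comm_ring_1) \<Rightarrow> 'c \<Rightarrow> 'c \<Rightarrow> 'a bpoly \<Rightarrow> 'c" where
  "bev \<kappa> u v p = ev1 (ev1 \<kappa> u) v p"

lemma rhom_bev: "rhom \<kappa> \<Longrightarrow> rhom (bev \<kappa> u v)"
  unfolding bev_def[abs_def] by (intro rhom_ev1)

lemma bev_pCons: "rhom \<kappa> \<Longrightarrow> bev \<kappa> u v (pCons c p) = ev1 \<kappa> u c + v * bev \<kappa> u v p"
  by (simp add: bev_def ev1_pCons rhom_ev1)

lemma bev_0 [simp]: "bev \<kappa> u v 0 = 0"
  by (simp add: bev_def)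

lemma bev_const: "rhom \<kappa> \<Longrightarrow> bev \<kappa> u v (kconst c) = \<kappa> c"
  and bev_x: "rhom \<kappa> \<Longrightarrow> bev \<kappa> u v var_x = u"
  and bev_y: "rhom \<kappa> \<Longrightarrow> bev \<kappa> u v var_y = v"
  by (simp_all add: bev_pCons ev1_pCons rhom_0 rhom_1 rhom_ev1 del: pCons_0_0)

lemma rhom_kconst: "rhom (\<lambda>c. kconst c)"
  by (auto simp: rhom_def one_pCons)

text \<open>Constants, x and y generate k[x,y] as a ring. Identities between homomorphisms or
  derivations are thus checked on generators instead of coefficients.\<close>

lemma bpoly_induct [case_names const x y add mult]:
  fixes p :: "'a::field bpoly"
  assumes const: "\<And>c. P (kconst c)" and x: "P var_x" and y: "P var_y"
    and add: "\<And>p q. P p \<Longrightarrow> P q \<Longrightarrow> P (p + q)" and mult: "\<And>p q. P p \<Longrightarrow> P q \<Longrightarrow> P (p * q)"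
  shows "P p"
proof -
  have 1: "P [:q:]" for q
  proof (induction q)
    case 0
    show ?case using const[of 0] by simp
  next
    case (pCons a q)
    have "[:pCons a q:] = kconst a + var_x * [:q:]" by simp
    then show ?case using add[OF const mult[OF x pCons(2)]] by simp
  qed
  show ?thesis
  proof (induction p)
    case 0
    show ?case using const[of 0] by simp
  next
    case (pCons q p)
    have "pCons q p = [:q:] + var_y * p" by simp
    then show ?case using add[OF 1 mult[OF y pCons(2)]] by simp
  qed
qed

abbreviation sub :: "'a::field bpoly \<Rightarrow> 'a bpoly \<Rightarrow> 'a bpoly \<Rightarrow> 'a bpoly" where
  "sub \<equiv> bev (\<lambda>c. kconst c)"

lemmas rhom_sub = rhom_bev[OF rhom_kconst]
lemmas sub_const = bev_const[OF rhom_kconst]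
lemmas sub_x = bev_x[OF rhom_kconst]
lemmas sub_y = bev_y[OF rhom_kconst]

lemma rhom_eq_bev:
  assumes "rhom h" "rhom \<kappa>" "\<And>c. h (kconst c) = \<kappa> c"
  shows "h p = bev \<kappa> (h var_x) (h var_y) p"
  by (induction p rule: bpoly_induct)
    (simp_all add: assms bev_const bev_x bev_y rhom_add[OF assms(1)] rhom_mult[OF assms(1)]
      rhom_add[OF rhom_bev[OF assms(2)]] rhom_mult[OF rhom_bev[OF assms(2)]] del: mult_pCons_left mult_pCons_right)

lemma rhom_eqI:
  fixes h g :: "'a::field bpoly \<Rightarrow> 'b::comm_ring_1"
  assumes "rhom h" "rhom g" "\<And>c. h (kconst c) = g (kconst c)" "h var_x = g var_x" "h var_y = g var_y"
  shows "h p = g p"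
  by (induction p rule: bpoly_induct)
    (simp_all add: assms(3-) rhom_add[OF assms(1)] rhom_add[OF assms(2)] rhom_mult[OF assms(1)]
      rhom_mult[OF assms(2)] del: mult_pCons_left mult_pCons_right)

abbreviation ainv :: "('a \<Rightarrow> 'b) \<Rightarrow> 'b \<Rightarrow> 'a" where "ainv \<equiv> inv_into UNIV"

lemma is_aut_rhom: assumes "is_aut \<rho>" shows "rhom \<rho>"
proof -
  have "\<rho> 1 = 1" using assms unfolding is_aut_def one_pCons by metis
  then show ?thesis using assms by (simp add: rhom_def is_aut_def)
qed

lemma is_aut_const: "is_aut \<rho> \<Longrightarrow> \<rho> (kconst c) = kconst c"
  by (simp add: is_aut_def)

lemma is_aut_sub: assumes "is_aut \<rho>" shows "\<rho> p = sub (\<rho> var_x) (\<rho> var_y) p"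
  by (rule rhom_eq_bev[OF is_aut_rhom[OF assms] rhom_kconst is_aut_const[OF assms]])

lemma is_aut_comp: "is_aut \<rho> \<Longrightarrow> is_aut \<sigma> \<Longrightarrow> is_aut (\<rho> \<circ> \<sigma>)"
  by (auto simp: is_aut_def intro: bij_comp)

lemma is_aut_id: "is_aut id"
  by (auto simp: is_aut_def)

lemma is_aut_inv: assumes "is_aut \<rho>" shows "is_aut (ainv \<rho>)"
proof -
  have b: "bij \<rho>" using assms by (simp add: is_aut_def)
  have [simp]: "\<rho> (ainv \<rho> p) = p" "ainv \<rho> (\<rho> p) = p" for p
    using b by (auto simp: bij_is_surj surj_f_inv_f bij_is_inj)
  have "ainv \<rho> (p + q) = ainv \<rho> p + ainv \<rho> q" for p q
    using is_aut_rhom[OF assms, THEN rhom_add, of "ainv \<rho> p" "ainv \<rho> q"]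
    by (metis \<open>\<And>p. \<rho> (ainv \<rho> p) = p\<close> \<open>\<And>p. ainv \<rho> (\<rho> p) = p\<close>)
  moreover have "ainv \<rho> (p * q) = ainv \<rho> p * ainv \<rho> q" for p q
    using is_aut_rhom[OF assms, THEN rhom_mult, of "ainv \<rho> p" "ainv \<rho> q"]
    by (metis \<open>\<And>p. \<rho> (ainv \<rho> p) = p\<close> \<open>\<And>p. ainv \<rho> (\<rho> p) = p\<close>)
  moreover have "ainv \<rho> (kconst c) = kconst c" for c
    by (metis is_aut_const[OF assms] \<open>\<And>p. ainv \<rho> (\<rho> p) = p\<close>)
  ultimately show ?thesis
    using b by (auto simp: is_aut_def bij_imp_bij_inv)
qed

lemma is_aut_inv_simps:
  assumes "is_aut \<rho>"
  shows "\<rho> (ainv \<rho> p) = p" "ainv \<rho> (\<rho> p) = p"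
  using assms by (auto simp: is_aut_def bij_is_surj surj_f_inv_f bij_is_inj)

lemma is_autI:
  assumes "rhom \<rho>" "rhom \<sigma>" "\<And>c. \<rho> (kconst c) = kconst c" "\<And>c. \<sigma> (kconst c) = kconst c"
    and "\<rho> (\<sigma> var_x) = var_x" "\<rho> (\<sigma> var_y) = var_y" "\<sigma> (\<rho> var_x) = var_x" "\<sigma> (\<rho> var_y) = var_y"
  shows "is_aut \<rho>" "ainv \<rho> = \<sigma>"
proof -
  have id: "rhom (\<lambda>p. p)" by (simp add: rhom_def)
  have 1: "\<rho> (\<sigma> p) = p" for p
    by (rule rhom_eqI[OF rhom_comp[OF assms(1,2)] id]) (simp_all add: assms)
  have 2: "\<sigma> (\<rho> p) = p" for p
    by (rule rhom_eqI[OF rhom_comp[OF assms(2,1)] id]) (simp_all add: assms)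
  have "bij \<rho>" by (rule o_bij[of \<sigma>]) (use 1 2 in auto)
  then show "is_aut \<rho>" using assms(1,3) by (auto simp: is_aut_def rhom_def)
  show "ainv \<rho> = \<sigma>" using 1 2 by (intro inv_unique_comp) auto
qed

subsection \<open>Partial derivatives\<close>

definition dx :: "'a::field bpoly \<Rightarrow> 'a bpoly" where "dx = map_poly pderiv"

abbreviation dy :: "'a::field bpoly \<Rightarrow> 'a bpoly" where "dy \<equiv> pderiv"

text \<open>Two rings occur: k[x,y], and k[x,y][T] with a derivation acting on coefficients; k sits
  inside them through \<kappa>.\<close>

definition deriv_over :: "('a::field \<Rightarrow> 'c::comm_ring_1) \<Rightarrow> ('c \<Rightarrow> 'c) \<Rightarrow> bool" where
  "deriv_over \<kappa> \<delta> \<longleftrightarrow> (\<forall>p q. \<delta> (p + q) = \<delta> p + \<delta> q) \<and>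
     (\<forall>p q. \<delta> (p * q) = p * \<delta> q + q * \<delta> p) \<and> (\<forall>c. \<delta> (\<kappa> c) = 0)"

lemma dx_pCons: "dx (pCons c p) = pCons (pderiv c) (dx p)"
  by (simp add: dx_def map_poly_pCons)

lemma coeff_dx: "coeff (dx p) j = pderiv (coeff p j)"
  by (simp add: dx_def coeff_map_poly)

lemma dx_0 [simp]: "dx 0 = 0"
  by (simp add: dx_def)

lemma map_poly_derivation_mult:
  fixes \<delta> :: "'b::comm_ring_1 \<Rightarrow> 'b"
  assumes add: "\<And>p q. \<delta> (p + q) = \<delta> p + \<delta> q" and mult: "\<And>p q. \<delta> (p * q) = p * \<delta> q + q * \<delta> p"
  shows "map_poly \<delta> (p * q) = p * map_poly \<delta> q + q * map_poly \<delta> p"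
    and "map_poly \<delta> (p + q) = map_poly \<delta> p + map_poly \<delta> q"
proof -
  have 0: "\<delta> 0 = 0" using add[of 0 0] by simp
  have sum: "\<delta> (sum f A) = (\<Sum>x\<in>A. \<delta> (f x))" if "finite A" for f :: "nat \<Rightarrow> 'b" and A
    using that by induction (auto simp: 0 add)
  show "map_poly \<delta> (p + q) = map_poly \<delta> p + map_poly \<delta> q"
    by (intro poly_eqI) (simp add: coeff_map_poly 0 add)
  show "map_poly \<delta> (p * q) = p * map_poly \<delta> q + q * map_poly \<delta> p"
  proof (rule poly_eqI)
    fix n
    have "coeff (map_poly \<delta> (p * q)) n = (\<Sum>i\<le>n. coeff p i * \<delta> (coeff q (n - i))) +
        (\<Sum>i\<le>n. coeff q (n - i) * \<delta> (coeff p i))"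
      by (simp add: coeff_map_poly 0 coeff_mult sum mult sum.distrib)
    also have "(\<Sum>i\<le>n. coeff q (n - i) * \<delta> (coeff p i)) = (\<Sum>i\<le>n. coeff q i * \<delta> (coeff p (n - i)))"
      by (rule sum.reindex_bij_witness[of _ "\<lambda>i. n - i" "\<lambda>i. n - i"]) auto
    finally show "coeff (map_poly \<delta> (p * q)) n = coeff (p * map_poly \<delta> q + q * map_poly \<delta> p) n"
      by (simp add: coeff_mult coeff_map_poly 0)
  qed
qed

lemma deriv_dx: "deriv_over (\<lambda>c. kconst c) dx"
  unfolding deriv_over_def dx_def
  using map_poly_derivation_mult[of pderiv] by (auto simp: pderiv_add pderiv_mult map_poly_pCons pderiv_pCons)

lemma deriv_dy: "deriv_over (\<lambda>c. kconst c) dy"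
  by (auto simp: deriv_over_def pderiv_add pderiv_mult pderiv_pCons)

lemma dx_x [simp]: "dx var_x = 1" and dx_y [simp]: "dx var_y = 0"
  and dy_x [simp]: "dy var_x = 0" and dy_y [simp]: "dy var_y = 1"
  and dx_const [simp]: "dx (kconst c) = 0" and dy_const [simp]: "dy (kconst c) = 0"
  by (simp_all add: dx_pCons pderiv_pCons one_pCons)

lemma dx_add: "dx (p + q) = dx p + dx q" and dx_mult: "dx (p * q) = p * dx q + q * dx p"
  using deriv_dx by (auto simp: deriv_over_def)

lemma chain_rule:
  assumes \<kappa>: "rhom \<kappa>" and \<delta>: "deriv_over \<kappa> \<delta>"
  shows "\<delta> (bev \<kappa> u v p) = bev \<kappa> u v (dx p) * \<delta> u + bev \<kappa> u v (dy p) * \<delta> v"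
proof -
  note h = rhom_add[OF rhom_bev[OF \<kappa>]] rhom_mult[OF rhom_bev[OF \<kappa>]] rhom_1[OF rhom_bev[OF \<kappa>]]
  show ?thesis
    by (induction p rule: bpoly_induct)
      (use \<delta> in \<open>simp_all add: deriv_over_def h bev_const[OF \<kappa>] bev_x[OF \<kappa>] bev_y[OF \<kappa>] dx_add dx_mult
        pderiv_add pderiv_mult algebra_simps del: mult_pCons_left mult_pCons_right\<close>)
qed

lemma sub_var [simp]: "sub var_x var_y p = p"
  using rhom_eq_bev[OF _ rhom_kconst, of "\<lambda>p. p" p] by (simp add: rhom_def)

lemma derivation_formula:
  assumes "deriv_over (\<lambda>c. kconst c) \<delta>"
  shows "\<delta> p = dx p * \<delta> var_x + dy p * \<delta> var_y"
  using chain_rule[OF rhom_kconst assms, of var_x var_y p] by simp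

lemma is_derivation_deriv_over: assumes "is_derivation D" shows "deriv_over (\<lambda>c. kconst c) D"
proof -
  have "D (1 * 1) = 1 * D 1 + 1 * D 1" using assms unfolding is_derivation_def by blast
  then have "D 1 + D 1 = D 1 + 0" by simp
  then have "D 1 = 0" by (rule add_left_imp_eq)
  moreover have "D (kconst c * 1) = kconst c * D 1" for c using assms unfolding is_derivation_def by blast
  ultimately show ?thesis using assms by (simp add: deriv_over_def is_derivation_def)
qed

subsection \<open>Weighted degrees\<close>

text \<open>Substituting \<open>x T^\<alpha>\<close> and \<open>y T^\<beta>\<close> turns weighted degrees and weighted homogeneous components into
  degrees and coefficients of a univariate polynomial in \<open>T\<close>.\<close>

definition wt :: "nat \<Rightarrow> nat \<Rightarrow> 'a::field bpoly \<Rightarrow> 'a bpoly poly" where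
  "wt \<alpha> \<beta> = bev (\<lambda>c. [:kconst c:]) (monom var_x \<alpha>) (monom var_y \<beta>)"

lemma rhom_wt_const: "rhom (\<lambda>c. [:kconst c:])"
  by (auto simp: rhom_def one_pCons)

lemma rhom_wt: "rhom (wt \<alpha> \<beta>)"
  unfolding wt_def by (rule rhom_bev[OF rhom_wt_const])

lemma bcoeff_eqI: "(\<And>i j. bcoeff p i j = bcoeff q i j) \<Longrightarrow> p = q"
  by (auto simp: bcoeff_def poly_eq_iff)

lemma bcoeff_simps [simp]:
  "bcoeff 0 i j = 0" "bcoeff (p + q) i j = bcoeff p i j + bcoeff q i j"
  "bcoeff (p - q) i j = bcoeff p i j - bcoeff q i j" "bcoeff (- p) i j = - bcoeff p i j"
  by (auto simp: bcoeff_def)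

lemma bcoeff_x_mult: "bcoeff (var_x * p) i j = (if i = 0 then 0 else bcoeff p (i - 1) j)"
  by (auto simp: bcoeff_def coeff_pCons split: nat.splits)

lemma bcoeff_y_mult: "bcoeff (var_y * p) i j = (if j = 0 then 0 else bcoeff p i (j - 1))"
  by (auto simp: bcoeff_def coeff_pCons split: nat.splits)

lemma bcoeff_const_mult: "bcoeff (kconst c * p) i j = c * bcoeff p i j"
  by (auto simp: bcoeff_def)

lemma bcoeff_kconst: "bcoeff (kconst c) i j = (if i = 0 \<and> j = 0 then c else 0)"
  by (auto simp: bcoeff_def coeff_pCons split: nat.splits)

lemma bcoeff_pCons: "bcoeff (pCons c p) i j = (case j of 0 \<Rightarrow> coeff c i | Suc j \<Rightarrow> bcoeff p i j)"
  by (auto simp: bcoeff_def coeff_pCons split: nat.splits)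

lemma bcoeff_monom: "bcoeff (monom (monom c k) l) i j = (if i = k \<and> j = l then c else 0)"
  by (auto simp: bcoeff_def)

lemma bcoeff_wt:
  "bcoeff (coeff (wt \<alpha> \<beta> p) n) i j = (if \<alpha> * i + \<beta> * j = n then bcoeff p i j else 0)"
proof -
  have 1: "bcoeff (coeff (ev1 (\<lambda>c. [:kconst c:]) (monom var_x \<alpha>) q) n) i j =
      (if \<alpha> * i = n \<and> j = 0 then coeff q i else 0)" for q n i j
  proof (induction q arbitrary: n i j)
    case 0
    then show ?case by simp
  next
    case (pCons a q)
    show ?case
      by (cases i) (auto simp: ev1_pCons[OF rhom_wt_const] coeff_monom_mult bcoeff_x_mult pCons.IH coeff_pCons
          bcoeff_kconst simp del: mult_pCons_left split: nat.splits)
  qed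
  show ?thesis
  proof (induction p arbitrary: n i j)
    case 0
    then show ?case by (simp add: wt_def)
  next
    case (pCons q p)
    have "coeff (wt \<alpha> \<beta> (pCons q p)) n = coeff (ev1 (\<lambda>c. [:kconst c:]) (monom var_x \<alpha>) q) n +
        (if \<beta> \<le> n then var_y * coeff (wt \<alpha> \<beta> p) (n - \<beta>) else 0)"
      by (simp add: wt_def bev_pCons[OF rhom_wt_const] coeff_monom_mult)
    then show ?case
      by (cases j) (auto simp: 1 bcoeff_y_mult pCons.IH bcoeff_pCons simp del: mult_pCons_left)
  qed
qed

lemma wt_eq_0_iff [simp]: "wt \<alpha> \<beta> p = 0 \<longleftrightarrow> p = 0"
proof
  assume "wt \<alpha> \<beta> p = 0"
  then have "bcoeff (coeff (wt \<alpha> \<beta> p) (\<alpha> * i + \<beta> * j)) i j = 0" for i j by simp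
  then show "p = 0" by (intro bcoeff_eqI) (simp add: bcoeff_wt)
qed (simp add: rhom_0[OF rhom_wt])

lemma degree_wt_le_iff:
  "degree (wt \<alpha> \<beta> p) \<le> n \<longleftrightarrow> (\<forall>i j. bcoeff p i j \<noteq> 0 \<longrightarrow> \<alpha> * i + \<beta> * j \<le> n)"
proof
  assume n: "degree (wt \<alpha> \<beta> p) \<le> n"
  show "\<forall>i j. bcoeff p i j \<noteq> 0 \<longrightarrow> \<alpha> * i + \<beta> * j \<le> n"
  proof (intro allI impI)
    fix i j assume "bcoeff p i j \<noteq> 0"
    then have "bcoeff (coeff (wt \<alpha> \<beta> p) (\<alpha> * i + \<beta> * j)) i j \<noteq> 0" by (simp add: bcoeff_wt)
    then have "coeff (wt \<alpha> \<beta> p) (\<alpha> * i + \<beta> * j) \<noteq> 0" by auto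
    then show "\<alpha> * i + \<beta> * j \<le> n" using n le_degree by (meson le_trans)
  qed
next
  assume R: "\<forall>i j. bcoeff p i j \<noteq> 0 \<longrightarrow> \<alpha> * i + \<beta> * j \<le> n"
  show "degree (wt \<alpha> \<beta> p) \<le> n"
  proof (rule degree_le, intro allI impI)
    fix m assume "n < m"
    show "coeff (wt \<alpha> \<beta> p) m = 0"
      by (rule bcoeff_eqI) (use R \<open>n < m\<close> in \<open>auto simp: bcoeff_wt not_le[symmetric]\<close>)
  qed
qed

lemma finite_bsupport: "finite {(i, j). bcoeff p i j \<noteq> 0}"
proof (rule finite_subset)
  show "{(i, j). bcoeff p i j \<noteq> 0} \<subseteq> (\<Union>j\<in>{..degree p}. {..degree (coeff p j)} \<times> {j})"
    by (force simp: bcoeff_def intro: le_degree)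
qed auto

lemma total_deg_le_iff: "total_deg p \<le> n \<longleftrightarrow> (\<forall>i j. bcoeff p i j \<noteq> 0 \<longrightarrow> i + j \<le> n)"
proof -
  have "finite {i + j |i j. bcoeff p i j \<noteq> 0}"
    using finite_imageI[OF finite_bsupport[of p], of "\<lambda>(i, j). i + j"]
    by (rule rev_finite_subset) auto
  then show ?thesis unfolding total_deg_def by auto
qed

lemma total_deg_wt: "total_deg p = degree (wt 1 1 p)"
proof (rule antisym)
  show "total_deg p \<le> degree (wt 1 1 p)"
    unfolding total_deg_le_iff using degree_wt_le_iff[of 1 1 p "degree (wt 1 1 p)"] by simp
  show "degree (wt 1 1 p) \<le> total_deg p"
    unfolding degree_wt_le_iff using total_deg_le_iff[of p "total_deg p"] by simp
qed

lemma total_deg_mult: "p \<noteq> 0 \<Longrightarrow> q \<noteq> 0 \<Longrightarrow> total_deg (p * q) = total_deg p + total_deg q"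
  by (simp add: total_deg_wt rhom_mult[OF rhom_wt] degree_mult_eq)

lemma total_deg_mult_le: "total_deg (p * q) \<le> total_deg p + total_deg q"
  by (simp add: total_deg_wt rhom_mult[OF rhom_wt] degree_mult_le)

lemma total_deg_power: "p \<noteq> 0 \<Longrightarrow> total_deg (p ^ n) = n * total_deg p"
  by (simp add: total_deg_wt rhom_power[OF rhom_wt] degree_power_eq)

lemma total_deg_power_le: "total_deg (p ^ n) \<le> n * total_deg p"
  using degree_power_le[of "wt 1 1 p" n] by (simp add: total_deg_wt rhom_power[OF rhom_wt] mult.commute)

lemma total_deg_add_le: "total_deg p \<le> n \<Longrightarrow> total_deg q \<le> n \<Longrightarrow> total_deg (p + q) \<le> n"
  by (simp add: total_deg_wt rhom_add[OF rhom_wt] degree_add_le)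

lemma total_deg_diff_le: "total_deg p \<le> n \<Longrightarrow> total_deg q \<le> n \<Longrightarrow> total_deg (p - q) \<le> n"
  by (simp add: total_deg_wt rhom_diff[OF rhom_wt] degree_diff_le)

lemma total_deg_const [simp]: "total_deg (kconst c) = 0"
  using total_deg_le_iff[of "kconst c" 0] by (auto simp: bcoeff_kconst split: if_splits)

lemma total_deg_0_iff: "total_deg p = 0 \<longleftrightarrow> p \<in> range kconst"
proof
  assume "total_deg p = 0"
  then have "\<forall>i j. bcoeff p i j \<noteq> 0 \<longrightarrow> i + j \<le> 0" using total_deg_le_iff[of p 0] by simp
  then have "p = kconst (bcoeff p 0 0)" by (intro bcoeff_eqI) (auto simp: bcoeff_kconst)
  then show "p \<in> range kconst" by blast
qed auto

lemma bcoeff_total_deg: "bcoeff p i j \<noteq> 0 \<Longrightarrow> i + j \<le> total_deg p"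
  using total_deg_le_iff[of p "total_deg p"] by auto

lemma total_deg_x [simp]: "total_deg (var_x :: 'a::field bpoly) = 1"
  and total_deg_y [simp]: "total_deg (var_y :: 'a bpoly) = 1"
proof -
  have "total_deg (var_x :: 'a bpoly) \<le> 1" "total_deg (var_y :: 'a bpoly) \<le> 1"
    unfolding total_deg_le_iff by (auto simp: bcoeff_def coeff_pCons split: nat.splits if_splits)
  moreover have "1 \<le> total_deg (var_x :: 'a bpoly)" using bcoeff_total_deg[of "var_x :: 'a bpoly" 1 0] by (simp add: bcoeff_def)
  moreover have "1 \<le> total_deg (var_y :: 'a bpoly)" using bcoeff_total_deg[of "var_y :: 'a bpoly" 0 1] by (simp add: bcoeff_def)
  ultimately show "total_deg (var_x :: 'a bpoly) = 1" "total_deg (var_y :: 'a bpoly) = 1" by auto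
qed

subsection \<open>Locally nilpotent derivations\<close>

definition deriv :: "('b::comm_ring_1 \<Rightarrow> 'b) \<Rightarrow> bool" where
  "deriv \<delta> \<longleftrightarrow> (\<forall>p q. \<delta> (p + q) = \<delta> p + \<delta> q) \<and> (\<forall>p q. \<delta> (p * q) = p * \<delta> q + q * \<delta> p)"

lemma deriv_add: "deriv \<delta> \<Longrightarrow> \<delta> (p + q) = \<delta> p + \<delta> q"
  and deriv_mult: "deriv \<delta> \<Longrightarrow> \<delta> (p * q) = p * \<delta> q + q * \<delta> p"
  by (auto simp: deriv_def)

lemma deriv_overD: "deriv_over \<kappa> \<delta> \<Longrightarrow> deriv \<delta>"
  by (auto simp: deriv_over_def deriv_def)

lemma deriv_0: assumes "deriv \<delta>" shows "\<delta> 0 = 0"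
  using deriv_add[OF assms, of 0 0] by simp

lemma deriv_1: assumes "deriv \<delta>" shows "\<delta> 1 = 0"
proof -
  have "\<delta> 1 + \<delta> 1 = \<delta> 1 + 0" using deriv_mult[OF assms, of 1 1] by simp
  then show ?thesis by (rule add_left_imp_eq)
qed

lemma deriv_uminus: assumes "deriv \<delta>" shows "\<delta> (- p) = - \<delta> p"
  using deriv_add[OF assms, of p "- p"] deriv_0[OF assms] by (simp add: eq_neg_iff_add_eq_0 add.commute)

lemma deriv_diff: assumes "deriv \<delta>" shows "\<delta> (p - q) = \<delta> p - \<delta> q"
  using deriv_add[OF assms, of p "- q"] deriv_uminus[OF assms] by simp

lemma deriv_power: assumes "deriv \<delta>" shows "\<delta> (p ^ n) = of_nat n * p ^ (n - 1) * \<delta> p"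
proof (induction n)
  case (Suc n)
  then show ?case by (cases n) (auto simp: deriv_mult[OF assms] deriv_1[OF assms] algebra_simps)
qed (simp add: deriv_1[OF assms])

lemma deriv_funpow_add: assumes "deriv \<delta>" shows "(\<delta> ^^ n) (p + q) = (\<delta> ^^ n) p + (\<delta> ^^ n) q"
  by (induction n) (auto simp: deriv_add[OF assms])

lemma deriv_funpow_0: assumes "deriv \<delta>" shows "(\<delta> ^^ n) 0 = 0"
  by (induction n) (auto simp: deriv_0[OF assms])

lemma deriv_funpow_mono: assumes "deriv \<delta>" "(\<delta> ^^ n) p = 0" "n \<le> m" shows "(\<delta> ^^ m) p = 0"
proof -
  have "(\<delta> ^^ (m - n + n)) p = 0" using assms(2) by (simp only: funpow_add o_apply deriv_funpow_0[OF assms(1)])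
  then show ?thesis using assms(3) by simp
qed

lemma funpow_mult_eq_0:
  assumes d: "deriv \<delta>"
  shows "(\<delta> ^^ m) p = 0 \<Longrightarrow> (\<delta> ^^ n) q = 0 \<Longrightarrow> (\<delta> ^^ (m + n)) (p * q) = 0"
proof (induction "m + n" arbitrary: m n p q)
  case 0
  then show ?case by simp
next
  case (Suc k)
  show ?case
  proof (cases "m = 0 \<or> n = 0")
    case True
    then show ?thesis using Suc.prems by (auto simp: deriv_funpow_0[OF d])
  next
    case False
    then obtain m' n' where mn: "m = Suc m'" "n = Suc n'" by (meson not0_implies_Suc)
    then have k: "m + n' = k" "m' + n = k" using Suc(2) by auto
    have "(\<delta> ^^ (m + n)) (p * q) = (\<delta> ^^ k) (p * \<delta> q + q * \<delta> p)"
      by (simp only: flip: Suc(2)) (simp only: funpow_Suc_right o_apply deriv_mult[OF d])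
    also have "\<dots> = (\<delta> ^^ (m + n')) (p * \<delta> q) + (\<delta> ^^ (m' + n)) (\<delta> p * q)"
      by (simp only: deriv_funpow_add[OF d] k mult.commute[of q])
    also have "(\<delta> ^^ (m + n')) (p * \<delta> q) = 0"
      by (rule Suc(1)) (use Suc(2-4) mn in \<open>auto simp: funpow_swap1\<close>)
    also have "(\<delta> ^^ (m' + n)) (\<delta> p * q) = 0"
      by (rule Suc(1)) (use Suc(2-4) mn in \<open>auto simp: funpow_swap1\<close>)
    finally show ?thesis by simp
  qed
qed

text \<open>A single term of Leibniz's formula survives; the induction step is Pascal's rule for its
  binomial coefficient.\<close>

lemma funpow_mult_lead:
  assumes d: "deriv \<delta>"
  shows "(\<delta> ^^ Suc m) p = 0 \<Longrightarrow> (\<delta> ^^ Suc n) q = 0 \<Longrightarrow>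
    (\<delta> ^^ (m + n)) (p * q) = of_nat ((m + n) choose m) * ((\<delta> ^^ m) p * (\<delta> ^^ n) q)"
proof (induction "m + n" arbitrary: m n p q)
  case 0
  then show ?case by simp
next
  case (Suc k)
  have const: "(\<delta> ^^ n) (p * q) = p * (\<delta> ^^ n) q" if "\<delta> p = 0" for n p q
    by (induction n) (auto simp: that deriv_mult[OF d])
  show ?case
  proof (cases "m = 0 \<or> n = 0")
    case True
    then show ?thesis using Suc.prems const[of p n q] const[of q m p] by (auto simp: mult.commute)
  next
    case False
    then obtain m' n' where mn: "m = Suc m'" "n = Suc n'" by (meson not0_implies_Suc)
    then have k: "m + n' = k" "m' + n = k" using Suc(2) by auto
    have "(\<delta> ^^ (m + n)) (p * q) = (\<delta> ^^ k) (p * \<delta> q + q * \<delta> p)"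
      by (simp only: flip: Suc(2)) (simp only: funpow_Suc_right o_apply deriv_mult[OF d])
    also have "\<dots> = (\<delta> ^^ (m + n')) (p * \<delta> q) + (\<delta> ^^ (m' + n)) (\<delta> p * q)"
      by (simp only: deriv_funpow_add[OF d] k mult.commute[of q])
    also have "(\<delta> ^^ (m + n')) (p * \<delta> q) = of_nat ((m + n') choose m) * ((\<delta> ^^ m) p * (\<delta> ^^ n') (\<delta> q))"
      by (rule Suc(1)) (use Suc(2-4) mn in \<open>auto simp: funpow_swap1\<close>)
    also have "(\<delta> ^^ (m' + n)) (\<delta> p * q) = of_nat ((m' + n) choose m') * ((\<delta> ^^ m') (\<delta> p) * (\<delta> ^^ n) q)"
      by (rule Suc(1)) (use Suc(2-4) mn in \<open>auto simp: funpow_swap1\<close>)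
    finally show ?thesis using mn by (simp add: funpow_swap1 algebra_simps)
  qed
qed

text \<open>In a domain of characteristic zero the surviving Leibniz term is nonzero, so nilpotency
  orders add up under products. Hence, for locally nilpotent \<delta>, factors of a nonzero element
  killed by \<delta> are killed too.\<close>

lemma order_mult_nonzero:
  fixes \<delta> :: "'b::{idom,ring_char_0} \<Rightarrow> 'b"
  assumes "deriv \<delta>" "(\<delta> ^^ m) p \<noteq> 0" "(\<delta> ^^ Suc m) p = 0" "(\<delta> ^^ n) q \<noteq> 0" "(\<delta> ^^ Suc n) q = 0"
  shows "(\<delta> ^^ (m + n)) (p * q) \<noteq> 0"
  using funpow_mult_lead[OF assms(1,3,5)] assms(2,4) by (simp del: funpow.simps add: binomial_eq_0_iff)

lemma nilpotent_order:
  fixes \<delta> :: "'b::zero \<Rightarrow> 'b"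
  assumes "(\<delta> ^^ k) p = 0" "p \<noteq> 0"
  obtains m where "(\<delta> ^^ m) p \<noteq> 0" "(\<delta> ^^ Suc m) p = 0"
proof -
  define K where "K = (LEAST k. (\<delta> ^^ k) p = 0)"
  have K: "(\<delta> ^^ K) p = 0" unfolding K_def by (rule LeastI[of _ k]) (rule assms(1))
  obtain m where m: "K = Suc m" using K assms(2) by (cases K) auto
  then have "(\<delta> ^^ m) p \<noteq> 0" using not_less_Least[of m "\<lambda>k. (\<delta> ^^ k) p = 0"] by (simp add: K_def)
  then show ?thesis using that K m by blast
qed

lemma locally_nilpotentI:
  fixes \<delta> :: "'a::field bpoly \<Rightarrow> 'a bpoly"
  assumes d: "deriv_over (\<lambda>c. kconst c) \<delta>" and "(\<delta> ^^ m) var_x = 0" "(\<delta> ^^ n) var_y = 0"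
  shows "\<exists>k. (\<delta> ^^ k) p = 0"
proof (induction p rule: bpoly_induct)
  case (const c)
  have "(\<delta> ^^ 1) (kconst c) = 0" using d by (simp add: deriv_over_def)
  then show ?case by blast
next
  case (add p q)
  then obtain k l where "(\<delta> ^^ k) p = 0" "(\<delta> ^^ l) q = 0" by auto
  then have "(\<delta> ^^ (max k l)) (p + q) = 0"
    using deriv_funpow_mono[OF deriv_overD[OF d]] by (simp add: deriv_funpow_add[OF deriv_overD[OF d]])
  then show ?case by blast
next
  case (mult p q)
  then show ?case using funpow_mult_eq_0[OF deriv_overD[OF d]] by blast
qed (use assms in auto)

subsection \<open>Jacobian derivations\<close>

definition jac :: "'a::field bpoly \<Rightarrow> 'a bpoly \<Rightarrow> 'a bpoly" where
  "jac p q = dx p * dy q - dy p * dx q"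

lemma deriv_jac: "deriv_over (\<lambda>c. kconst c) (jac u)"
  by (auto simp: deriv_over_def jac_def dx_add dx_mult pderiv_add pderiv_mult algebra_simps
      simp del: mult_pCons_left mult_pCons_right)

lemma jac_self [simp]: "jac u u = 0"
  by (simp add: jac_def)

lemma jac_aut:
  assumes "is_aut \<rho>"
  shows "jac (\<rho> p) (\<rho> q) = \<rho> (jac p q) * jac (\<rho> var_x) (\<rho> var_y)"
proof -
  define u v where uv: "u = \<rho> var_x" "v = \<rho> var_y"
  note s = is_aut_sub[OF assms, folded uv]
  have ring: "(A * ux + B * vx) * (C * uy + E * vy) - (A * uy + B * vy) * (C * ux + E * vx) =
      (A * E - B * C) * (ux * vy - uy * vx)" for A B C E ux uy vx vy :: "'a bpoly"
    by (simp add: algebra_simps)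
  show ?thesis
    unfolding jac_def s[of p] s[of q] s[of "dx p * dy q - dy p * dx q"] uv[symmetric]
    unfolding chain_rule[OF rhom_kconst deriv_dx] chain_rule[OF rhom_kconst deriv_dy]
      rhom_diff[OF rhom_sub] rhom_mult[OF rhom_sub] by (rule ring)
qed

text \<open>The chain rule for \<rho> and its inverse exhibits the Jacobian of \<rho> as a factor of
  1, and units of k[x,y] have total degree 0.\<close>

lemma jac_aut_const:
  assumes "is_aut \<rho>"
  obtains c where "c \<noteq> 0" "jac (\<rho> var_x) (\<rho> var_y) = kconst c"
proof -
  have "jac (\<rho> (ainv \<rho> var_x)) (\<rho> (ainv \<rho> var_y)) = (1 :: 'a bpoly)"
    by (simp only: is_aut_inv_simps[OF assms] jac_def) simp
  then have 1: "\<rho> (jac (ainv \<rho> var_x) (ainv \<rho> var_y)) * jac (\<rho> var_x) (\<rho> var_y) = 1" (is "?A * ?B = 1")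
    by (simp only: jac_aut[OF assms, of "ainv \<rho> var_x"])
  then have nz: "?A \<noteq> 0" "?B \<noteq> 0" by auto
  have "total_deg (?A * ?B) = 0"
    by (simp only: 1) (simp add: one_pCons)
  then have "total_deg ?B = 0" by (simp only: total_deg_mult[OF nz] add_is_0)
  then have "?B \<in> range kconst" by (simp add: total_deg_0_iff)
  then show ?thesis using that nz by auto
qed

lemma dy_nilpotent: "\<exists>n. (dy ^^ n) p = 0"
proof -
  have "degree p < n \<Longrightarrow> (pderiv ^^ n) p = 0" for n and p :: "'b::idom poly"
  proof (induction n arbitrary: p)
    case (Suc n)
    show ?case
    proof (cases "degree p = 0")
      case True
      then have "pderiv p = 0" by (metis degree_eq_zeroE pderiv_pCons pderiv_0 add_0 pCons_0_0)
      then show ?thesis by (simp only: funpow_Suc_right o_apply) (simp add: deriv_funpow_0 deriv_def pderiv_add pderiv_mult)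
    next
      case False
      have "degree (pderiv p) \<le> degree p - 1"
        by (rule degree_le) (simp add: coeff_pderiv coeff_eq_0)
      then have "(pderiv ^^ n) (pderiv p) = 0" using Suc False by (intro Suc.IH) auto
      then show ?thesis by (simp only: funpow_Suc_right o_apply)
    qed
  qed simp
  then show ?thesis by blast
qed

text \<open>In the coordinates \<open>\<rho> x\<close>, \<open>\<rho> y\<close> this derivation is a
  constant times the partial derivative along the second one.\<close>

lemma jac_coordinate_nilpotent:
  assumes "is_aut \<rho>"
  shows "\<exists>n. (jac (\<rho> var_x) ^^ n) p = 0"
proof -
  obtain c where c: "jac (\<rho> var_x) (\<rho> var_y) = kconst c" using jac_aut_const[OF assms] by blast
  have step: "jac (\<rho> var_x) (\<rho> q) = kconst c * \<rho> (dy q)" for q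
  proof -
    have "jac var_x q = dy q" by (simp add: jac_def)
    then show ?thesis using jac_aut[OF assms, of var_x q] c by (simp only: mult.commute)
  qed
  have smult: "jac w (kconst c * q) = kconst c * jac w q" for w q
    using deriv_jac[of w] by (simp add: deriv_over_def del: mult_pCons_left mult_pCons_right)
  have "(jac (\<rho> var_x) ^^ n) (\<rho> q) = kconst c ^ n * \<rho> ((dy ^^ n) q)" for n q
  proof (induction n arbitrary: q)
    case (Suc n)
    have "(jac (\<rho> var_x) ^^ n) (kconst c * q) = kconst c * (jac (\<rho> var_x) ^^ n) q" for q
      by (induction n) (simp_all add: smult del: mult_pCons_left mult_pCons_right)
    then show ?case
      by (simp only: funpow_Suc_right o_apply step Suc) (simp add: mult.assoc del: mult_pCons_left mult_pCons_right)
  qed simp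
  moreover obtain n where "(dy ^^ n) (ainv \<rho> p) = 0" using dy_nilpotent by blast
  ultimately have "(jac (\<rho> var_x) ^^ n) (\<rho> (ainv \<rho> p)) = 0" by (simp add: rhom_0[OF is_aut_rhom[OF assms]])
  then show ?thesis by (auto simp: is_aut_inv_simps[OF assms])
qed

lemma coeff_mult_top:
  assumes "degree A \<le> m" "degree B \<le> n"
  shows "coeff (A * B) (m + n) = coeff A m * coeff B n"
proof -
  have "coeff (A * B) (m + n) = (\<Sum>i\<le>m + n. coeff A i * coeff B (m + n - i))" by (simp add: coeff_mult)
  also have "\<dots> = (\<Sum>i\<in>{m}. coeff A i * coeff B (m + n - i))"
  proof (rule sum.mono_neutral_right)
    show "\<forall>i\<in>{..m + n} - {m}. coeff A i * coeff B (m + n - i) = 0"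
    proof
      fix i assume "i \<in> {..m + n} - {m}"
      then have "i > m \<or> m + n - i > n" by auto
      then have "coeff A i = 0 \<or> coeff B (m + n - i) = 0" using assms by (auto intro: coeff_eq_0)
      then show "coeff A i * coeff B (m + n - i) = 0" by auto
    qed
  qed auto
  finally show ?thesis by simp
qed

text \<open>A partial derivative lowers weights by the weight of its variable; the power of T on the
  right makes up for it.\<close>

lemma wt_dx: "map_poly dx (wt \<alpha> \<beta> p) = wt \<alpha> \<beta> (dx p) * monom 1 \<alpha>"
  and wt_dy: "map_poly dy (wt \<alpha> \<beta> p) = wt \<alpha> \<beta> (dy p) * monom 1 \<beta>"
proof -
  have "deriv_over (\<lambda>c. [:kconst c:]) (map_poly (dx :: 'a bpoly \<Rightarrow> _))"
    using map_poly_derivation_mult[of "dx :: 'a bpoly \<Rightarrow> _", OF dx_add dx_mult] by (auto simp: deriv_over_def map_poly_pCons)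
  from chain_rule[OF rhom_wt_const this]
  show "map_poly dx (wt \<alpha> \<beta> p) = wt \<alpha> \<beta> (dx p) * monom 1 \<alpha>"
    by (simp add: wt_def map_poly_monom)
  have "deriv_over (\<lambda>c. [:kconst c:]) (map_poly (dy :: 'a bpoly \<Rightarrow> _))"
    using map_poly_derivation_mult[of "dy :: 'a bpoly \<Rightarrow> _", OF pderiv_add pderiv_mult[unfolded mult.commute[of "pderiv _"]]]
    by (auto simp: deriv_over_def map_poly_pCons)
  from chain_rule[OF rhom_wt_const this]
  show "map_poly dy (wt \<alpha> \<beta> p) = wt \<alpha> \<beta> (dy p) * monom 1 \<beta>"
    by (simp add: wt_def map_poly_monom)
qed

text \<open>Top components multiply, so the Jacobian of the top components is the component of
  \<open>jac u p\<close> of weight \<open>W + n - (\<alpha> + \<beta>)\<close>, with nothing above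
  it. The power of T in \<open>F\<close> postpones this subtraction until \<open>nz\<close> has
  shown that it is exact.\<close>

lemma wt_jac_top:
  assumes "degree (wt \<alpha> \<beta> u) \<le> W" "degree (wt \<alpha> \<beta> p) \<le> n"
    and nz: "jac (coeff (wt \<alpha> \<beta> u) W) (coeff (wt \<alpha> \<beta> p) n) \<noteq> 0"
  obtains n' where "degree (wt \<alpha> \<beta> (jac u p)) \<le> n'"
    "coeff (wt \<alpha> \<beta> (jac u p)) n' = jac (coeff (wt \<alpha> \<beta> u) W) (coeff (wt \<alpha> \<beta> p) n)"
proof -
  define F where "F = monom 1 (\<alpha> + \<beta>) * wt \<alpha> \<beta> (jac u p)"
  have m: "monom 1 (\<alpha> + \<beta>) = monom 1 \<alpha> * monom (1 :: 'a bpoly) \<beta>" by (simp add: mult_monom)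
  have F: "F = map_poly dx (wt \<alpha> \<beta> u) * map_poly dy (wt \<alpha> \<beta> p) - map_poly dy (wt \<alpha> \<beta> u) * map_poly dx (wt \<alpha> \<beta> p)"
    unfolding F_def jac_def wt_dx wt_dy m
    by (simp add: rhom_diff[OF rhom_wt] rhom_mult[OF rhom_wt] algebra_simps)
  have deg: "degree (map_poly dx (wt \<alpha> \<beta> u)) \<le> W" "degree (map_poly dy (wt \<alpha> \<beta> u)) \<le> W"
    "degree (map_poly dx (wt \<alpha> \<beta> p)) \<le> n" "degree (map_poly dy (wt \<alpha> \<beta> p)) \<le> n"
    using assms(1,2) by (meson map_poly_degree_leq le_trans)+
  have "degree F \<le> W + n" unfolding F
    by (intro degree_diff_le order.trans[OF degree_mult_le] add_mono deg)
  have c: "coeff F (W + n) = jac (coeff (wt \<alpha> \<beta> u) W) (coeff (wt \<alpha> \<beta> p) n)"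
    unfolding F coeff_diff coeff_mult_top[OF deg(1,4)] coeff_mult_top[OF deg(2,3)]
    by (simp add: jac_def coeff_map_poly)
  with nz have le: "\<alpha> + \<beta> \<le> W + n" by (auto simp: F_def coeff_monom_mult split: if_splits)
  show ?thesis
  proof (rule that)
    show "coeff (wt \<alpha> \<beta> (jac u p)) (W + n - (\<alpha> + \<beta>)) = jac (coeff (wt \<alpha> \<beta> u) W) (coeff (wt \<alpha> \<beta> p) n)"
      using c le by (simp add: F_def coeff_monom_mult)
    show "degree (wt \<alpha> \<beta> (jac u p)) \<le> W + n - (\<alpha> + \<beta>)"
    proof (cases "wt \<alpha> \<beta> (jac u p) = 0")
      case False
      then have "degree F = \<alpha> + \<beta> + degree (wt \<alpha> \<beta> (jac u p))" unfolding F_def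
        by (subst degree_mult_eq) (auto simp: degree_monom_eq simp del: wt_eq_0_iff)
      then show ?thesis using \<open>degree F \<le> W + n\<close> by simp
    qed (simp add: rhom_0[OF rhom_wt])
  qed
qed

text \<open>As long as the iterates on the top form are nonzero, they are the top components of the
  iterates of \<open>jac u\<close>. A nonzero k-th one would contradict the vanishing of the k-th
  iterate on p.\<close>

lemma top_form_nilpotent:
  assumes u: "degree (wt \<alpha> \<beta> u) \<le> W" and p: "degree (wt \<alpha> \<beta> p) \<le> n"
    and k: "(jac u ^^ k) p = 0"
  shows "(jac (coeff (wt \<alpha> \<beta> u) W) ^^ k) (coeff (wt \<alpha> \<beta> p) n) = 0"
proof (rule ccontr)
  let ?\<delta> = "jac (coeff (wt \<alpha> \<beta> u) W)" and ?P = "coeff (wt \<alpha> \<beta> p) n"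
  assume nz: "(?\<delta> ^^ k) ?P \<noteq> 0"
  have "\<exists>n. degree (wt \<alpha> \<beta> ((jac u ^^ l) p)) \<le> n \<and> coeff (wt \<alpha> \<beta> ((jac u ^^ l) p)) n = (?\<delta> ^^ l) ?P" if "l \<le> k" for l
    using that
  proof (induction l)
    case 0
    then show ?case using p by auto
  next
    case (Suc l)
    then obtain n where n: "degree (wt \<alpha> \<beta> ((jac u ^^ l) p)) \<le> n" "coeff (wt \<alpha> \<beta> ((jac u ^^ l) p)) n = (?\<delta> ^^ l) ?P"
      by auto
    have "(?\<delta> ^^ Suc l) ?P \<noteq> 0"
      using nz deriv_funpow_mono[OF deriv_overD[OF deriv_jac], of "Suc l" _ ?P k] Suc.prems by blast
    then show ?case using wt_jac_top[OF u n(1)] n(2) by (metis funpow.simps(2) o_apply)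
  qed
  from this[OF order.refl] show False using nz k by (auto simp: rhom_0[OF rhom_wt])
qed

subsection \<open>The Newton polygon of a coordinate\<close>

definition degx :: "'a::field bpoly \<Rightarrow> nat" where "degx p = degree (wt 1 0 p)"

definition degy :: "'a::field bpoly \<Rightarrow> nat" where "degy p = degree (wt 0 1 p)"

lemma degx_le_iff: "degx p \<le> n \<longleftrightarrow> (\<forall>i j. bcoeff p i j \<noteq> 0 \<longrightarrow> i \<le> n)"
  and degy_le_iff: "degy p \<le> n \<longleftrightarrow> (\<forall>i j. bcoeff p i j \<noteq> 0 \<longrightarrow> j \<le> n)"
  by (simp_all only: degx_def degy_def degree_wt_le_iff) simp_all

lemma wt_attained:
  assumes "p \<noteq> 0"
  obtains i j where "bcoeff p i j \<noteq> 0" "\<alpha> * i + \<beta> * j = degree (wt \<alpha> \<beta> p)"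
proof -
  have "coeff (wt \<alpha> \<beta> p) (degree (wt \<alpha> \<beta> p)) \<noteq> 0" using assms by simp
  then obtain i j where "bcoeff (coeff (wt \<alpha> \<beta> p) (degree (wt \<alpha> \<beta> p))) i j \<noteq> 0"
    using bcoeff_eqI[of _ 0] by (metis bcoeff_simps(1))
  then show ?thesis using that by (auto simp: bcoeff_wt split: if_splits)
qed

lemma wt_le: "bcoeff p i j \<noteq> 0 \<Longrightarrow> \<alpha> * i + \<beta> * j \<le> degree (wt \<alpha> \<beta> p)"
  using degree_wt_le_iff[of \<alpha> \<beta> p "degree (wt \<alpha> \<beta> p)"] by auto

section \<open>Divisibility by the variables x and y\<close>

lemma y_dvd_iff: "var_y dvd p \<longleftrightarrow> coeff p 0 = 0"
  using poly_eq_0_iff_dvd[of p 0] by (simp add: poly_0_coeff_0)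

lemma x_dvd_iff: "var_x dvd p \<longleftrightarrow> (\<forall>j. bcoeff p 0 j = 0)"
proof -
  have "[:0, 1:] dvd coeff p j \<longleftrightarrow> bcoeff p 0 j = 0" for j
    using poly_eq_0_iff_dvd[of "coeff p j" 0] by (simp add: poly_0_coeff_0 bcoeff_def)
  then show ?thesis by (simp add: const_poly_dvd_iff)
qed

lemma y_dvd_iff': "var_y dvd p \<longleftrightarrow> (\<forall>i. bcoeff p i 0 = 0)"
  by (auto simp: y_dvd_iff bcoeff_def poly_eq_iff)

lemma prime_x: "prime_elem (var_x :: 'a::field bpoly)"
  by (intro lift_prime_elem_poly field_poly_irreducible_imp_prime irreducible_linear_field_poly) simp

lemma prime_y: "prime_elem (var_y :: 'a::field bpoly)"
proof (rule prime_elemI)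
  fix p q :: "'a bpoly" assume "var_y dvd p * q"
  then show "var_y dvd p \<or> var_y dvd q" by (simp add: y_dvd_iff coeff_mult_0)
qed (auto simp: y_dvd_iff)

lemma x_not_dvd_y_power: "\<not> var_x dvd (var_y :: 'a::field bpoly) ^ n"
proof
  assume "var_x dvd (var_y :: 'a bpoly) ^ n"
  then have "var_x dvd (var_y :: 'a bpoly)" using prime_x prime_elem_dvd_power by blast
  then have "bcoeff (var_y :: 'a bpoly) 0 1 = 0" using x_dvd_iff by blast
  then show False by (simp add: bcoeff_def)
qed

lemma y_not_dvd_x_power: "\<not> var_y dvd (var_x :: 'a::field bpoly) ^ n"
proof
  assume "var_y dvd (var_x :: 'a bpoly) ^ n"
  then have "var_y dvd (var_x :: 'a bpoly)" using prime_y prime_elem_dvd_power by blast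
  then show False by (simp add: y_dvd_iff)
qed

lemma x_power_y_power: "(var_x :: 'a::field bpoly) ^ i * var_y ^ j = monom (monom 1 i) j"
proof -
  have "(var_x :: 'a bpoly) ^ i = [:monom 1 i:]"
    by (induction i) (auto simp: monom_Suc one_pCons monom_0)
  moreover have "(var_y :: 'a bpoly) ^ j = monom 1 j"
    by (simp add: monom_altdef)
  ultimately show ?thesis by (simp add: smult_monom)
qed

text \<open>The top form \<open>U\<close> of \<open>u\<close> for the weights \<open>(b, a)\<close> again has a locally nilpotent Jacobian derivation.
  Factors of \<open>U\<close> are constants of that derivation, which forces \<open>U\<close> to join \<open>x^a\<close> to \<open>y^b\<close>
  and to be divisible by some \<open>y^r - \<mu> x^s\<close>; and \<open>r, s \<ge> 2\<close> would give \<open>y | \<delta> x\<close> and \<open>x | \<delta> y\<close>.\<close>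

lemma newton_edge:
  fixes u :: "'a::{alg_closed_field, field_char_0} bpoly"
  assumes nil: "\<And>p. \<exists>n. (jac u ^^ n) p = 0"
    and a: "degx u = a" "a \<ge> 1" and b: "degy u = b" "b \<ge> 1" and ab: "a \<ge> b"
  obtains s \<mu> where "a = b * s" "s \<ge> 1" "\<mu> \<noteq> 0" "\<And>i j. bcoeff u i j \<noteq> 0 \<Longrightarrow> i + s * j \<le> a"
    "(\<Sum>k\<le>b. bcoeff u (s * (b - k)) k * \<mu> ^ k) = 0"
proof -
  note a = a[unfolded degx_def] and b = b[unfolded degy_def]
  \<comment> \<open>For the weights (b, a) the points (a, 0) and (0, b) both have weight a b, which
    is the value expected for W; at this stage W is only known to be at least that.\<close>
  define W where "W = degree (wt b a u)"
  define U where "U = coeff (wt b a u) W"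
  define \<delta> where "\<delta> = jac U"
  have u0: "u \<noteq> 0" using a by (auto simp: rhom_0[OF rhom_wt])
  have U: "bcoeff U i j = (if b * i + a * j = W then bcoeff u i j else 0)" for i j
    unfolding U_def by (rule bcoeff_wt)
  have U0: "U \<noteq> 0" using u0 by (simp add: U_def W_def)
  have le_a: "i \<le> a" and le_b: "j \<le> b" and le_W: "b * i + a * j \<le> W" if "bcoeff u i j \<noteq> 0" for i j
    using wt_le[OF that, of 1 0] wt_le[OF that, of 0 1] wt_le[OF that, of b a] a b by (auto simp: W_def)
  obtain i0 where i0: "bcoeff u i0 b \<noteq> 0"
    using wt_attained[OF u0, of 0 1] b by auto
  obtain j0 where j0: "bcoeff u a j0 \<noteq> 0"
    using wt_attained[OF u0, of 1 0] a by auto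
  have W_ge: "a * b \<le> W" using le_W[OF i0] by (simp add: mult.commute)
  note d\<delta> = deriv_jac[of U, folded \<delta>_def]
  note d = deriv_overD[OF d\<delta>]
  have \<delta>x: "\<delta> var_x = - dy U" and \<delta>y: "\<delta> var_y = dx U"
    by (simp_all add: \<delta>_def jac_def)
  obtain kx where kx: "(\<delta> ^^ kx) var_x = 0"
  proof -
    obtain k where "(jac u ^^ k) var_x = 0" using nil by blast
    from top_form_nilpotent[OF _ _ this, of b a W b]
    show ?thesis using that by (auto simp: W_def U_def \<delta>_def wt_def bev_x[OF rhom_wt_const] degree_monom_le)
  qed
  obtain ky where ky: "(\<delta> ^^ ky) var_y = 0"
  proof -
    obtain k where "(jac u ^^ k) var_y = 0" using nil by blast
    from top_form_nilpotent[OF _ _ this, of b a W a]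
    show ?thesis using that by (auto simp: W_def U_def \<delta>_def wt_def bev_y[OF rhom_wt_const] degree_monom_le)
  qed
  have ord: "\<exists>m. (\<delta> ^^ m) p \<noteq> 0 \<and> (\<delta> ^^ Suc m) p = 0" if "p \<noteq> 0" for p
    using locally_nilpotentI[OF d\<delta> kx ky] nilpotent_order[OF _ that] by metis
  obtain m where m: "(\<delta> ^^ m) var_x \<noteq> 0" "(\<delta> ^^ Suc m) var_x = 0" using ord[of var_x] by auto
  obtain n where n: "(\<delta> ^^ n) var_y \<noteq> 0" "(\<delta> ^^ Suc n) var_y = 0" using ord[of var_y] by auto
  \<comment> \<open>The orders of p and q add up to that of U, which is 0 because
    \<open>\<delta> U = 0\<close>.\<close>
  have factor: "\<delta> p = 0" if "p * q = U" for p q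
  proof -
    have "p \<noteq> 0" "q \<noteq> 0" using that U0 by auto
    then obtain k l where k: "(\<delta> ^^ k) p \<noteq> 0" "(\<delta> ^^ Suc k) p = 0" and l: "(\<delta> ^^ l) q \<noteq> 0" "(\<delta> ^^ Suc l) q = 0"
      using ord by metis
    from order_mult_nonzero[OF d k l] have "(\<delta> ^^ (k + l)) U \<noteq> 0" unfolding that .
    moreover have "(\<delta> ^^ 1) U = 0" by (simp add: \<delta>_def)
    ultimately have "k + l = 0" using deriv_funpow_mono[OF d, of 1 U "k + l"]
      by (metis One_nat_def Suc_leI neq0_conv)
    then show ?thesis using k by simp
  qed
  \<comment> \<open>If U involved x alone, its only point would be (a, 0), so W = a b; but then the
    point \<open>(i0, b)\<close> of u lies on the same edge, although b \<ge> 1.\<close>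
  have dyU: "dy U \<noteq> 0"
  proof
    assume "dy U = 0"
    then have "degree U = 0" by (simp add: pderiv_eq_0_iff)
    then have j: "j = 0" if "bcoeff U i j \<noteq> 0" for i j
      using that by (auto simp: bcoeff_def coeff_eq_0 intro: ccontr)
    obtain i j where ij: "bcoeff U i j \<noteq> 0" using U0 bcoeff_eqI[of U 0] by auto
    have "b * i = W" "bcoeff u i 0 \<noteq> 0" using ij j[OF ij] by (auto simp: U split: if_splits)
    then have "b * i \<ge> b * a" "i \<le> a" using W_ge le_a by (auto simp: mult.commute)
    then have "i = a" using b by simp
    then have "W = a * b" using \<open>b * i = W\<close> by (simp add: mult.commute)
    then have "b * i0 + a * b = W" using le_W[OF i0] by (simp add: mult.commute)
    then have "bcoeff U i0 b \<noteq> 0" using i0 by (simp add: U)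
    then show False using j b by force
  qed
  have dxU: "dx U \<noteq> 0"
  proof
    assume "dx U = 0"
    then have "pderiv (coeff U j) = 0" for j using coeff_dx[of U j] by simp
    then have i: "i = 0" if "bcoeff U i j \<noteq> 0" for i j
      using that by (auto simp: bcoeff_def coeff_eq_0 pderiv_eq_0_iff intro: ccontr)
    obtain i j where ij: "bcoeff U i j \<noteq> 0" using U0 bcoeff_eqI[of U 0] by auto
    have "a * j = W" "bcoeff u 0 j \<noteq> 0" using ij i[OF ij] by (auto simp: U split: if_splits)
    then have "a * j \<ge> a * b" "j \<le> b" using W_ge le_b by auto
    then have "j = b" using a by simp
    then have "W = a * b" using \<open>a * j = W\<close> by simp
    then have "b * a + a * j0 = W" using le_W[OF j0] by (simp add: mult.commute)
    then have "bcoeff U a j0 \<noteq> 0" using j0 by (simp add: U)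
    then show False using i a by force
  qed
  \<comment> \<open>A factor x of U would satisfy \<open>\<delta> x = 0\<close>, whereas
    \<open>\<delta> x = - dy U\<close>. So the edge reaches both axes, which forces W = a b.\<close>
  have "\<not> var_x dvd U" using factor[of var_x] \<delta>x dyU by (auto simp del: mult_pCons_left)
  then obtain j1 where j1: "bcoeff U 0 j1 \<noteq> 0" by (auto simp: x_dvd_iff)
  have "\<not> var_y dvd U" using factor[of var_y] \<delta>y dxU by (auto simp del: mult_pCons_left)
  then obtain i1 where i1: "bcoeff U i1 0 \<noteq> 0" by (auto simp: y_dvd_iff')
  have "a * j1 = W" "j1 \<le> b" using j1 le_b by (auto simp: U split: if_splits)
  then have W: "W = a * b" using W_ge by (metis le_antisym mult_le_mono2)
  then have U0b: "bcoeff U 0 b \<noteq> 0" using j1 \<open>a * j1 = W\<close> a by simp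
  have "b * i1 = W" using i1 by (auto simp: U split: if_splits)
  then have Ua0: "bcoeff U a 0 \<noteq> 0" using i1 W b by (simp add: mult.commute)
  define g where "g = gcd a b"
  have g: "g \<ge> 1" using a by (simp add: g_def Suc_le_eq)
  obtain s r where sr: "a = g * s" "b = g * r" "coprime s r"
    using gcd_coprime_exists[of a b] a by (metis g_def gcd_eq_0_iff mult.commute not_one_le_zero)
  have s: "s \<ge> 1" and r: "r \<ge> 1" using sr a b by (cases s; cases r; simp)+
  define c where "c k = bcoeff U (s * (g - k)) (r * k)" for k
  have U_eq: "U = (\<Sum>k\<le>g. kconst (c k) * ((var_x ^ s) ^ (g - k) * (var_y ^ r) ^ k))"
  proof (rule bcoeff_eqI)
    fix i j
    have sum: "bcoeff (\<Sum>k\<in>A. f k) i j = (\<Sum>k\<in>A. bcoeff (f k) i j)" if "finite A" for A :: "nat set" and f :: "nat \<Rightarrow> 'a bpoly"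
      using that by induction auto
    have "bcoeff (\<Sum>k\<le>g. kconst (c k) * ((var_x ^ s) ^ (g - k) * (var_y ^ r) ^ k)) i j =
        (\<Sum>k\<le>g. if i = s * (g - k) \<and> j = r * k then c k else 0)" (is "_ = ?S")
      by (simp add: sum bcoeff_const_mult x_power_y_power bcoeff_monom flip: power_mult cong: if_cong del: mult_pCons_left)
        (intro sum.cong, auto)
    also have "?S = bcoeff U i j"
    proof (cases "\<exists>k\<le>g. i = s * (g - k) \<and> j = r * k")
      case True
      then obtain k where k: "k \<le> g" "i = s * (g - k)" "j = r * k" by auto
      have "?S = (\<Sum>k'\<in>{k}. if i = s * (g - k') \<and> j = r * k' then c k' else 0)"
        by (rule sum.mono_neutral_right) (use k r in auto)
      then show ?thesis using k by (simp add: c_def)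
    next
      case False
      then have "?S = 0" by (intro sum.neutral) auto
      moreover have "bcoeff U i j = 0"
      proof (rule ccontr)
        assume "bcoeff U i j \<noteq> 0"
        then have "b * i + a * j = a * b" using W by (auto simp: U split: if_splits)
        then have "g * (r * i + s * j) = g * (g * s * r)" by (simp add: sr algebra_simps)
        then have e: "r * i + s * j = g * s * r" using g by simp
        then have "s dvd r * i + s * j" "r dvd r * i + s * j" by auto
        then have "s dvd i" "r dvd j" using \<open>coprime s r\<close>
          by (auto simp: dvd_add_left_iff dvd_add_right_iff coprime_dvd_mult_right_iff coprime_commute)
        then obtain k l where kl: "i = s * k" "j = r * l" by (auto simp: dvd_def)
        then have "r * s * (k + l) = r * s * g" using e by (simp add: algebra_simps)
        then have "k + l = g" using r s by simp
        then have "l \<le> g \<and> i = s * (g - l) \<and> j = r * l" using kl by auto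
        then show False using False by blast
      qed
      ultimately show ?thesis by simp
    qed
    finally show "bcoeff U i j = bcoeff (\<Sum>k\<le>g. kconst (c k) * ((var_x ^ s) ^ (g - k) * (var_y ^ r) ^ k)) i j" ..
  qed
  \<comment> \<open>The dehomogenised edge form. A root \<mu> of it yields the factor
    \<open>Y - \<mu> X\<close> of U, and \<mu> is nonzero because the pure power of x occurs in
    U.\<close>
  define P where "P = (\<Sum>k\<le>g. monom (c k) k)"
  have P: "coeff P k = (if k \<le> g then c k else 0)" for k
    by (auto simp: P_def coeff_sum)
  have "coeff P g \<noteq> 0" using U0b sr by (simp add: P c_def mult.commute)
  then have "degree P > 0" using le_degree[of P g] g by simp
  then obtain \<mu> where \<mu>: "poly P \<mu> = 0" using alg_closed_imp_poly_has_root by blast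
  have "poly P 0 \<noteq> 0" using Ua0 sr by (simp add: poly_0_coeff_0 P c_def mult.commute)
  then have \<mu>0: "\<mu> \<noteq> 0" using \<mu> by auto
  have Psum: "(\<Sum>k\<le>g. c k * \<mu> ^ k) = 0" using \<mu> by (simp add: P_def poly_sum poly_monom)
  define X where "X = (var_x :: 'a bpoly) ^ s"
  define Y where "Y = (var_y :: 'a bpoly) ^ r"
  define \<pi> where "\<pi> = Y - kconst \<mu> * X"
  have kc: "kconst (p * q) = kconst p * kconst q" "kconst (p + q) = kconst p + kconst q" for p q :: 'a by auto
  have kcsum: "kconst (\<Sum>k\<in>A. f k) = (\<Sum>k\<in>A. kconst (f k))" if "finite A" for A and f :: "nat \<Rightarrow> 'a"
    using that by induction (auto simp: kc)
  have "\<pi> dvd U"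
  proof -
    have "(\<Sum>k\<le>g. kconst (c k) * (X ^ (g - k) * (kconst \<mu> * X) ^ k)) = kconst (\<Sum>k\<le>g. c k * \<mu> ^ k) * X ^ g"
      unfolding kcsum[OF finite_atMost] sum_distrib_right
      by (rule sum.cong) (auto simp: rhom_power[OF rhom_kconst, symmetric] rhom_mult[OF rhom_kconst] power_mult_distrib
          mult_ac power_add[symmetric] simp del: mult_pCons_left mult_pCons_right)
    then have "U = (\<Sum>k\<le>g. kconst (c k) * (X ^ (g - k) * (Y ^ k - (kconst \<mu> * X) ^ k)))"
      unfolding U_eq Psum X_def[symmetric] Y_def[symmetric] right_diff_distrib sum_subtractf by simp
    moreover have "\<pi> dvd Y ^ k - (kconst \<mu> * X) ^ k" for k
      unfolding \<pi>_def power_diff_sumr2 by (rule dvd_triv_left)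
    ultimately show ?thesis by (auto intro!: dvd_sum dvd_mult simp del: mult_pCons_left)
  qed
  then have "\<delta> \<pi> = 0" using factor by (auto elim: dvdE)
  then have \<delta>\<pi>: "of_nat r * (var_y ^ (r - 1) * \<delta> var_y) = kconst \<mu> * (of_nat s * (var_x ^ (s - 1) * \<delta> var_x))"
    using d\<delta> by (simp add: \<pi>_def X_def Y_def deriv_diff[OF d] deriv_mult[OF d] deriv_power[OF d] deriv_over_def mult.assoc
        del: mult_pCons_left mult_pCons_right)
  have const: "prime_elem p \<Longrightarrow> p dvd kconst l * q \<Longrightarrow> l \<noteq> 0 \<Longrightarrow> p dvd q" for p q :: "'a bpoly" and l
  proof -
    assume "p dvd kconst l * q" "l \<noteq> 0"
    then have "p dvd kconst (inverse l) * (kconst l * q)" by (rule_tac dvd_mult)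
    then show "p dvd q" using \<open>l \<noteq> 0\<close> by (simp add: mult.assoc[symmetric] del: mult_pCons_right flip: one_pCons)
  qed
  have nat: "of_nat k = kconst (of_nat k :: 'a)" for k
    by (induction k) (auto simp: one_pCons)
  \<comment> \<open>Divisibility of \<open>\<delta> x\<close> by y would raise the nilpotency order
    of x above that of y, and the symmetric divisibility would do the opposite.\<close>
  have "r = 1 \<or> s = 1"
  proof (rule ccontr)
    assume "\<not> (r = 1 \<or> s = 1)"
    then have rs: "r \<ge> 2" "s \<ge> 2" using r s by auto
    have "var_y dvd var_y ^ (r - 1)" using rs by (intro dvd_power) auto
    then have "var_y dvd of_nat r * (var_y ^ (r - 1) * \<delta> var_y)" by (intro dvd_mult dvd_mult2)
    then have "var_y dvd kconst \<mu> * (kconst (of_nat s) * (var_x ^ (s - 1) * \<delta> var_x))" unfolding \<delta>\<pi> unfolding nat .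
    then have "var_y dvd var_x ^ (s - 1) * \<delta> var_x"
      using const[OF prime_y] \<mu>0 s by (metis of_nat_eq_0_iff not_one_le_zero)
    then have "var_y dvd \<delta> var_x" using prime_elem_dvd_multD[OF prime_y] y_not_dvd_x_power by blast
    then obtain z where z: "\<delta> var_x = var_y * z" by (auto elim: dvdE)
    have "z \<noteq> 0" using z \<delta>x dyU by auto
    then obtain l where l: "(\<delta> ^^ l) z \<noteq> 0" "(\<delta> ^^ Suc l) z = 0" using ord by blast
    from order_mult_nonzero[OF d n l] have "(\<delta> ^^ Suc (n + l)) var_x \<noteq> 0"
      by (simp only: z[symmetric] funpow_Suc_right o_apply not_False_eq_True)
    then have mn: "n < m" using deriv_funpow_mono[OF d m(2), of "Suc (n + l)"] by force
    have "var_x dvd var_x ^ (s - 1)" using rs by (intro dvd_power) auto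
    then have "var_x dvd kconst \<mu> * (of_nat s * (var_x ^ (s - 1) * \<delta> var_x))" by (intro dvd_mult dvd_mult2)
    then have "var_x dvd kconst (of_nat r) * (var_y ^ (r - 1) * \<delta> var_y)" unfolding \<delta>\<pi>[symmetric] unfolding nat .
    then have "var_x dvd var_y ^ (r - 1) * \<delta> var_y"
      using const[OF prime_x] r by (metis of_nat_eq_0_iff not_one_le_zero)
    then have "var_x dvd \<delta> var_y" using prime_elem_dvd_multD[OF prime_x] x_not_dvd_y_power by blast
    then obtain z where z: "\<delta> var_y = var_x * z" by (auto elim: dvdE)
    have "z \<noteq> 0" using z \<delta>y dxU by auto
    then obtain l where l: "(\<delta> ^^ l) z \<noteq> 0" "(\<delta> ^^ Suc l) z = 0" using ord by blast
    from order_mult_nonzero[OF d m l] have "(\<delta> ^^ Suc (m + l)) var_y \<noteq> 0"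
      by (simp only: z[symmetric] funpow_Suc_right o_apply not_False_eq_True)
    then have "m < n" using deriv_funpow_mono[OF d n(2), of "Suc (m + l)"] by force
    then show False using mn by simp
  qed
  moreover have "r \<le> s" using ab sr g by simp
  ultimately have r1: "r = 1" using r by auto
  then have gb: "g = b" using sr by simp
  then have a_bs: "a = b * s" using sr by simp
  show ?thesis
  proof (rule that)
    show "a = b * s" by (rule a_bs)
    show "s \<ge> 1" "\<mu> \<noteq> 0" by fact+
    show "i + s * j \<le> a" if "bcoeff u i j \<noteq> 0" for i j
    proof -
      have "b * (i + s * j) \<le> b * a" using le_W[OF that] unfolding W a_bs by (simp add: algebra_simps)
      then show ?thesis using b by simp
    qed
    have "bcoeff u (s * (b - k)) k = c k" if "k \<le> b" for k
    proof -
      have "b * (s * (b - k)) + a * k = b * s * (b - k + k)" unfolding a_bs by (simp only: algebra_simps)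
      also have "\<dots> = W" using that unfolding W a_bs by simp
      finally show ?thesis by (simp add: c_def U r1 gb)
    qed
    then show "(\<Sum>k\<le>b. bcoeff u (s * (b - k)) k * \<mu> ^ k) = 0" using Psum gb by simp
  qed
qed

subsection \<open>Shears and the swap\<close>

definition swp :: "'a::field bpoly \<Rightarrow> 'a bpoly" where "swp = sub var_y var_x"

definition shear :: "'a::field poly \<Rightarrow> 'a bpoly \<Rightarrow> 'a bpoly" where
  "shear Q h = pcompose h [:Q, 1:]"

lemma rhom_swp: "rhom swp"
  unfolding swp_def by (rule rhom_sub)

lemma swp_simps [simp]: "swp (kconst c) = kconst c" "swp var_x = var_y" "swp var_y = var_x"
  by (simp_all only: swp_def sub_const sub_x sub_y)

lemma aut_swp: "is_aut swp" and inv_swp: "ainv swp = swp"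
  by (rule is_autI[OF rhom_swp rhom_swp]; simp only: swp_simps)+

lemma bcoeff_swp: "bcoeff (swp p) i j = bcoeff p j i"
proof -
  have 1: "bcoeff (ev1 (\<lambda>c. kconst c) var_y q) i j = (if i = 0 then coeff q j else 0)" for q i j
  proof (induction q arbitrary: i j)
    case (pCons a q)
    then show ?case
      by (cases j) (auto simp: ev1_pCons[OF rhom_kconst] bcoeff_y_mult bcoeff_kconst simp del: mult_pCons_left)
  qed simp
  show ?thesis
  proof (induction p arbitrary: i j)
    case 0
    then show ?case by (simp add: rhom_0[OF rhom_swp])
  next
    case (pCons q p)
    have "swp (pCons q p) = ev1 (\<lambda>c. kconst c) var_y q + var_x * swp p"
      by (simp add: swp_def bev_pCons[OF rhom_kconst])
    then show ?case
      using pCons.IH by (cases i) (auto simp: 1 bcoeff_x_mult bcoeff_pCons simp del: mult_pCons_left)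
  qed
qed

lemma swp_swp [simp]: "swp (swp p) = p"
  by (rule bcoeff_eqI) (simp add: bcoeff_swp)

lemma degx_swp [simp]: "degx (swp p) = degy p"
proof (rule order_antisym)
  show "degx (swp p) \<le> degy p"
    unfolding degx_le_iff using degy_le_iff[of p "degy p"] by (auto simp: bcoeff_swp)
  show "degy p \<le> degx (swp p)"
    unfolding degy_le_iff using degx_le_iff[of "swp p" "degx (swp p)"] by (auto simp: bcoeff_swp)
qed

lemma degy_swp [simp]: "degy (swp p) = degx p"
  using degx_swp[of "swp p"] by simp

lemma rhom_shear: "rhom (shear Q)"
  by (auto simp: rhom_def shear_def pcompose_add pcompose_mult pcompose_1)

lemma shear_simps [simp]: "shear Q [:q:] = [:q:]" "shear Q var_y = [:Q, 1:]"
  by (simp_all add: shear_def pcompose_pCons)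

lemma shear_shear: "shear P (shear Q h) = shear (P + Q) h"
  by (simp add: shear_def flip: pcompose_assoc) (simp add: pcompose_pCons add.commute)

lemma shear_0 [simp]: "shear 0 h = h"
  by (simp add: shear_def)

lemma aut_shear: "is_aut (shear Q)" and inv_shear: "ainv (shear Q) = shear (- Q)"
  by (rule is_autI[of "shear Q" "shear (- Q)"]; simp only: rhom_shear shear_simps(1) shear_shear; simp)+

lemma degy_degree: "degy p = degree p"
proof (rule order_antisym)
  show "degy p \<le> degree p" unfolding degy_le_iff by (auto simp: bcoeff_def intro: le_degree)
  show "degree p \<le> degy p"
  proof (rule degree_le, intro allI impI)
    fix j assume "degy p < j"
    then have "coeff (coeff p j) i = 0" for i
      using degy_le_iff[of p "degy p"] by (force simp: bcoeff_def)
    then show "coeff p j = 0" by (simp add: poly_eq_iff)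
  qed
qed

lemma degy_shear [simp]: "degy (shear Q h) = degy h"
  by (simp add: degy_degree shear_def degree_pcompose)

subsection \<open>Growth of degrees under alternating shears\<close>

text \<open>\<open>topp e N h\<close> is the component of \<open>h\<close> of weight \<open>N\<close> (for the weights \<open>(1, e)\<close>), dehomogenised at \<open>x = 1\<close>.\<close>

definition topp :: "nat \<Rightarrow> nat \<Rightarrow> 'a::field bpoly \<Rightarrow> 'a poly" where
  "topp e N h = (\<Sum>j\<le>degree h. monom (if e * j \<le> N then bcoeff h (N - e * j) j else 0) j)"

lemma coeff_topp: "coeff (topp e N h) j = (if e * j \<le> N then bcoeff h (N - e * j) j else 0)"
proof (cases "j \<le> degree h")
  case True
  then show ?thesis by (simp add: topp_def coeff_sum)
next
  case False
  then have "coeff h j = 0" by (simp add: coeff_eq_0)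
  then show ?thesis using False by (simp add: topp_def coeff_sum bcoeff_def)
qed

text \<open>For the weights (1, e) the polynomial y + Q(x) has the component y + c x^e of weight e,
  where c is \<open>coeff Q e\<close>; at x = 1 the substitution is the translation by c.\<close>

lemma shear_top:
  assumes Q: "degree Q \<le> e" and h: "degree (wt 1 e h) \<le> N"
  shows "degree (wt 1 e (shear Q h)) \<le> N \<and> topp e N (shear Q h) = pcompose (topp e N h) [:coeff Q e, 1:]"
  using h
proof (induction h arbitrary: N)
  case 0
  have "topp e N 0 = (0 :: 'a poly)" by (rule poly_eqI) (simp add: coeff_topp)
  then show ?case by (simp add: rhom_0[OF rhom_wt] rhom_0[OF rhom_shear])
next
  case (pCons q p)
  have b: "i + e * j \<le> N" if "bcoeff (pCons q p) i j \<noteq> 0" for i j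
    using pCons.prems that degree_wt_le_iff[of 1 e "pCons q p" N] by auto
  have q: "degree q \<le> N"
  proof (cases "q = 0")
    case False
    then have "bcoeff (pCons q p) (degree q) 0 \<noteq> 0" by (simp add: bcoeff_pCons)
    from b[OF this] show ?thesis by simp
  qed simp
  have q0: "degree (wt 1 e [:q:]) \<le> N" unfolding degree_wt_le_iff
    using q by (auto simp: bcoeff_pCons split: nat.splits dest!: le_degree)
  have tq: "topp e N [:q:] = [:coeff q N:]"
    by (rule poly_eqI) (auto simp: coeff_topp bcoeff_def coeff_pCons split: nat.splits)
  show ?case
  proof (cases "p = 0")
    case True
    then show ?thesis using q0 tq by simp
  next
    case False
    define g where "g = shear Q p"
    obtain i j where ij: "bcoeff p i j \<noteq> 0" using False bcoeff_eqI[of p 0] by auto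
    have b': "i + e * Suc j \<le> N" if "bcoeff p i j \<noteq> 0" for i j
      using b[of i "Suc j"] that by (simp add: bcoeff_pCons)
    \<comment> \<open>As p is nonzero, y times some monomial of p has weight at most N; this makes
      the natural number subtraction \<open>N - e\<close> exact below.\<close>
    have eN: "e \<le> N" using b'[OF ij] by simp
    have "degree (wt 1 e p) \<le> N - e" unfolding degree_wt_le_iff using b' by force
    from pCons.IH[OF this] have g: "degree (wt 1 e g) \<le> N - e"
      "topp e (N - e) g = pcompose (topp e (N - e) p) [:coeff Q e, 1:]" by (simp_all add: g_def)
    have gb: "i + e * j \<le> N - e" if "bcoeff g i j \<noteq> 0" for i j
      using g(1) that degree_wt_le_iff[of 1 e g "N - e"] by auto
    have gdeg: "e * j + degree (coeff g j) \<le> N - e" if "coeff g j \<noteq> 0" for j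
      using gb[of "degree (coeff g j)" j] that by (simp add: bcoeff_def add.commute)
    have sh: "shear Q (pCons q p) = [:q:] + ([:Q:] * g + var_y * g)"
      by (simp add: shear_def g_def pcompose_pCons)
    have "degree (wt 1 e [:Q:]) \<le> e" "degree (wt 1 e var_y) \<le> e" unfolding degree_wt_le_iff
      using Q by (auto simp: bcoeff_def coeff_pCons split: nat.splits if_splits dest!: le_degree)
    then have "degree (wt 1 e ([:Q:] * g)) \<le> e + (N - e)" "degree (wt 1 e (var_y * g)) \<le> e + (N - e)"
      using g(1) unfolding rhom_mult[OF rhom_wt] by (meson add_mono degree_mult_le le_trans)+
    then have 1: "degree (wt 1 e (shear Q (pCons q p))) \<le> N"
      unfolding sh rhom_add[OF rhom_wt] using q0 eN by (intro degree_add_le) auto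
    have tQ: "topp e N ([:Q:] * g) = smult (coeff Q e) (topp e (N - e) g)"
    proof (rule poly_eqI)
      fix j
      show "coeff (topp e N ([:Q:] * g)) j = coeff (smult (coeff Q e) (topp e (N - e) g)) j"
      proof (cases "coeff g j = 0")
        case True
        then show ?thesis by (simp add: coeff_topp bcoeff_def)
      next
        case False
        define M where "M = N - e - e * j"
        have M: "N = e + M + e * j" "degree (coeff g j) \<le> M" using gdeg[OF False] eN by (auto simp: M_def)
        have "bcoeff ([:Q:] * g) (N - e * j) j = coeff (Q * coeff g j) (e + M)"
          using M by (simp add: bcoeff_def)
        then show ?thesis using M coeff_mult_top[OF Q M(2)] by (simp add: coeff_topp bcoeff_def)
      qed
    qed
    have ty: "topp e N (var_y * g) = pCons 0 (topp e (N - e) g)"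
    proof (rule poly_eqI)
      fix j
      show "coeff (topp e N (var_y * g)) j = coeff (pCons 0 (topp e (N - e) g)) j"
        using eN by (cases j) (auto simp: coeff_topp bcoeff_y_mult simp del: mult_pCons_left)
    qed
    have tp: "topp e N (pCons q p) = pCons (coeff q N) (topp e (N - e) p)"
    proof (rule poly_eqI)
      fix j
      show "coeff (topp e N (pCons q p)) j = coeff (pCons (coeff q N) (topp e (N - e) p)) j"
        using eN by (cases j) (auto simp: coeff_topp bcoeff_pCons bcoeff_def)
    qed
    have "topp e N (u + v) = topp e N u + topp e N v" for u v :: "'a bpoly"
      by (rule poly_eqI) (simp add: coeff_topp)
    then have "topp e N (shear Q (pCons q p)) = [:coeff q N:] + (smult (coeff Q e) (topp e (N - e) g) + pCons 0 (topp e (N - e) g))"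
      by (simp only: sh tq tQ ty)
    then show ?thesis using 1 by (simp add: tp g(2) pcompose_pCons)
  qed
qed

text \<open>Write P = T^l S. For nonzero c the translate of T^l does not vanish at 0, so only S, of
  degree \<open>degree P - l\<close>, contributes to the order there.\<close>

lemma pcompose_shift_order:
  fixes P :: "'a::field poly"
  assumes "P \<noteq> 0" "c \<noteq> 0" "monom 1 l dvd P"
  shows "order 0 (pcompose P [:c, 1:]) + l \<le> degree P"
proof -
  obtain S where S: "P = monom 1 l * S" using assms(3) by (auto elim: dvdE)
  with assms have S0: "S \<noteq> 0" by auto
  have nz: "pcompose p [:c, 1:] \<noteq> 0" if "p \<noteq> 0" for p :: "'a poly"
    using that by (simp add: pcompose_eq_0_iff)
  have "order 0 (pcompose P [:c, 1:]) = order 0 (pcompose (monom 1 l) [:c, 1:]) + order 0 (pcompose S [:c, 1:])"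
    unfolding S pcompose_mult by (intro order_mult no_zero_divisors nz S0) simp
  also have "order 0 (pcompose (monom 1 l) [:c, 1:]) = 0"
    by (rule order_0I) (simp add: poly_pcompose poly_monom assms)
  also have "order 0 (pcompose S [:c, 1:]) \<le> degree S"
    using order_degree[OF nz[OF S0], of 0] by (simp add: degree_pcompose)
  finally show ?thesis using S0 by (simp add: S degree_mult_eq degree_monom_eq)
qed

text \<open>\<open>out e L g\<close>: some \<open>x^L y^m\<close> lies on the \<open>(1, e)\<close>-edge of the Newton polygon of \<open>g\<close>.\<close>

definition out :: "nat \<Rightarrow> nat \<Rightarrow> 'a::field bpoly \<Rightarrow> bool" where
  "out e L g \<longleftrightarrow> (\<exists>m. bcoeff g L m \<noteq> 0 \<and> degree (wt 1 e g) \<le> L + e * m)"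

text \<open>Here m is the order at 0 of the translated edge polynomial, so
  \<open>x^(N - e*m) y^m\<close> is the edge point of least y-exponent after the shear. The bound on
  \<open>m + l\<close> limits how far cancellation can move it towards the y-axis: the higher the
  power of T in P, the further away it stays.\<close>

lemma shear_edge:
  fixes h :: "'a::field bpoly"
  assumes h: "h \<noteq> 0" and Q: "degree Q = e" "e \<ge> 1"
  defines "N \<equiv> degree (wt 1 e h)"
  obtains P m where "P = topp e N h" "P \<noteq> 0" "e * degree P \<le> N" "e * m \<le> N"
    "out e (N - e * m) (shear Q h)" "\<And>l. monom 1 l dvd P \<Longrightarrow> m + l \<le> degree P"
    "m \<ge> 1 \<Longrightarrow> bcoeff (shear Q h) N 0 = 0" "degree (wt 1 e (shear Q h)) \<le> N"
proof -
  define P where "P = topp e N h"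
  define P' where "P' = topp e N (shear Q h)"
  have c: "coeff Q e \<noteq> 0" using Q by auto
  have top: "degree (wt 1 e (shear Q h)) \<le> N" "P' = pcompose P [:coeff Q e, 1:]"
    using shear_top[of Q e h N] Q by (auto simp: P_def P'_def N_def)
  obtain i j where ij: "bcoeff h i j \<noteq> 0" "i + e * j = N"
    using wt_attained[OF h, of 1 e] by (auto simp: N_def)
  then have "coeff P j \<noteq> 0" by (auto simp: P_def coeff_topp)
  then have P0: "P \<noteq> 0" by auto
  then have P'0: "P' \<noteq> 0" by (simp add: top pcompose_eq_0_iff)
  have deg: "e * degree P \<le> N"
  proof -
    have "coeff P (degree P) \<noteq> 0" using P0 by simp
    then show ?thesis by (auto simp: P_def coeff_topp split: if_splits)
  qed
  define m where "m = order 0 P'"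
  have "monom 1 m dvd P'" "\<not> monom 1 (Suc m) dvd P'"
    using order[OF P'0, of 0] by (simp_all add: m_def monom_altdef)
  then have cm: "coeff P' m \<noteq> 0" "\<And>k. k < m \<Longrightarrow> coeff P' k = 0"
    by (auto simp: monom_1_dvd_iff' less_Suc_eq)
  then have em: "e * m \<le> N" and bm: "bcoeff (shear Q h) (N - e * m) m \<noteq> 0"
    by (auto simp: P'_def coeff_topp split: if_splits)
  show ?thesis
  proof (rule that[OF P_def P0 deg em])
    show "out e (N - e * m) (shear Q h)" unfolding out_def using bm top em by auto
    show "m + l \<le> degree P" if "monom 1 l dvd P" for l
      using pcompose_shift_order[OF P0 c that] by (simp add: m_def top)
    show "bcoeff (shear Q h) N 0 = 0" if "m \<ge> 1"
      using cm(2)[of 0] that by (simp add: P'_def coeff_topp)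
  qed fact
qed

text \<open>The swap turns the given edge point into one of y-exponent L. Since
  \<open>e * degree Q \<ge> 2\<close>, every point of h with smaller y-exponent lies strictly below
  the new edge, so T^L divides P. Then \<open>m + L \<le> degree P\<close> gives
  \<open>N - e' * m \<ge> e' * L\<close>.\<close>

lemma out_step:
  fixes g :: "'a::field bpoly"
  assumes o: "out e L g" and e: "e \<ge> 1" and Q: "degree Q \<ge> 2"
  obtains L' where "L' \<ge> degree Q * L" "out (degree Q) L' (shear Q (swp g))"
proof -
  define h where "h = swp g"
  define e' where "e' = degree Q"
  define N where "N = degree (wt 1 e' h)"
  obtain m0 where m0: "bcoeff g L m0 \<noteq> 0" "degree (wt 1 e g) \<le> L + e * m0" using o by (auto simp: out_def)
  have hb: "j + e * i \<le> L + e * m0" if "bcoeff h i j \<noteq> 0" for i j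
    using m0(2) that degree_wt_le_iff[of 1 e g "L + e * m0"] by (auto simp: h_def bcoeff_swp)
  have hm: "bcoeff h m0 L \<noteq> 0" using m0 by (simp add: h_def bcoeff_swp)
  then have h0: "h \<noteq> 0" by auto
  have NL: "m0 + e' * L \<le> N" using wt_le[OF hm, of 1 e'] by (simp add: N_def)
  have e'1: "e' \<ge> 1" using Q by (simp add: e'_def)
  obtain P m where P: "P = topp e' N h" "P \<noteq> 0" "e' * degree P \<le> N" "e' * m \<le> N"
    "out e' (N - e' * m) (shear Q h)" "\<And>l. monom 1 l dvd P \<Longrightarrow> m + l \<le> degree P"
    using shear_edge[OF h0 e'_def[symmetric] e'1, folded N_def] by metis
  have "coeff P j = 0" if "j < L" for j
  proof (rule ccontr)
    assume "coeff P j \<noteq> 0"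
    then have j: "e' * j \<le> N" "bcoeff h (N - e' * j) j \<noteq> 0" by (auto simp: P coeff_topp split: if_splits)
    define d where "d = L - j"
    have d: "L = j + d" "d \<ge> 1" using that by (auto simp: d_def)
    define i where "i = N - e' * j"
    have "m0 + e' * d \<le> i" using NL j(1) by (simp add: i_def d algebra_simps)
    then have "e * (m0 + e' * d) \<le> e * i" by simp
    moreover have "e * i \<le> d + e * m0" using hb[OF j(2)] by (simp add: d i_def)
    moreover have "e * (m0 + e' * d) = e * m0 + e * e' * d" by (simp add: algebra_simps)
    ultimately have "e * e' * d \<le> d" by linarith
    moreover have "2 \<le> e * e'" using e Q mult_le_mono[of 1 e 2 e'] by (simp add: e'_def)
    then have "2 * d \<le> e * e' * d" by (rule mult_le_mono1)
    ultimately show False using d by simp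
  qed
  then have "monom 1 L dvd P" by (simp add: monom_1_dvd_iff')
  from P(6)[OF this] have "e' * (m + L) \<le> N" using P(3) by (meson le_trans mult_le_mono2)
  then have "e' * L \<le> N - e' * m" by (simp add: algebra_simps)
  then show ?thesis using that P(5) by (simp add: e'_def h_def)
qed

text \<open>The bad case is \<open>N = e * m\<close>: the edge polynomial is translated to a
  multiple of T^m, the edge shrinks to the point y^m, and the degree in x drops. Otherwise the
  extreme point of the edge has positive x-exponent \<open>L = N - e * m\<close>.\<close>

lemma first_step:
  fixes h :: "'a::field bpoly"
  assumes h: "degy h \<ge> 1" and Q: "degree Q \<ge> 1"
  obtains (good) L where "L \<ge> 1" "out (degree Q) L (shear Q h)" "degree Q \<le> max (degx h) L"
  | (bad) "degx (shear Q h) < degx h" "degree Q \<le> degx h"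
proof -
  define e where "e = degree Q"
  define N where "N = degree (wt 1 e h)"
  have h0: "h \<noteq> 0" using h by (auto simp: degy_degree)
  have e1: "e \<ge> 1" using Q by (simp add: e_def)
  obtain P m where P: "P = topp e N h" "P \<noteq> 0" "e * degree P \<le> N" "e * m \<le> N"
    "out e (N - e * m) (shear Q h)" "\<And>l. monom 1 l dvd P \<Longrightarrow> m + l \<le> degree P"
    "m \<ge> 1 \<Longrightarrow> bcoeff (shear Q h) N 0 = 0" "degree (wt 1 e (shear Q h)) \<le> N"
    using shear_edge[OF h0 e_def[symmetric] e1, folded N_def] by metis
  obtain i j where ij: "bcoeff h i j \<noteq> 0" "j = degy h" using wt_attained[OF h0, of 0 1] by (auto simp: degy_def)
  have "e * 1 \<le> e * j" using ij(2) h by (intro mult_le_mono2) simp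
  then have eN: "e \<le> N" using wt_le[OF ij(1), of 1 e] unfolding N_def by linarith
  \<comment> \<open>If x^N does not occur in h, then T divides P and m stays at least one below N /
    e. So either N, and with it e, is at most \<open>degx h\<close>, or \<open>N - e * m\<close> is
    at least e.\<close>
  have coeff0: "N \<le> degx h \<or> e * (m + 1) \<le> N"
  proof (cases "coeff P 0 = 0")
    case True
    then have "monom 1 1 dvd P" by (simp add: monom_1_dvd_iff')
    from P(6)[OF this] show ?thesis using P(3) by (meson le_trans mult_le_mono2)
  next
    case False
    then have "bcoeff h N 0 \<noteq> 0" by (simp add: P coeff_topp)
    then show ?thesis using wt_le[of h N 0 1 0] by (simp add: degx_def)
  qed
  show ?thesis
  proof (cases "N - e * m = 0")
    case False
    show ?thesis
    proof (rule good)
      show "degree Q \<le> max (degx h) (N - e * m)" using coeff0 eN by (auto simp: e_def)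
    qed (use False P(5) in \<open>auto simp: e_def\<close>)
  next
    case True
    then have N: "N = e * m" using P(4) by simp
    then have m: "m \<ge> 1" using eN e1 by (cases m) auto
    have deg: "N \<le> degx h" using coeff0 N e1 by auto
    have "degx (shear Q h) \<le> N - 1" unfolding degx_le_iff
    proof (intro allI impI)
      fix i j assume ij: "bcoeff (shear Q h) i j \<noteq> 0"
      then have "i + e * j \<le> N" using P(8) wt_le[OF ij, of 1 e] by simp
      moreover have "\<not> (i = N \<and> j = 0)" using P(7)[OF m] ij by metis
      ultimately show "i \<le> N - 1" using e1 by (cases j) auto
    qed
    then show ?thesis using bad deg eN e1 by (simp add: e_def)
  qed
qed

section \<open>Words of shears and swaps, and the product of their degrees\<close>

fun word :: "'a::field poly list \<Rightarrow> 'a bpoly \<Rightarrow> 'a bpoly" where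
  "word [] h = h"
| "word (Q # Qs) h = word Qs (swp (shear Q h))"

lemma word_out:
  "out e L g \<Longrightarrow> e \<ge> 1 \<Longrightarrow> \<forall>Q\<in>set Qs. degree Q \<ge> 2 \<Longrightarrow>
    prod_list (map degree Qs) * L \<le> total_deg (word Qs (swp g))"
proof (induction Qs arbitrary: e L g)
  case Nil
  then obtain m where "bcoeff (swp g) m L \<noteq> 0" by (auto simp: out_def bcoeff_swp)
  then show ?case using bcoeff_total_deg by fastforce
next
  case (Cons Q Qs)
  then have Q: "degree Q \<ge> 2" by simp
  obtain L' where L': "L' \<ge> degree Q * L" "out (degree Q) L' (shear Q (swp g))"
    using out_step[OF Cons.prems(1,2) Q] by blast
  have "prod_list (map degree Qs) * L' \<le> total_deg (word Qs (swp (shear Q (swp g))))"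
    by (rule Cons.IH[OF L'(2)]) (use Q Cons.prems in auto)
  moreover have "prod_list (map degree Qs) * (degree Q * L) \<le> prod_list (map degree Qs) * L'"
    using L'(1) by (rule mult_le_mono2)
  ultimately have "prod_list (map degree Qs) * (degree Q * L) \<le> total_deg (word Qs (swp (shear Q (swp g))))"
    by linarith
  then show ?case by (simp only: list.map prod_list.Cons word.simps mult_ac)
qed

text \<open>Equivalently, f lies in k[u] for a coordinate u. The property is invariant under
  automorphisms, so its negation persists along a word.\<close>

definition pencil :: "'a::field bpoly \<Rightarrow> bool" where
  "pencil f \<longleftrightarrow> (\<exists>g\<in>poly_in_x. equivalent f g)"

lemma pencil_aut: assumes "is_aut \<rho>" shows "pencil (\<rho> f) \<longleftrightarrow> pencil f"
proof -
  have 1: "pencil (\<sigma> h)" if \<sigma>: "is_aut \<sigma>" and h: "pencil h" for \<sigma> and h :: "'a bpoly"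
  proof -
    obtain g \<phi> where "g \<in> poly_in_x" "is_aut \<phi>" "\<phi> g = h" using h unfolding pencil_def equivalent_def by blast
    then show ?thesis using is_aut_comp[OF \<sigma>] unfolding pencil_def equivalent_def
      by (intro bexI[of _ g] exI[of _ "\<sigma> \<circ> \<phi>"]) auto
  qed
  from 1[OF assms, of f] 1[OF is_aut_inv[OF assms], of "\<rho> f"] show ?thesis
    by (auto simp: is_aut_inv_simps[OF assms])
qed

lemma pencil_degy_0: assumes "degy f = 0" shows "pencil f"
proof -
  obtain q where "f = [:q:]" using assms degree_eq_zeroE unfolding degy_degree by blast
  then have "f \<in> poly_in_x" by (simp add: poly_in_x_def)
  then show ?thesis using is_aut_id unfolding pencil_def equivalent_def
    by (intro bexI[of _ f] exI[of _ id]) auto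
qed

text \<open>A bad step costs a factor \<open>degree Q \<le> s\<close> and lowers the budget s by
  one; s bounds the sum of both degrees, so that the swap does not matter. The first good step ends
  the recursion: the remaining product is at most d by \<open>word_out\<close>, and the current
  degree is at most \<open>max s L\<close>, which accounts for two further factors of the base. That
  h is no pencil keeps \<open>degy h\<close> positive.\<close>

lemma word_bound:
  assumes "\<not> pencil h" "\<forall>Q\<in>set Qs. degree Q \<ge> 2" "total_deg (word Qs h) \<le> d" "degx h + degy h \<le> s"
  shows "prod_list (map degree Qs) \<le> (s + d + 1) ^ (s + 2)"
  using assms
proof (induction Qs arbitrary: h s)
  case Nil
  show ?case by (simp only: list.map prod_list.Nil) (rule one_le_power, simp)
next
  case (Cons Q Qs)
  let ?h = "swp (shear Q h)"
  have Q: "degree Q \<ge> 2" using Cons.prems by simp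
  have y: "degy h \<ge> 1" using Cons.prems(1) pencil_degy_0 by (metis less_one not_less)
  have Q1: "degree Q \<ge> 1" using Q by simp
  consider (good) L where "L \<ge> 1" "out (degree Q) L (shear Q h)" "degree Q \<le> max (degx h) L"
    | (bad) "degx (shear Q h) < degx h" "degree Q \<le> degx h"
    using first_step[OF y Q1] by blast
  then show ?case
  proof cases
    case (good L)
    have p: "prod_list (map degree Qs) * L \<le> d"
      using word_out[OF good(2) Q1, of Qs] Cons.prems(2,3) by simp
    have "prod_list (map degree Qs) \<le> d" using p good(1) by (metis dual_order.trans le_add1 mult.right_neutral mult_le_mono2)
    have sd: "s * d \<le> (s + d + 1) ^ 2" "d \<le> (s + d + 1) ^ 2"
      by (auto simp: power2_eq_square algebra_simps)
    have "degree Q * prod_list (map degree Qs) \<le> (s + d + 1) ^ 2"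
    proof (cases "degree Q \<le> L")
      case True
      then have "degree Q * prod_list (map degree Qs) \<le> d" using p by (metis le_trans mult.commute mult_le_mono2)
      then show ?thesis using sd by simp
    next
      case False
      then have "degree Q \<le> s" using good(3) Cons.prems(4) by simp
      then have "degree Q * prod_list (map degree Qs) \<le> s * d"
        using \<open>prod_list (map degree Qs) \<le> d\<close> by (rule mult_le_mono)
      then show ?thesis using sd by simp
    qed
    also have "\<dots> \<le> (s + d + 1) ^ (s + 2)" by (rule power_increasing) auto
    finally show ?thesis by simp
  next
    case bad
    have s: "s \<ge> 1" "degree Q \<le> s" using Cons.prems(4) y bad by auto
    have "prod_list (map degree Qs) \<le> (s - 1 + d + 1) ^ (s - 1 + 2)"
    proof (rule Cons.IH)
      show "\<not> pencil ?h" using Cons.prems(1) by (simp add: pencil_aut[OF aut_swp] pencil_aut[OF aut_shear])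
      show "degx ?h + degy ?h \<le> s - 1" using bad(1) Cons.prems(4) by simp
    qed (use Cons.prems in auto)
    also have "\<dots> \<le> (s + d + 1) ^ (s - 1 + 2)" by (rule power_mono) auto
    finally have "degree Q * prod_list (map degree Qs) \<le> (s + d + 1) * (s + d + 1) ^ (s - 1 + 2)"
      using s by (intro mult_le_mono) auto
    also have "\<dots> = (s + d + 1) ^ (s + 2)" using s by (simp flip: power_Suc)
    finally show ?thesis by simp
  qed
qed

subsection \<open>Decomposition of automorphisms\<close>

text \<open>After the shear by \<mu> x^s the coefficient of the highest pure power of x is the edge
  polynomial at \<mu>, which is 0. All other points have smaller x-exponent because s \<ge>
  1.\<close>

lemma coordinate_reduction_step:
  fixes \<rho> :: "'a::{alg_closed_field, field_char_0} bpoly \<Rightarrow> 'a bpoly"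
  assumes \<rho>: "is_aut \<rho>" and deg: "degy (\<rho> var_x) \<le> degx (\<rho> var_x)" "degy (\<rho> var_x) \<ge> 1"
  obtains s \<mu> where "degx (\<rho> var_x) = degy (\<rho> var_x) * s" "s \<ge> 1" "\<mu> \<noteq> 0"
    "degx (shear (monom \<mu> s) (\<rho> var_x)) < degx (\<rho> var_x)"
proof -
  define u where "u = \<rho> var_x"
  define a b where "a = degx u" and "b = degy u"
  have ab: "degx u = a" "a \<ge> 1" "degy u = b" "b \<ge> 1" "a \<ge> b" using deg by (auto simp: u_def a_def b_def)
  obtain s \<mu> where s: "a = b * s" "s \<ge> 1" "\<mu> \<noteq> 0" "\<And>i j. bcoeff u i j \<noteq> 0 \<Longrightarrow> i + s * j \<le> a"
    "(\<Sum>k\<le>b. bcoeff u (s * (b - k)) k * \<mu> ^ k) = 0"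
    using newton_edge[OF _ ab] jac_coordinate_nilpotent[OF \<rho>] unfolding u_def by blast
  define T where "T = shear (monom \<mu> s) u"
  have "degree (wt 1 s u) \<le> a" unfolding degree_wt_le_iff using s(4) by simp
  from shear_top[OF degree_monom_le this, of \<mu>]
  have T: "degree (wt 1 s T) \<le> a" "topp s a T = pcompose (topp s a u) [:\<mu>, 1:]" by (simp_all add: T_def)
  have "bcoeff T a 0 = poly (topp s a T) 0" by (simp add: poly_0_coeff_0 coeff_topp)
  also have "\<dots> = poly (topp s a u) \<mu>" by (simp add: T poly_pcompose)
  also have "\<dots> = (\<Sum>k\<le>b. bcoeff u (s * (b - k)) k * \<mu> ^ k)"
    unfolding topp_def poly_sum poly_monom degy_degree[symmetric] ab(3)
    by (rule sum.cong) (auto simp: s(1) algebra_simps)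
  finally have T0: "bcoeff T a 0 = 0" using s(5) by simp
  have "degx T \<le> a - 1" unfolding degx_le_iff
  proof (intro allI impI)
    fix i j assume ij: "bcoeff T i j \<noteq> 0"
    have "i + s * j \<le> a" using wt_le[OF ij, of 1 s] T(1) by simp
    moreover have "\<not> (i = a \<and> j = 0)" using T0 ij by metis
    ultimately show "i \<le> a - 1" using s(2) by (cases j) auto
  qed
  then have "degx T < a" using ab(2) by simp
  then show ?thesis using that s(1-3) ab by (simp add: T_def u_def)
qed

text \<open>Monomial shears are composed until \<open>degx\<close> falls below \<open>degy\<close>.
  As they preserve \<open>degy\<close>, the exponents, which are quotients of the two degrees,
  strictly decrease; so the sum of the monomials has the degree of the first one.\<close>

lemma coordinate_reduction:
  fixes \<rho> :: "'a::{alg_closed_field, field_char_0} bpoly \<Rightarrow> 'a bpoly"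
  assumes "is_aut \<rho>" "degy (\<rho> var_x) \<le> degx (\<rho> var_x)" "degy (\<rho> var_x) \<ge> 1"
  shows "degy (\<rho> var_x) dvd degx (\<rho> var_x) \<and>
    (\<exists>Q. degree Q = degx (\<rho> var_x) div degy (\<rho> var_x) \<and> degx (shear Q (\<rho> var_x)) < degy (\<rho> var_x))"
  using assms
proof (induction "degx (\<rho> var_x)" arbitrary: \<rho> rule: less_induct)
  case less
  define u where "u = \<rho> var_x"
  obtain s \<mu> where s: "degx u = degy u * s" "s \<ge> 1" "\<mu> \<noteq> 0" "degx (shear (monom \<mu> s) u) < degx u"
    using coordinate_reduction_step[OF less.prems] unfolding u_def by metis
  have div: "degx u div degy u = s" using s(1) less.prems(3) by (simp add: u_def)
  define \<sigma> where "\<sigma> = shear (monom \<mu> s) \<circ> \<rho>"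
  have \<sigma>: "is_aut \<sigma>" unfolding \<sigma>_def by (rule is_aut_comp[OF aut_shear less.prems(1)])
  have \<sigma>x: "\<sigma> var_x = shear (monom \<mu> s) u" by (simp add: \<sigma>_def u_def)
  have "\<exists>Q. degree Q = s \<and> degx (shear Q u) < degy u"
  proof (cases "degx (\<sigma> var_x) < degy u")
    case True
    then show ?thesis using s by (intro exI[of _ "monom \<mu> s"]) (simp add: degree_monom_eq \<sigma>x)
  next
    case False
    have "degx (\<sigma> var_x) < degx (\<rho> var_x)" using s(4) by (simp add: \<sigma>x u_def)
    from less.hyps[OF this \<sigma>] False less.prems(3)
    obtain Q where Q: "degree Q = degx (\<sigma> var_x) div degy u" "degx (shear Q (\<sigma> var_x)) < degy u"
      by (auto simp: \<sigma>x u_def)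
    have "degree Q < s" unfolding Q(1) \<sigma>x using s(1,4) by (simp add: less_mult_imp_div_less mult.commute)
    then have "degree (Q + monom \<mu> s) = s" using s(3) by (simp add: degree_add_eq_right degree_monom_eq)
    then show ?thesis using Q(2) by (auto simp: \<sigma>x shear_shear)
  qed
  then show ?case using s(1) div by (simp add: u_def)
qed

lemma aut_word: "is_aut (word Qs)"
proof (induction Qs)
  case Nil
  then show ?case using is_aut_id by (simp add: id_def)
next
  case (Cons Q Qs)
  have "word (Q # Qs) = word Qs \<circ> (swp \<circ> shear Q)" by auto
  then show ?case using Cons by (simp only: is_aut_comp aut_swp aut_shear)
qed

lemma word_append: "word (Qs @ Rs) h = word Rs (word Qs h)"
  by (induction Qs arbitrary: h) auto

text \<open>Euclidean descent on \<open>degy\<close>: a shear brings \<open>degx\<close> below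
  \<open>degy\<close>, and the swap restores \<open>degy < degx\<close>. Strictness makes the
  quotient of the degrees, and so the degree of each letter, at least 2.\<close>

lemma coordinate_to_x:
  fixes \<rho> :: "'a::{alg_closed_field, field_char_0} bpoly \<Rightarrow> 'a bpoly"
  assumes "is_aut \<rho>" "degy (\<rho> var_x) < degx (\<rho> var_x)"
  shows "\<exists>Qs. (\<forall>Q\<in>set Qs. degree Q \<ge> 2) \<and> degy (word Qs (\<rho> var_x)) = 0"
  using assms
proof (induction "degy (\<rho> var_x)" arbitrary: \<rho> rule: less_induct)
  case less
  define u where "u = \<rho> var_x"
  show ?case
  proof (cases "degy u = 0")
    case True
    then show ?thesis by (intro exI[of _ "[]"]) (simp add: u_def)
  next
    case False
    then obtain Q where Q: "degree Q = degx u div degy u" "degx (shear Q u) < degy u" "degy u dvd degx u"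
      using coordinate_reduction[OF less.prems(1)] less.prems(2) by (auto simp: u_def)
    obtain k where k: "degx u = degy u * k" using Q(3) by (auto simp: dvd_def)
    then have "k > 1" using less.prems(2) by (cases "k = 0 \<or> k = 1") (auto simp: u_def)
    then have Q2: "degree Q \<ge> 2" using Q(1) k False by simp
    define \<sigma> where "\<sigma> = swp \<circ> (shear Q \<circ> \<rho>)"
    have \<sigma>: "is_aut \<sigma>" unfolding \<sigma>_def by (intro is_aut_comp aut_swp aut_shear less.prems)
    have \<sigma>x: "\<sigma> var_x = swp (shear Q u)" by (simp add: \<sigma>_def u_def)
    have "degy (\<sigma> var_x) < degy (\<rho> var_x)" "degy (\<sigma> var_x) < degx (\<sigma> var_x)"
      using Q(2) by (simp_all add: \<sigma>x u_def)
    from less.hyps[OF this(1) \<sigma> this(2)] obtain Qs where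
      "\<forall>Q\<in>set Qs. degree Q \<ge> 2" "degy (word Qs (\<sigma> var_x)) = 0" by auto
    then show ?thesis using Q2 by (intro exI[of _ "Q # Qs"]) (simp add: \<sigma>x u_def)
  qed
qed

text \<open>If x goes to q(x) and y to v, the Jacobian q' * \<open>dy v\<close> is a nonzero
  constant. Both factors are then constants, so q is linear in x and v is linear in y with constant
  leading coefficient.\<close>

lemma triangular_of_degy_0:
  fixes \<sigma> :: "'a::field_char_0 bpoly \<Rightarrow> 'a bpoly"
  assumes \<sigma>: "is_aut \<sigma>" and "degy (\<sigma> var_x) = 0"
  obtains \<alpha> \<beta> \<gamma> r where "\<gamma> \<noteq> 0" "\<sigma> var_x = [:[:\<beta>, \<alpha>:]:]" "\<sigma> var_y = [:r, [:\<gamma>:]:]"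
proof -
  obtain q where q: "\<sigma> var_x = [:q:]" using assms(2) degree_eq_zeroE unfolding degy_degree by blast
  define v where "v = \<sigma> var_y"
  obtain c where c: "c \<noteq> 0" "jac (\<sigma> var_x) v = kconst c"
    using jac_aut_const[OF \<sigma>] unfolding v_def by metis
  then have p: "[:pderiv q:] * dy v = kconst c" by (simp add: jac_def q dx_pCons pderiv_pCons)
  then have nz: "[:pderiv q:] \<noteq> 0" "dy v \<noteq> 0" using c(1) by auto
  have "total_deg [:pderiv q:] + total_deg (dy v) = 0"
    unfolding total_deg_mult[OF nz, symmetric] p by simp
  then obtain \<alpha> \<gamma> where \<alpha>: "[:pderiv q:] = kconst \<alpha>" and \<gamma>: "dy v = kconst \<gamma>"
    by (auto simp: total_deg_0_iff)
  have lin: "p = [:coeff p 0, d:]" if "pderiv p = [:d:]" for p :: "'b::{idom,ring_char_0} poly" and d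
  proof (rule poly_eqI)
    fix n
    have e: "of_nat (Suc n) * coeff p (Suc n) = (if n = 0 then d else 0)" for n
      by (subst coeff_pderiv[symmetric], subst that) (simp add: coeff_pCons split: nat.splits)
    show "coeff p n = coeff [:coeff p 0, d:] n"
    proof (cases n)
      case (Suc m)
      then show ?thesis using e[of m] by (cases m) (auto simp del: of_nat_Suc simp: coeff_pCons)
    qed simp
  qed
  have "\<sigma> var_x = [:[:coeff q 0, \<alpha>:]:]" using lin[of q \<alpha>] \<alpha> q by simp
  moreover have "\<sigma> var_y = [:coeff v 0, [:\<gamma>:]:]" using lin[of v "[:\<gamma>:]"] \<gamma> by (simp add: v_def)
  moreover have "\<gamma> \<noteq> 0" using nz \<gamma> by auto
  ultimately show ?thesis using that by blast
qed

lemma total_deg_linear: "total_deg [:[:\<beta>, \<alpha>:]:] \<le> 1" "total_deg [:[:\<beta>, \<alpha>:], [:\<gamma>:]:] \<le> 1"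
  unfolding total_deg_le_iff by (auto simp: bcoeff_def coeff_pCons split: nat.splits if_splits)

lemma aut_decomposition:
  fixes \<rho> :: "'a::{alg_closed_field, field_char_0} bpoly \<Rightarrow> 'a bpoly"
  assumes \<rho>: "is_aut \<rho>" and "degy (\<rho> var_x) < degx (\<rho> var_x)"
  obtains Qs where "\<forall>Q\<in>set Qs. degree Q \<ge> 2" "aut_degree (word Qs \<circ> \<rho>) \<le> 1"
proof -
  obtain Qs where Qs: "\<forall>Q\<in>set Qs. degree Q \<ge> 2" "degy (word Qs (\<rho> var_x)) = 0"
    using coordinate_to_x[OF assms] by blast
  define \<sigma> where "\<sigma> = word Qs \<circ> \<rho>"
  have \<sigma>: "is_aut \<sigma>" unfolding \<sigma>_def by (rule is_aut_comp[OF aut_word \<rho>])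
  have "degy (\<sigma> var_x) = 0" using Qs(2) by (simp add: \<sigma>_def)
  then obtain \<alpha> \<beta> \<gamma> r where tri: "\<gamma> \<noteq> 0" "\<sigma> var_x = [:[:\<beta>, \<alpha>:]:]" "\<sigma> var_y = [:r, [:\<gamma>:]:]"
    by (rule triangular_of_degy_0[OF \<sigma>])
  show ?thesis
  proof (cases "degree r \<ge> 2")
    case True
    \<comment> \<open>One more letter removes r. It is appended only if its degree is at least 2, as
      required of letters; for smaller degree of r the map \<sigma> is affine already.\<close>
    define Q where "Q = smult (- inverse \<gamma>) r"
    have "degree Q = degree r" using tri(1) by (simp add: Q_def)
    moreover have "word (Qs @ [Q]) \<circ> \<rho> = swp \<circ> (shear Q \<circ> \<sigma>)" by (auto simp: word_append \<sigma>_def)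
    moreover have "shear Q (\<sigma> var_y) = [:0, [:\<gamma>:]:]"
      using tri(1) by (simp add: tri shear_def pcompose_pCons Q_def)
    moreover have "swp (shear Q (\<sigma> var_x)) = [:[:\<beta>:], [:\<alpha>:]:]" "swp [:0, [:\<gamma>:]:] = [:[:0, \<gamma>:]:]"
      by (rule bcoeff_eqI; auto simp: tri bcoeff_swp bcoeff_pCons coeff_pCons split: nat.splits)+
    ultimately have "aut_degree (word (Qs @ [Q]) \<circ> \<rho>) \<le> 1"
      using total_deg_linear(2)[of \<beta> 0 \<alpha>] total_deg_linear(1)[of 0 \<gamma>] by (simp add: aut_degree_def)
    then show ?thesis using that[of "Qs @ [Q]"] Qs(1) True \<open>degree Q = degree r\<close> by auto
  next
    case False
    have "r = [:coeff r 0, coeff r 1:]"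
    proof (rule poly_eqI)
      fix n
      show "coeff r n = coeff [:coeff r 0, coeff r 1:] n"
        using False by (auto simp: coeff_pCons coeff_eq_0 split: nat.splits)
    qed
    then obtain \<beta>' \<alpha>' where "r = [:\<beta>', \<alpha>':]" by blast
    then have "aut_degree \<sigma> \<le> 1"
      using tri total_deg_linear(1)[of \<beta> \<alpha>] total_deg_linear(2)[of \<beta>' \<alpha>' \<gamma>] by (simp add: aut_degree_def)
    then show ?thesis using that Qs(1) by (simp add: \<sigma>_def)
  qed
qed

section \<open>Total degree under substitutions, shears and words\<close>

lemma total_deg_0 [simp]: "total_deg 0 = 0"
  using total_deg_const[of 0] by simp

lemma total_deg_sub:
  assumes "total_deg u \<le> M" "total_deg v \<le> M"
  shows "total_deg (sub u v p) \<le> total_deg p * M"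
proof -
  have 1: "total_deg (ev1 (\<lambda>c. kconst c) u q) \<le> n * M" if "degree q \<le> n" for q n
    using that
  proof (induction q arbitrary: n)
    case (pCons a q)
    show ?case
    proof (cases "q = 0")
      case True
      then show ?thesis by (simp add: ev1_pCons[OF rhom_kconst])
    next
      case False
      then obtain n' where n: "n = Suc n'" "degree q \<le> n'" using pCons.prems by (cases n) auto
      have "total_deg (u * ev1 (\<lambda>c. kconst c) u q) \<le> n * M"
        using total_deg_mult_le[of u "ev1 (\<lambda>c. kconst c) u q"] pCons.IH[OF n(2)] assms(1) n(1) by simp
      then show ?thesis unfolding ev1_pCons[OF rhom_kconst] by (intro total_deg_add_le) auto
    qed
  qed simp
  have "total_deg (sub u v p) \<le> n * M" if "\<And>i j. bcoeff p i j \<noteq> 0 \<Longrightarrow> i + j \<le> n" for n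
    using that
  proof (induction p arbitrary: n)
    case (pCons q p)
    have "degree q \<le> n"
    proof (cases "q = 0")
      case False
      then have "bcoeff (pCons q p) (degree q) 0 \<noteq> 0" by (simp add: bcoeff_pCons)
      from pCons.prems[OF this] show ?thesis by simp
    qed simp
    note q = 1[OF this]
    have "total_deg (v * sub u v p) \<le> n * M"
    proof (cases "p = 0")
      case False
      obtain i j where ij: "bcoeff p i j \<noteq> 0" using False bcoeff_eqI[of p 0] by auto
      have le: "i + Suc j \<le> n" if "bcoeff p i j \<noteq> 0" for i j
        using pCons.prems[of i "Suc j"] that by (simp add: bcoeff_pCons)
      from le[OF ij] obtain n' where n: "n = Suc n'" by (cases n) auto
      have "total_deg (sub u v p) \<le> n' * M" by (rule pCons.IH) (use le n in force)
      then show ?thesis using total_deg_mult_le[of v "sub u v p"] assms(2) n by simp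
    qed simp
    then show ?case unfolding bev_pCons[OF rhom_kconst] using q by (intro total_deg_add_le)
  qed simp
  then show ?thesis using bcoeff_total_deg by blast
qed

lemma total_deg_aut: "is_aut \<rho> \<Longrightarrow> total_deg (\<rho> p) \<le> total_deg p * aut_degree \<rho>"
  using total_deg_sub[of "\<rho> var_x" "aut_degree \<rho>" "\<rho> var_y" p] is_aut_sub[of \<rho> p] by (simp add: aut_degree_def)

lemma total_deg_swp [simp]: "total_deg (swp p) = total_deg p"
proof -
  have "total_deg (swp p) \<le> total_deg p" for p :: "'b::field bpoly"
    using bcoeff_total_deg[of p] unfolding total_deg_le_iff bcoeff_swp by (metis add.commute)
  from this[of p] this[of "swp p"] show ?thesis by simp
qed

lemma total_deg_shear_le: "total_deg (shear Q p) \<le> total_deg p * max 1 (degree Q)"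
proof -
  have "total_deg [:Q, 1:] \<le> max 1 (degree Q)"
    unfolding total_deg_le_iff by (auto simp: bcoeff_def coeff_pCons one_pCons split: nat.splits if_splits dest: le_degree)
  then have "aut_degree (shear Q) \<le> max 1 (degree Q)" by (simp add: aut_degree_def)
  then show ?thesis using total_deg_aut[OF aut_shear, of Q p] by (meson le_trans mult_le_mono2)
qed

lemma total_deg_shear_linear: assumes "degree Q \<le> 1" shows "total_deg (shear Q p) = total_deg p"
  using total_deg_shear_le[of Q p] total_deg_shear_le[of "- Q" "shear Q p"] assms
  by (simp add: shear_shear max_absorb1)

text \<open>A letter is undone by the swap and the opposite shear, which together multiply the
  degree by at most \<open>degree Q\<close>.\<close>

lemma total_deg_word:
  "\<forall>Q\<in>set Qs. degree Q \<ge> 2 \<Longrightarrow> total_deg p \<le> total_deg (word Qs p) * prod_list (map degree Qs)"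
proof (induction Qs arbitrary: p)
  case (Cons Q Qs)
  have "total_deg p = total_deg (shear (- Q) (shear Q p))" by (simp add: shear_shear)
  also have "\<dots> \<le> total_deg (swp (shear Q p)) * degree Q"
    using total_deg_shear_le[of "- Q" "shear Q p"] Cons.prems by (simp add: max_def split: if_splits)
  also have "\<dots> \<le> (total_deg (word Qs (swp (shear Q p))) * prod_list (map degree Qs)) * degree Q"
    using Cons.prems by (intro mult_le_mono1 Cons.IH) auto
  finally show ?case by (simp add: mult_ac)
qed simp

text \<open>The descent starts from \<open>degy < degx\<close>; with equal degrees a letter of
  degree 1 would appear. That case is settled by a linear shear followed by the swap. The correction
  preserves total degrees, so it is harmless for the bound.\<close>

lemma linear_normalization:
  fixes \<rho> :: "'a::{alg_closed_field, field_char_0} bpoly \<Rightarrow> 'a bpoly"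
  assumes \<rho>: "is_aut \<rho>"
  obtains \<alpha> where "is_aut \<alpha>" "\<And>p. total_deg (\<alpha> p) = total_deg p" "degy (\<alpha> (\<rho> var_x)) < degx (\<alpha> (\<rho> var_x))"
proof -
  define u where "u = \<rho> var_x"
  consider "degy u < degx u" | "degx u < degy u" | "degx u = degy u" "degy u \<ge> 1" | "degx u = 0" "degy u = 0"
    by linarith
  then show ?thesis
  proof cases
    case 1
    then show ?thesis using that[of id] is_aut_id by (simp add: u_def)
  next
    case 2
    then show ?thesis using that[of swp] aut_swp by (simp add: u_def)
  next
    case 3
    then obtain s \<mu> where s: "degx u = degy u * s" "\<mu> \<noteq> 0" "degx (shear (monom \<mu> s) u) < degx u"
      using coordinate_reduction_step[OF \<rho>] unfolding u_def by (metis order_refl)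
    then have "s = 1" using 3 by simp
    then show ?thesis using that[of "swp \<circ> shear (monom \<mu> s)"] s 3
      by (simp add: is_aut_comp aut_swp aut_shear total_deg_shear_linear degree_monom_eq u_def)
  next
    case 4
    have "u = kconst (bcoeff u 0 0)"
    proof (rule bcoeff_eqI)
      fix i j
      show "bcoeff u i j = bcoeff (kconst (bcoeff u 0 0)) i j"
        using 4 degx_le_iff[of u 0] degy_le_iff[of u 0] by (auto simp: bcoeff_kconst)
    qed
    then have "ainv \<rho> u = kconst (bcoeff u 0 0)" using is_aut_const[OF is_aut_inv[OF \<rho>]] by metis
    then have "var_x = kconst (bcoeff u 0 0)" by (simp add: u_def is_aut_inv_simps[OF \<rho>])
    then show ?thesis by simp
  qed
qed

theorem aut_degree_bounded:
  fixes f :: "'a::{alg_closed_field, field_char_0} bpoly"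
  assumes f: "\<not> pencil f"
  obtains B where "\<And>\<rho>. is_aut \<rho> \<Longrightarrow> total_deg (\<rho> f) \<le> d \<Longrightarrow> aut_degree \<rho> \<le> B"
proof
  fix \<rho> :: "'a bpoly \<Rightarrow> 'a bpoly"
  assume \<rho>: "is_aut \<rho>" and d: "total_deg (\<rho> f) \<le> d"
  obtain \<alpha> where \<alpha>: "is_aut \<alpha>" "\<And>p. total_deg (\<alpha> p) = total_deg p" "degy (\<alpha> (\<rho> var_x)) < degx (\<alpha> (\<rho> var_x))"
    using linear_normalization[OF \<rho>] by blast
  have \<alpha>\<rho>: "is_aut (\<alpha> \<circ> \<rho>)" by (rule is_aut_comp[OF \<alpha>(1) \<rho>])
  obtain Qs where Qs: "\<forall>Q\<in>set Qs. degree Q \<ge> 2" "aut_degree (word Qs \<circ> (\<alpha> \<circ> \<rho>)) \<le> 1"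
    using aut_decomposition[OF \<alpha>\<rho>] \<alpha>(3) by auto
  define h where "h = \<alpha> (\<rho> f)"
  have h: "total_deg h \<le> d" "\<not> pencil h" using d f by (simp_all add: h_def \<alpha> pencil_aut[OF \<alpha>(1)] pencil_aut[OF \<rho>])
  have "degx h \<le> d" "degy h \<le> d" unfolding degx_le_iff degy_le_iff
    using h(1) bcoeff_total_deg[of h] by (meson add_leD1 add_leD2 le_trans)+
  \<comment> \<open>The word composed with \<open>\<alpha> \<circ> \<rho>\<close> has degree at most
    1 and does not raise the degree of f. So the word leads from h, of degree at most d, to a
    polynomial of degree at most \<open>total_deg f\<close>.\<close>
  moreover have "total_deg (word Qs h) \<le> total_deg f"
  proof -
    have "total_deg ((word Qs \<circ> (\<alpha> \<circ> \<rho>)) f) \<le> total_deg f * 1"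
      by (rule order.trans[OF total_deg_aut[OF is_aut_comp[OF aut_word \<alpha>\<rho>]] mult_le_mono2[OF Qs(2)]])
    then show ?thesis by (simp add: h_def)
  qed
  \<comment> \<open>The budget s of \<open>word_bound\<close> is 2 d, as both partial degrees of h
    are at most d.\<close>
  ultimately have prod: "prod_list (map degree Qs) \<le> (2 * d + total_deg f + 1) ^ (2 * d + 2)"
    by (intro word_bound[OF h(2) Qs(1)]) auto
  have "total_deg (\<rho> p) \<le> prod_list (map degree Qs)" if "total_deg (word Qs (\<alpha> (\<rho> p))) \<le> 1" for p
  proof -
    have "total_deg (\<rho> p) \<le> total_deg (word Qs (\<alpha> (\<rho> p))) * prod_list (map degree Qs)"
      using total_deg_word[OF Qs(1), of "\<alpha> (\<rho> p)"] by (simp add: \<alpha>)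
    also have "\<dots> \<le> 1 * prod_list (map degree Qs)" using that by (rule mult_le_mono1)
    finally show ?thesis by simp
  qed
  then have "aut_degree \<rho> \<le> prod_list (map degree Qs)" using Qs(2) by (simp add: aut_degree_def)
  then show "aut_degree \<rho> \<le> (2 * d + total_deg f + 1) ^ (2 * d + 2)" using prod by (rule le_trans)
qed

subsection \<open>Irreducible polynomials are prime\<close>

lemma bpoly_unit_iff: "p dvd 1 \<longleftrightarrow> p \<noteq> 0 \<and> p \<in> range kconst" for p :: "'a::field bpoly"
proof
  assume "p dvd 1"
  then obtain q where q: "p * q = 1" by (auto elim: dvdE)
  then have nz: "p \<noteq> 0" "q \<noteq> 0" by auto
  have "total_deg (p * q) = 0" unfolding q by (simp add: one_pCons)
  then have "total_deg p = 0" by (simp only: total_deg_mult[OF nz] add_is_0)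
  then show "p \<noteq> 0 \<and> p \<in> range kconst" using nz by (simp add: total_deg_0_iff)
next
  assume "p \<noteq> 0 \<and> p \<in> range kconst"
  then show "p dvd 1" by (auto simp: is_unit_const_poly_iff dvd_field_iff)
qed

lemma linear_const_prime: "prime_elem [:[:- z, 1:]:]" for z :: "'a::field"
  by (intro lift_prime_elem_poly field_poly_irreducible_imp_prime irreducible_linear_field_poly) simp

lemma linear_const_not_dvd:
  fixes p :: "'a::field bpoly"
  assumes "irreducible p" "degree p \<ge> 1"
  shows "\<not> [:[:- z, 1:]:] dvd p"
proof
  assume "[:[:- z, 1:]:] dvd p"
  then obtain t where t: "p = [:[:- z, 1:]:] * t" by (rule dvdE)
  have "\<not> [:[:- z, 1:]:] dvd 1" using linear_const_prime by (rule prime_elem_not_unit)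
  then have "t dvd 1" using irreducibleD[OF assms(1) t] by blast
  then have "degree t = 0" by (auto simp: bpoly_unit_iff)
  then have "degree p = 0" by (auto simp: t)
  then show False using assms(2) by simp
qed

lemma root_split:
  fixes c :: "'a::alg_closed_field poly"
  assumes "degree c = Suc n"
  obtains z c' where "c = [:- z, 1:] * c'" "degree c' = n" "c' \<noteq> 0"
proof -
  obtain z where "poly c z = 0" using alg_closed_imp_poly_has_root[of c] assms by auto
  then obtain c' where c': "c = [:- z, 1:] * c'" by (auto simp: poly_eq_0_iff_dvd elim: dvdE)
  then have "c' \<noteq> 0" using assms by auto
  moreover have "degree c' = n" using assms \<open>c' \<noteq> 0\<close> unfolding c' by (subst (asm) degree_mult_eq) auto
  ultimately show ?thesis using that c' by blast
qed

text \<open>Linear factors of c are split off one at a time: each is prime and does not divide p, so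
  it divides the cofactor of p and cancels.\<close>

lemma dvd_smult_cancel_irreducible:
  fixes p b :: "'a::alg_closed_field bpoly"
  assumes p: "irreducible p" "degree p \<ge> 1"
  shows "c \<noteq> 0 \<Longrightarrow> p dvd [:c:] * b \<Longrightarrow> p dvd b"
proof (induction "degree c" arbitrary: c)
  case 0
  then obtain a where a: "c = [:a:]" "a \<noteq> 0" by (metis degree_eq_zeroE pCons_0_0)
  have "p dvd kconst (inverse a) * ([:c:] * b)" using 0(3) by (rule dvd_mult)
  also have "kconst (inverse a) * ([:c:] * b) = b"
    using a by (simp add: mult.assoc[symmetric] del: mult_pCons_right flip: one_pCons)
  finally show ?case .
next
  case (Suc n)
  obtain z c' where c: "c = [:- z, 1:] * c'" "degree c' = n" "c' \<noteq> 0"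
    using root_split Suc.hyps(2)[symmetric] by blast
  define \<pi> where "\<pi> = [:[:- z, 1:]:]"
  obtain w where w: "[:c:] * b = p * w" using Suc.prems(2) by (rule dvdE)
  have cp: "[:c:] = \<pi> * [:c':]" by (simp add: \<pi>_def c)
  then have "\<pi> dvd p * w" unfolding w[symmetric] by (simp only: mult.assoc dvd_triv_left)
  then have "\<pi> dvd w" using linear_const_prime linear_const_not_dvd[OF p] prime_elem_dvd_multD unfolding \<pi>_def by blast
  then obtain w' where w': "w = \<pi> * w'" by (rule dvdE)
  have "\<pi> * ([:c':] * b) = \<pi> * (p * w')" using w unfolding cp w' by (simp only: mult_ac)
  moreover have "\<pi> \<noteq> 0" by (simp add: \<pi>_def)
  ultimately have "[:c':] * b = p * w'" using mult_left_cancel by blast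
  then have "p dvd [:c':] * b" by simp
  then show ?case using Suc.hyps(1)[of c'] c by blast
qed

text \<open>Each linear factor of c is prime and cancels against r or q; once c is constant,
  irreducibility of p decides. Restoring a factor from k[x] in r does not change its degree in
  y.\<close>

lemma factor_of_smult_irreducible:
  fixes p :: "'a::alg_closed_field bpoly"
  assumes p: "irreducible p" "degree p \<ge> 1"
  shows "c \<noteq> 0 \<Longrightarrow> [:c:] * p = r * q \<Longrightarrow> degree r = 0 \<or> p dvd r"
proof (induction "degree c" arbitrary: c r q)
  case 0
  then obtain a where a: "c = [:a:]" "a \<noteq> 0" by (metis degree_eq_zeroE pCons_0_0)
  have "p = (kconst (inverse a) * kconst a) * p" using a by (simp flip: one_pCons)
  also have "\<dots> = kconst (inverse a) * ([:c:] * p)" by (simp only: a(1) mult.assoc)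
  also have "\<dots> = r * (kconst (inverse a) * q)" unfolding 0(3) by (simp only: mult_ac)
  finally have *: "p = r * (kconst (inverse a) * q)" .
  from irreducibleD[OF p(1) *] show ?case
  proof
    assume "r dvd 1"
    then show ?case by (auto simp: bpoly_unit_iff)
  next
    assume "kconst (inverse a) * q dvd 1"
    then obtain t where t: "1 = kconst (inverse a) * q * t" by (rule dvdE)
    have "p * t = r * (kconst (inverse a) * q * t)" by (subst *) (simp only: mult_ac)
    then have "r = p * t" unfolding t[symmetric] by simp
    then show ?case by simp
  qed
next
  case (Suc n)
  obtain z c' where c: "c = [:- z, 1:] * c'" "degree c' = n" "c' \<noteq> 0"
    using root_split Suc.hyps(2)[symmetric] by blast
  define \<pi> where "\<pi> = [:[:- z, 1:]:]"
  have \<pi>0: "\<pi> \<noteq> 0" by (simp add: \<pi>_def)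
  have cp: "[:c:] = \<pi> * [:c':]" by (simp add: \<pi>_def c)
  then have "\<pi> dvd r * q" unfolding Suc.prems(2)[symmetric] by (simp only: mult.assoc dvd_triv_left)
  then consider "\<pi> dvd r" | "\<pi> dvd q" using linear_const_prime prime_elem_dvd_multD unfolding \<pi>_def by blast
  then show ?case
  proof cases
    case 1
    then obtain r' where r': "r = \<pi> * r'" by (rule dvdE)
    have "\<pi> * ([:c':] * p) = \<pi> * (r' * q)" using Suc.prems(2) unfolding cp r' by (simp only: mult_ac)
    then have "[:c':] * p = r' * q" using \<pi>0 mult_left_cancel by blast
    then have "degree r' = 0 \<or> p dvd r'" using Suc.hyps(1)[of c'] c by blast
    then show ?thesis
    proof
      assume "degree r' = 0"
      then obtain d where "r' = [:d:]" by (rule degree_eq_zeroE)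
      then show ?thesis by (simp add: r' \<pi>_def)
    next
      assume "p dvd r'"
      then show ?thesis unfolding r' by (intro disjI2 dvd_mult)
    qed
  next
    case 2
    then obtain q' where q': "q = \<pi> * q'" by (rule dvdE)
    have "\<pi> * ([:c':] * p) = \<pi> * (r * q')" using Suc.prems(2) unfolding cp q' by (simp only: mult_ac)
    then have "[:c':] * p = r * q'" using \<pi>0 mult_left_cancel by blast
    then show ?thesis using Suc.hyps(1)[of c'] c by blast
  qed
qed

text \<open>Gauss' lemma by hand: the coefficient ring \<open>k[x]\<close> is not an instance of the classes that the library version needs.\<close>

lemma irreducible_imp_prime_bpoly:
  fixes p :: "'a::alg_closed_field bpoly"
  assumes p: "irreducible p"
  shows "prime_elem p"
proof (cases "degree p = 0")
  case True
  then obtain q where q: "p = [:q:]" by (rule degree_eq_zeroE)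
  then have "irreducible q" using p by (simp add: irreducible_const_poly_iff)
  then show ?thesis unfolding q by (intro lift_prime_elem_poly field_poly_irreducible_imp_prime)
next
  case False
  then have deg: "degree p \<ge> 1" by simp
  show ?thesis
  proof (rule prime_elemI)
    fix a b assume ab: "p dvd a * b"
    show "p dvd a \<or> p dvd b"
    proof (rule disjCI)
      assume nb: "\<not> p dvd b"
      \<comment> \<open>Euclid's algorithm over k(x) without denominators: an element r of least
        y-degree in the ideal (a, p) divides each of its elements up to a nonzero factor in k[x].
        Either p divides r, and then a, or r lies in k[x] and p divides
        \<open>r * b\<close>.\<close>
      define I where "I = {s * a + t * p |s t. True}"
      have "p \<in> I" unfolding I_def by (rule CollectI, rule exI[of _ 0], rule exI[of _ 1]) simp
      have "a \<in> I" unfolding I_def by (rule CollectI, rule exI[of _ 1], rule exI[of _ 0]) simp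
      have "p \<noteq> 0" using p by auto
      define r where "r = arg_min degree (\<lambda>r. r \<in> I \<and> r \<noteq> 0)"
      have r: "r \<in> I" "r \<noteq> 0" and rmin: "\<And>t. t \<in> I \<Longrightarrow> t \<noteq> 0 \<Longrightarrow> degree r \<le> degree t"
        using arg_min_nat_lemma[of "\<lambda>r. r \<in> I \<and> r \<noteq> 0" p degree] \<open>p \<in> I\<close> \<open>p \<noteq> 0\<close> by (auto simp: r_def)
      have quot: "\<exists>c q. c \<noteq> 0 \<and> [:c:] * f = r * q" if f: "f \<in> I" for f
      proof -
        obtain q r' where qr: "pseudo_divmod f r = (q, r')" by fastforce
        define c where "c = coeff r (degree r) ^ (Suc (degree f) - degree r)"
        have e: "smult c f = r * q + r'" "r' = 0 \<or> degree r' < degree r"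
          using pseudo_divmod[OF r(2) qr] by (simp_all add: c_def)
        obtain s t s' t' where st: "f = s * a + t * p" "r = s' * a + t' * p" using f r(1) by (auto simp: I_def)
        have "r' = ([:c:] * s - q * s') * a + ([:c:] * t - q * t') * p"
        proof -
          have "r' = [:c:] * f - r * q" using e(1) by simp
          then show ?thesis unfolding st by (simp add: algebra_simps del: mult_pCons_left mult_pCons_right)
        qed
        then have "r' \<in> I" unfolding I_def by blast
        then have "r' = 0" using rmin e(2) by force
        moreover have "c \<noteq> 0" using r(2) by (simp add: c_def)
        ultimately show ?thesis using e(1) by auto
      qed
      obtain c q where c: "c \<noteq> 0" "[:c:] * p = r * q" using quot[OF \<open>p \<in> I\<close>] by blast
      from factor_of_smult_irreducible[OF p deg c] show "p dvd a"
      proof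
        assume "p dvd r"
        obtain c q where c: "c \<noteq> 0" "[:c:] * a = r * q" using quot[OF \<open>a \<in> I\<close>] by blast
        have "p dvd [:c:] * a" unfolding c(2) using \<open>p dvd r\<close> by (rule dvd_mult2)
        then show ?thesis using dvd_smult_cancel_irreducible[OF p deg] c(1) by blast
      next
        assume "degree r = 0"
        then obtain d where d: "r = [:d:]" by (rule degree_eq_zeroE)
        obtain s t where st: "r = s * a + t * p" using r(1) by (auto simp: I_def)
        have "[:d:] * b = s * (a * b) + p * (t * b)" unfolding d[symmetric] st by (simp add: algebra_simps)
        then have "p dvd [:d:] * b" using ab by simp
        then show ?thesis using dvd_smult_cancel_irreducible[OF p deg] d r(2) nb by force
      qed
    qed
  qed (use p in \<open>auto simp: irreducible_def\<close>)
qed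

lemma irreducible_factor_exists:
  fixes f :: "'a::field bpoly"
  assumes "f \<notin> range kconst"
  shows "\<exists>p. irreducible p \<and> p dvd f"
  using assms
proof (induction "total_deg f" arbitrary: f rule: less_induct)
  case less
  show ?case
  proof (cases "irreducible f")
    case False
    have f0: "f \<noteq> 0" "\<not> f dvd 1" using less.prems by (auto simp: bpoly_unit_iff intro: range_eqI[of _ _ 0])
    then obtain a b where ab: "f = a * b" "\<not> a dvd 1" "\<not> b dvd 1" using False by (auto simp: irreducible_def)
    then have nz: "a \<noteq> 0" "b \<noteq> 0" using f0 by auto
    then have "a \<notin> range kconst" "b \<notin> range kconst" using ab by (auto simp: bpoly_unit_iff)
    then have "total_deg a < total_deg f"
      unfolding ab(1) total_deg_mult[OF nz] using total_deg_0_iff[of b] by auto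
    then obtain p where "irreducible p" "p dvd a" using less.hyps \<open>a \<notin> range kconst\<close> by blast
    then show ?thesis using ab(1) by auto
  qed auto
qed

lemma irreducible_squarefree:
  fixes p :: "'a::field bpoly"
  assumes "irreducible p" shows "squarefree p"
proof (rule squarefreeI)
  fix x assume "x ^ 2 dvd p"
  then obtain t where "p = x ^ 2 * t" by (rule dvdE)
  then have "p = x * (x * t)" by (simp add: power2_eq_square mult.assoc)
  then have "x dvd 1 \<or> x * t dvd 1" by (rule irreducibleD[OF assms])
  then show "x dvd 1" by (auto dest: dvd_mult_left)
qed

lemma irreducible_not_const: "irreducible p \<Longrightarrow> p \<notin> range kconst" for p :: "'a::field bpoly"
  using bpoly_unit_iff[of p] by (auto simp: irreducible_def)

subsection \<open>Eigenvectors\<close>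

lemma eigenvector_iff: "eigenvector D f \<longleftrightarrow> f \<notin> range kconst \<and> f dvd D f"
  by (auto simp: eigenvector_def eigenvector_with_def dvd_def mult.commute)

lemma is_derivation_deriv: "is_derivation D \<Longrightarrow> deriv D"
  by (rule deriv_overD[OF is_derivation_deriv_over])

text \<open>Write f = p^k q with q not divisible by p. Modulo p^k, \<open>D f\<close> is k p^(k-1) q
  D(p), so p divides k q D(p), and k is a unit in characteristic zero.\<close>

lemma irreducible_factor_of_eigenvector:
  fixes D :: "'a::{alg_closed_field, field_char_0} bpoly \<Rightarrow> 'a bpoly"
  assumes D: "is_derivation D" and f: "f \<noteq> 0" "f dvd D f" and p: "irreducible p" "p dvd f"
  shows "p dvd D p"
proof -
  note d = is_derivation_deriv[OF D]
  have p0: "p \<noteq> 0" using p by auto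
  have pdeg: "total_deg p \<ge> 1" using irreducible_not_const[OF p(1)] total_deg_0_iff[of p] by simp
  have bound: "k \<le> total_deg f" if pk: "p ^ k dvd f" for k
  proof -
    obtain q where q: "f = p ^ k * q" using pk by (rule dvdE)
    then have "total_deg f = k * total_deg p + total_deg q"
      using f(1) p0 by (auto simp: total_deg_mult total_deg_power)
    then show ?thesis using pdeg by (metis le_add1 le_trans mult.right_neutral mult_le_mono2)
  qed
  define k where "k = (GREATEST k. p ^ k dvd f)"
  have k: "p ^ k dvd f" unfolding k_def using GreatestI_nat[of "\<lambda>k. p ^ k dvd f" 1 "total_deg f"] bound p(2) by simp
  have kmax: "\<not> p ^ Suc k dvd f"
  proof
    assume "p ^ Suc k dvd f"
    then have "Suc k \<le> k" unfolding k_def using Greatest_le_nat[of "\<lambda>k. p ^ k dvd f"] bound by blast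
    then show False by simp
  qed
  obtain l where l: "k = Suc l"
    using kmax p(2) by (cases k) auto
  obtain q where q: "f = p ^ k * q" using k by (rule dvdE)
  have "\<not> p dvd q" using kmax unfolding q by (auto simp: dvd_def mult_ac)
  have "p ^ k dvd D f" using k f(2) by (rule dvd_trans)
  moreover have "D f = p ^ k * D q + p ^ l * (of_nat k * (q * D p))"
  proof -
    have "D (p ^ k) = of_nat k * p ^ l * D p" using deriv_power[OF d, of p k] l by simp
    then show ?thesis unfolding q deriv_mult[OF d] by (simp only: mult_ac)
  qed
  ultimately have "p ^ k dvd p ^ l * (of_nat k * (q * D p))" by (simp add: dvd_add_right_iff)
  then have "p ^ l * p dvd p ^ l * (of_nat k * (q * D p))" by (simp add: l mult.commute)
  then have "p dvd of_nat k * (q * D p)" using p0 by (simp only: dvd_mult_cancel_left power_eq_0_iff simp_thms)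
  moreover have "\<not> p dvd of_nat k"
  proof
    assume "p dvd of_nat k"
    moreover have "of_nat k = kconst (of_nat k :: 'a)" by (induction k) (auto simp: one_pCons)
    ultimately have "p dvd kconst (of_nat k :: 'a)" by simp
    moreover have "kconst (of_nat k :: 'a) dvd 1" using l by (auto simp: bpoly_unit_iff simp del: of_nat_Suc)
    ultimately have "p dvd 1" by (rule dvd_trans)
    then show False using p(1) by (simp add: irreducible_def)
  qed
  ultimately show ?thesis
    using irreducible_imp_prime_bpoly[OF p(1)] \<open>\<not> p dvd q\<close> by (auto dest: prime_elem_dvd_multD)
qed

section \<open>Action of the isotropy group on eigenvectors\<close>

lemma isotropy_eigenvector:
  assumes "\<rho> \<in> isotropy D" "eigenvector D f"
  shows "eigenvector D (\<rho> f)"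
proof -
  have \<rho>: "is_aut \<rho>" and comm: "\<rho> (D p) = D (\<rho> p)" for p
    using assms(1) by (auto simp: isotropy_def fun_eq_iff)
  have "\<rho> f \<notin> range kconst"
  proof
    assume "\<rho> f \<in> range kconst"
    then obtain c where "\<rho> f = kconst c" by auto
    then have "f = kconst c" using is_aut_inv_simps(2)[OF \<rho>, of f] is_aut_const[OF is_aut_inv[OF \<rho>]] by metis
    then show False using assms(2) by (simp add: eigenvector_iff)
  qed
  moreover have "\<rho> f dvd D (\<rho> f)"
    using assms(2) rhom_mult[OF is_aut_rhom[OF \<rho>]] by (auto simp: eigenvector_iff dvd_def comm[symmetric])
  ultimately show ?thesis by (simp add: eigenvector_iff)
qed

lemma aut_dvd: assumes "is_aut \<rho>" "p dvd q" shows "\<rho> p dvd \<rho> q"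
  using assms rhom_mult[OF is_aut_rhom[OF assms(1)]] by (auto simp: dvd_def)

lemma aut_squarefree:
  assumes \<rho>: "is_aut \<rho>" and p: "squarefree p"
  shows "squarefree (\<rho> p)"
proof (rule squarefreeI)
  fix x assume "x ^ 2 dvd \<rho> p"
  from aut_dvd[OF is_aut_inv[OF \<rho>] this] have "(ainv \<rho> x) ^ 2 dvd p"
    by (simp add: is_aut_inv_simps[OF \<rho>] rhom_power[OF is_aut_rhom[OF is_aut_inv[OF \<rho>]]])
  then have "ainv \<rho> x dvd 1" using p by (rule squarefreeD[rotated])
  from aut_dvd[OF \<rho> this] show "x dvd 1"
    by (simp add: is_aut_inv_simps[OF \<rho>] rhom_1[OF is_aut_rhom[OF \<rho>]])
qed

lemma scalar_rel_refl: "(f, f) \<in> scalar_rel"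
  by (auto simp: scalar_rel_def intro: exI[of _ 1] simp flip: one_pCons)

lemma squarefree_eigenvectors_bounded:
  assumes "finite (eigen_classes D)"
  obtains B where "\<And>f. eigenvector D f \<Longrightarrow> squarefree f \<Longrightarrow> total_deg f \<le> B"
proof -
  have "finite (total_deg ` X)" if cls: "X \<in> eigen_classes D" for X
  proof -
    obtain g where X: "X = scalar_rel `` {g}" using cls unfolding eigen_classes_def by (elim quotientE) blast
    have "total_deg h \<le> total_deg g" if "h \<in> X" for h
    proof -
      obtain c where "h = kconst c * g" using \<open>h \<in> X\<close> by (auto simp: X scalar_rel_def)
      then show ?thesis using total_deg_mult_le[of "kconst c" g] by (simp del: mult_pCons_left)
    qed
    then have "total_deg ` X \<subseteq> {..total_deg g}" by auto
    then show ?thesis by (rule finite_subset) simp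
  qed
  then have fin: "finite (\<Union>X\<in>eigen_classes D. total_deg ` X)" using assms by blast
  show ?thesis
  proof (rule that)
    fix f assume f: "eigenvector D f" "squarefree f"
    then have 1: "scalar_rel `` {f} \<in> eigen_classes D" unfolding eigen_classes_def by (intro quotientI) simp
    have "f \<in> scalar_rel `` {f}" using scalar_rel_refl by (rule ImageI) simp
    then have "total_deg f \<in> (\<Union>X\<in>eigen_classes D. total_deg ` X)" by (intro UN_I[OF 1] imageI)
    then show "total_deg f \<le> Max (\<Union>X\<in>eigen_classes D. total_deg ` X)" by (rule Max_ge[OF fin])
  qed
qed

text \<open>f need not be square-free, so one irreducible factor p is split off at a time. Its
  images are square-free eigenvectors, of degree at most B, and the cofactor q again satisfies
  \<open>q dvd D q\<close>.\<close>

lemma eigenvector_orbit_bounded: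
  fixes D :: "'a::{alg_closed_field, field_char_0} bpoly \<Rightarrow> 'a bpoly"
  assumes D: "is_derivation D" and fin: "finite (eigen_classes D)"
  shows "eigenvector D f \<Longrightarrow> \<exists>d. \<forall>\<rho>\<in>isotropy D. total_deg (\<rho> f) \<le> d"
proof (induction "total_deg f" arbitrary: f rule: less_induct)
  case less
  obtain B where B: "\<And>f. eigenvector D f \<Longrightarrow> squarefree f \<Longrightarrow> total_deg f \<le> B"
    using squarefree_eigenvectors_bounded[OF fin] by blast
  have f: "f \<notin> range kconst" "f dvd D f" using less.prems by (auto simp: eigenvector_iff)
  then have f0: "f \<noteq> 0" by (auto intro: range_eqI[of _ _ 0])
  obtain p where p: "irreducible p" "p dvd f" using irreducible_factor_exists[OF f(1)] by blast
  have pD: "p dvd D p" by (rule irreducible_factor_of_eigenvector[OF D f0 f(2) p])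
  have pc: "p \<notin> range kconst" by (rule irreducible_not_const[OF p(1)])
  obtain q where q: "f = p * q" using p(2) by (rule dvdE)
  have nz: "p \<noteq> 0" "q \<noteq> 0" using q f0 by auto
  have qD: "q dvd D q"
  proof -
    obtain m where m: "D p = p * m" using pD by (rule dvdE)
    have "D f = p * (D q + q * m)" unfolding q deriv_mult[OF is_derivation_deriv[OF D]] m by (simp add: algebra_simps)
    then have "p * q dvd p * (D q + q * m)" using f(2) q by simp
    then have "q dvd D q + q * m" using nz by simp
    then show ?thesis by (simp add: dvd_add_left_iff)
  qed
  have pB: "total_deg (\<rho> p) \<le> B" if "\<rho> \<in> isotropy D" for \<rho>
  proof (rule B)
    show "eigenvector D (\<rho> p)" using isotropy_eigenvector[OF that] pc pD by (simp add: eigenvector_iff)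
    show "squarefree (\<rho> p)" using that irreducible_squarefree[OF p(1)] aut_squarefree by (auto simp: isotropy_def)
  qed
  have mult: "total_deg (\<rho> f) \<le> total_deg (\<rho> p) + total_deg (\<rho> q)" if "\<rho> \<in> isotropy D" for \<rho>
  proof -
    have \<rho>: "is_aut \<rho>" using that by (simp add: isotropy_def)
    show ?thesis unfolding q rhom_mult[OF is_aut_rhom[OF \<rho>]] by (rule total_deg_mult_le)
  qed
  have "\<exists>d. \<forall>\<rho>\<in>isotropy D. total_deg (\<rho> q) \<le> d"
  proof (cases "q \<in> range kconst")
    case True
    then obtain c where "q = kconst c" by auto
    then have "\<forall>\<rho>\<in>isotropy D. total_deg (\<rho> q) \<le> 0" by (auto simp: isotropy_def is_aut_const)
    then show ?thesis by blast
  next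
    case False
    have "total_deg q < total_deg f" unfolding q total_deg_mult[OF nz] using total_deg_0_iff[of p] pc by auto
    then show ?thesis using less.hyps False qD by (simp add: eigenvector_iff)
  qed
  then obtain d where "\<forall>\<rho>\<in>isotropy D. total_deg (\<rho> q) \<le> d" by blast
  then have "\<forall>\<rho>\<in>isotropy D. total_deg (\<rho> f) \<le> B + d" using pB mult by (meson add_mono le_trans)
  then show ?case by blast
qed

lemma derivation_const: "is_derivation D \<Longrightarrow> D (kconst c) = 0"
  using is_derivation_deriv_over unfolding deriv_over_def by blast

text \<open>The elements f - c with c in k are killed by D and pairwise comaximal. Irreducible
  factors chosen from them are eigenvectors in distinct classes, and k is infinite.\<close>

lemma infinite_eigen_classes:
  fixes D :: "'a::{alg_closed_field, field_char_0} bpoly \<Rightarrow> 'a bpoly"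
  assumes D: "is_derivation D" and f: "f \<notin> range kconst" "D f = 0"
  shows "infinite (eigen_classes D)"
proof
  assume fin: "finite (eigen_classes D)"
  have nc: "f - kconst c \<notin> range kconst" for c
  proof
    assume "f - kconst c \<in> range kconst"
    then obtain d where "f - kconst c = kconst d" by auto
    then have "f = kconst (d + c)" by (simp add: diff_eq_eq)
    then show False using f(1) by auto
  qed
  then have "\<exists>p. irreducible p \<and> p dvd f - kconst c" for c by (rule irreducible_factor_exists)
  then obtain p where p: "\<And>c. irreducible (p c)" "\<And>c. p c dvd f - kconst c" by metis
  have ev: "eigenvector D (p c)" for c
  proof -
    have "D (f - kconst c) = 0" using deriv_diff[OF is_derivation_deriv[OF D]] f(2) derivation_const[OF D] by simp
    moreover have "f - kconst c \<noteq> 0" using nc[of c] by (auto intro: range_eqI[of _ _ 0])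
    ultimately show ?thesis
      using irreducible_factor_of_eigenvector[OF D _ _ p] irreducible_not_const[OF p(1)] by (simp add: eigenvector_iff)
  qed
  have "inj (\<lambda>c. scalar_rel `` {p c})"
  proof (rule injI, rule ccontr)
    fix c d assume eq: "scalar_rel `` {p c} = scalar_rel `` {p d}" and "c \<noteq> d"
    have "p d \<in> scalar_rel `` {p c}" using eq scalar_rel_refl[of "p d"] by auto
    then obtain e where "p d = kconst e * p c" by (auto simp: scalar_rel_def)
    then have "p c dvd p d" by (metis dvd_triv_right)
    then have "p c dvd f - kconst d" using p(2) by (rule dvd_trans)
    then have "p c dvd (f - kconst d) - (f - kconst c)" using p(2) by (rule dvd_diff)
    then have "p c dvd kconst (c - d)" by simp
    moreover have "kconst (c - d) dvd 1" using \<open>c \<noteq> d\<close> by (auto simp: bpoly_unit_iff)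
    ultimately have "p c dvd 1" by (rule dvd_trans)
    then show False using p(1)[of c] by (simp add: irreducible_def)
  qed
  moreover have "range (\<lambda>c. scalar_rel `` {p c}) \<subseteq> eigen_classes D"
    unfolding eigen_classes_def using ev irreducible_squarefree[OF p(1)] by (auto intro: quotientI)
  ultimately have "finite (UNIV :: 'a set)" using fin by (metis finite_imageD finite_subset)
  then show False by (simp add: infinite_UNIV_char_0)
qed

subsection \<open>The kernel of a derivation\<close>

text \<open>The Jacobian matrix of (r, s) annihilates the nonzero vector (D x, D y), so its
  determinant vanishes.\<close>

lemma kernel_jac:
  assumes D: "is_derivation D" "D \<noteq> (\<lambda>_. 0)" and r: "D r = 0" and s: "D s = 0"
  shows "jac r s = 0"
proof -
  note f = derivation_formula[OF is_derivation_deriv_over[OF D(1)]]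
  have 1: "dx r * D var_x = - (dy r * D var_y)" "dx s * D var_x = - (dy s * D var_y)"
    using f[of r] f[of s] r s by (simp_all add: eq_neg_iff_add_eq_0)
  have "jac r s * D var_x = (dx r * D var_x) * dy s - dy r * (dx s * D var_x)"
    by (simp add: jac_def algebra_simps)
  also have "\<dots> = 0" unfolding 1 by (simp add: algebra_simps)
  finally have x: "jac r s * D var_x = 0" .
  have "jac r s * D var_y = - (dx r * - (dy s * D var_y)) + dx s * - (dy r * D var_y)"
    by (simp add: jac_def algebra_simps)
  also have "\<dots> = 0" unfolding 1[symmetric] by (simp add: algebra_simps)
  finally have y: "jac r s * D var_y = 0" .
  have "D var_x \<noteq> 0 \<or> D var_y \<noteq> 0"
  proof (rule ccontr)
    assume "\<not> (D var_x \<noteq> 0 \<or> D var_y \<noteq> 0)"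
    then have "D p = 0" for p using f[of p] by simp
    then show False using D(2) by auto
  qed
  then show ?thesis using x y by auto
qed

lemma jac_smult: "jac (r - kconst c * s) s = jac r s"
proof -
  have d: "dx (r - kconst c * s) = dx r - kconst c * dx s" "dy (r - kconst c * s) = dy r - kconst c * dy s"
    by (simp_all add: deriv_diff[OF deriv_overD[OF deriv_dx]] dx_mult pderiv_diff pderiv_mult
        del: mult_pCons_left mult_pCons_right)
  show ?thesis unfolding jac_def d by (simp add: algebra_simps del: mult_pCons_left mult_pCons_right)
qed

lemma x_dx_monom: "var_x * dx (monom (monom a i) j) = of_nat i * monom (monom a i) j"
  and y_dy_monom: "var_y * dy (monom (monom a i) j) = of_nat j * monom (monom a i) j"
proof -
  have nat: "of_nat k = kconst (of_nat k :: 'a)" for k by (induction k) (auto simp: one_pCons)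
  show "var_x * dx (monom (monom a i) j) = of_nat i * monom (monom a i) j"
    by (rule bcoeff_eqI) (auto simp: bcoeff_x_mult nat bcoeff_const_mult bcoeff_monom dx_def map_poly_monom pderiv_monom
        simp del: mult_pCons_left)
  show "var_y * dy (monom (monom a i) j) = of_nat j * monom (monom a i) j"
  proof -
    have "dy (monom (monom a i) j) = monom (monom (of_nat j * a) i) (j - 1)"
      by (simp add: pderiv_monom of_nat_poly smult_monom)
    then show ?thesis by (cases j) (simp_all add: monom_Suc of_nat_poly smult_monom del: of_nat_Suc)
  qed
qed

text \<open>Multiplied by x y, the Jacobian of two monomials is i l - j k times their product, by
  Euler's rule in each variable.\<close>

lemma jac_monom_nonzero:
  fixes a b :: "'a::field_char_0"
  assumes "a \<noteq> 0" "b \<noteq> 0" "i * l \<noteq> j * k"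
  shows "jac (monom (monom a i) j) (monom (monom b k) l) \<noteq> 0"
proof
  define p where "p = monom (monom a i) j"
  define q where "q = monom (monom b k) l"
  assume "jac (monom (monom a i) j) (monom (monom b k) l) = 0"
  then have "0 = var_x * var_y * jac p q" by (simp add: p_def q_def)
  also have "\<dots> = (var_x * dx p) * (var_y * dy q) - (var_y * dy p) * (var_x * dx q)"
    by (simp only: jac_def algebra_simps)
  also have "\<dots> = (of_nat (i * l) - of_nat (j * k)) * (p * q)"
    unfolding p_def q_def x_dx_monom y_dy_monom by (simp add: algebra_simps)
  finally have "of_nat (i * l) = (of_nat (j * k) :: 'a bpoly)"
    using assms(1,2) by (auto simp: p_def q_def)
  then show False using assms(3) by (simp only: of_nat_eq_iff)
qed

text \<open>Forms of equal positive degree with zero Jacobian are proportional. The constant c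
  clears from r the monomial of highest x-exponent in the top form of s. If z still had degree N,
  the leading monomials of the two top forms would be different but of equal degree, so their
  Jacobian would be nonzero. Two passages to top components, for the weights (1, 1) and (1, 0),
  contradict \<open>jac z s = 0\<close>.\<close>

lemma kernel_leaf:
  fixes D :: "'a::field_char_0 bpoly \<Rightarrow> 'a bpoly"
  assumes D: "is_derivation D" "D \<noteq> (\<lambda>_. 0)" and r: "D r = 0" and s: "D s = 0"
    and N: "total_deg r = N" "total_deg s = N" "N \<ge> 1"
  obtains c where "total_deg (r - kconst c * s) < N"
proof -
  define top where "top p = coeff (wt 1 1 p) N" for p :: "'a bpoly"
  have top: "bcoeff (top p) i j = (if i + j = N then bcoeff p i j else 0)" for p i j
    by (simp add: top_def bcoeff_wt)
  have top0: "top p \<noteq> 0" if "total_deg p = N" for p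
  proof -
    have "p \<noteq> 0" using that N(3) by auto
    then show ?thesis using that by (auto simp: top_def total_deg_wt)
  qed
  define k where "k = degx (top s)"
  obtain l where kl: "bcoeff (top s) k l \<noteq> 0"
    using wt_attained[OF top0[OF N(2)], of 1 0] by (auto simp: k_def degx_def)
  then have l: "k + l = N" "bcoeff s k l \<noteq> 0" by (auto simp: top split: if_splits)
  define c where "c = bcoeff r k l / bcoeff s k l"
  define z where "z = r - kconst c * s"
  have zN: "total_deg z \<le> N" unfolding z_def using N total_deg_mult_le[of "kconst c" s]
    by (intro total_deg_diff_le) (simp_all del: mult_pCons_left)
  have z0: "bcoeff z k l = 0"
    using l(2) by (simp only: z_def bcoeff_simps bcoeff_const_mult) (simp add: c_def)
  have "jac z s = 0" unfolding z_def jac_smult by (rule kernel_jac[OF D r s])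
  have "total_deg z \<noteq> N"
  proof
    assume eq: "total_deg z = N"
    have "jac (top z) (top s) = 0"
    proof (rule ccontr)
      assume "jac (top z) (top s) \<noteq> 0"
      then obtain n' where "coeff (wt 1 1 (jac z s)) n' = jac (top z) (top s)"
        unfolding top_def using wt_jac_top[of 1 1 z N s N] eq N(2) by (auto simp: total_deg_wt)
      then show False using \<open>jac z s = 0\<close> \<open>jac (top z) (top s) \<noteq> 0\<close> by (simp add: rhom_0[OF rhom_wt])
    qed
    define i where "i = degx (top z)"
    obtain j where ij: "bcoeff (top z) i j \<noteq> 0"
      using wt_attained[OF top0[OF eq], of 1 0] by (auto simp: i_def degx_def)
    then have j: "i + j = N" "bcoeff z i j \<noteq> 0" by (auto simp: top split: if_splits)
    have lead: "coeff (wt 1 0 (top p)) m = monom (monom (bcoeff p m n) m) n" if "m + n = N" for p m n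
      by (rule bcoeff_eqI) (use that in \<open>auto simp: bcoeff_wt top bcoeff_monom\<close>)
    have "i \<noteq> k" using j l z0 by auto
    have "i * l \<noteq> j * k"
    proof
      assume "i * l = j * k"
      then have "i * (k + l) = (i + j) * k" by (simp add: algebra_simps)
      then show False using \<open>i \<noteq> k\<close> l(1) j(1) N(3) by simp
    qed
    then have nz: "jac (coeff (wt 1 0 (top z)) i) (coeff (wt 1 0 (top s)) k) \<noteq> 0"
      unfolding lead[OF j(1)] lead[OF l(1)] using jac_monom_nonzero j(2) l(2) by blast
    then obtain n' where "coeff (wt 1 0 (jac (top z) (top s))) n' = jac (coeff (wt 1 0 (top z)) i) (coeff (wt 1 0 (top s)) k)"
      using wt_jac_top[of 1 0 "top z" i "top s" k] by (auto simp: i_def k_def degx_def)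
    then show False using nz \<open>jac (top z) (top s) = 0\<close> by (simp add: rhom_0[OF rhom_wt])
  qed
  then have "total_deg z < N" using zN by simp
  then show ?thesis using that unfolding z_def by blast
qed

text \<open>The ring \<open>R = ker D\<close> is spanned over \<open>k[p]\<close> by finitely many elements, one for each
  residue class of degrees modulo the degree of \<open>p\<close>.\<close>

lemma kernel_degree_bound:
  fixes D :: "'a::field_char_0 bpoly \<Rightarrow> 'a bpoly"
  assumes D: "is_derivation D" "D \<noteq> (\<lambda>_. 0)" and \<rho>: "is_aut \<rho>"
    and p: "D p = 0" "total_deg p \<ge> 1"
  obtains C where "\<And>r. D r = 0 \<Longrightarrow> total_deg p * total_deg (\<rho> r) \<le> total_deg (\<rho> p) * total_deg r + C"
proof -
  note d = is_derivation_deriv[OF D(1)]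
  define m where "m = total_deg p"
  define \<phi> where "\<phi> r = total_deg (\<rho> r)" for r
  have "\<exists>g. (\<exists>r. D r = 0 \<and> r \<noteq> 0 \<and> total_deg r mod m = i) \<longrightarrow> (D g = 0 \<and> g \<noteq> 0 \<and> total_deg g mod m = i) \<and>
      (\<forall>r. D r = 0 \<and> r \<noteq> 0 \<and> total_deg r mod m = i \<longrightarrow> total_deg g \<le> total_deg r)" for i
    using ex_has_least_nat[of "\<lambda>r. D r = 0 \<and> r \<noteq> 0 \<and> total_deg r mod m = i" _ total_deg] by blast
  then obtain g where g: "\<And>i r. D r = 0 \<Longrightarrow> r \<noteq> 0 \<Longrightarrow> total_deg r mod m = i \<Longrightarrow>
      D (g i) = 0 \<and> g i \<noteq> 0 \<and> total_deg (g i) mod m = i \<and> total_deg (g i) \<le> total_deg r"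
    by metis
  \<comment> \<open>C has to dominate \<open>m * \<phi> (g i)\<close> for every residue i. A residue
    without nonzero kernel elements contributes an arbitrary value, which only enlarges C.\<close>
  define C where "C = (\<Sum>i<m. m * \<phi> (g i))"
  have "m * \<phi> r \<le> \<phi> p * total_deg r + C" if "D r = 0" for r
    using that
  proof (induction "total_deg r" arbitrary: r rule: less_induct)
    case less
    show ?case
    proof (cases "total_deg r = 0")
      case True
      then have "\<phi> r = 0" using total_deg_0_iff[of r] by (auto simp: \<phi>_def is_aut_const[OF \<rho>])
      then show ?thesis by simp
    next
      case False
      define i where "i = total_deg r mod m"
      have r0: "r \<noteq> 0" using False by auto
      have gi: "D (g i) = 0" "g i \<noteq> 0" "total_deg (g i) mod m = i" "total_deg (g i) \<le> total_deg r"
        using g[OF less.prems r0 i_def[symmetric]] by auto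
      have p0: "p \<noteq> 0" using p(2) by auto
      have "m dvd total_deg r - total_deg (g i)" using mod_eq_dvd_iff_nat[OF gi(4), of m] gi(3) by (simp add: i_def)
      then obtain j where "total_deg r - total_deg (g i) = m * j" by (auto simp: dvd_def)
      then have j: "total_deg r = total_deg (g i) + m * j" using gi(4) by simp
      \<comment> \<open>Built to have the degree of r, so that \<open>kernel_leaf\<close> leaves a
        remainder z of lower degree. The j factors p raise the degree of the image by
        \<open>j * \<phi> p\<close> against m j for s itself, which is the slope of the
        bound.\<close>
      define s where "s = p ^ j * g i"
      have Ds: "D s = 0" by (simp add: s_def deriv_mult[OF d] deriv_power[OF d] p gi)
      have "total_deg s = total_deg r"
        using p0 gi(2) by (simp add: s_def total_deg_mult total_deg_power j m_def)
      then obtain c where c: "total_deg (r - kconst c * s) < total_deg r"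
        using kernel_leaf[OF D less.prems Ds refl] False by (metis less_one not_less)
      define z where "z = r - kconst c * s"
      have Dz: "D z = 0"
        by (simp add: z_def deriv_diff[OF d] deriv_mult[OF d] Ds less.prems derivation_const[OF D(1)]
            del: mult_pCons_left)
      have zb: "m * \<phi> z \<le> \<phi> p * total_deg r + C"
      proof -
        have "m * \<phi> z \<le> \<phi> p * total_deg z + C" using less.hyps[of z] c Dz by (simp add: z_def)
        also have "\<dots> \<le> \<phi> p * total_deg r + C" using c by (intro add_right_mono mult_le_mono2) (simp add: z_def)
        finally show ?thesis .
      qed
      have hm: "\<rho> (a * b) = \<rho> a * \<rho> b" "\<rho> (a ^ n) = \<rho> a ^ n" "\<rho> (a + b) = \<rho> a + \<rho> b" for a b n
        using rhom_mult rhom_power rhom_add is_aut_rhom[OF \<rho>] by blast+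
      have "i < m" using p(2) by (simp add: i_def m_def)
      then have gC: "m * \<phi> (g i) \<le> C" unfolding C_def by (intro member_le_sum) auto
      have "\<phi> (kconst c * s) \<le> 0 + (j * \<phi> p + \<phi> (g i))"
        unfolding \<phi>_def s_def hm is_aut_const[OF \<rho>]
        by (intro order.trans[OF total_deg_mult_le] add_mono total_deg_power_le) simp_all
      then have "m * \<phi> (kconst c * s) \<le> m * (j * \<phi> p + \<phi> (g i))" by simp
      also have "\<dots> = \<phi> p * (m * j) + m * \<phi> (g i)" by (simp add: algebra_simps)
      also have "\<dots> \<le> \<phi> p * total_deg r + C" using gC by (intro add_mono mult_le_mono2) (simp_all add: j)
      finally have sb: "m * \<phi> (kconst c * s) \<le> \<phi> p * total_deg r + C" .
      have "r = z + kconst c * s" by (simp add: z_def)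
      then have "\<rho> r = \<rho> z + \<rho> (kconst c * s)" using hm(3) by metis
      then have "\<phi> r \<le> max (\<phi> z) (\<phi> (kconst c * s))" unfolding \<phi>_def
        by (simp only:) (intro total_deg_add_le, simp_all)
      then show ?thesis using zb sb by (auto simp: max_def split: if_splits intro: le_trans[OF mult_le_mono2])
    qed
  qed
  then show ?thesis by (intro that[of C]) (simp add: m_def \<phi>_def)
qed

text \<open>For the powers r^n both sides of \<open>kernel_degree_bound\<close> grow linearly in n
  while C stays fixed; n = C + 1 already refutes a strict excess.\<close>

lemma kernel_degree_ratio:
  fixes D :: "'a::field_char_0 bpoly \<Rightarrow> 'a bpoly"
  assumes D: "is_derivation D" "D \<noteq> (\<lambda>_. 0)" and \<rho>: "is_aut \<rho>"
    and p: "D p = 0" "total_deg p \<ge> 1" and r: "D r = 0"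
  shows "total_deg p * total_deg (\<rho> r) \<le> total_deg (\<rho> p) * total_deg r"
proof (cases "r = 0")
  case True
  then show ?thesis using rhom_0[OF is_aut_rhom[OF \<rho>]] by simp
next
  case False
  obtain C where C: "\<And>r. D r = 0 \<Longrightarrow> total_deg p * total_deg (\<rho> r) \<le> total_deg (\<rho> p) * total_deg r + C"
    using kernel_degree_bound[OF D \<rho> p] by blast
  have \<rho>r: "\<rho> r \<noteq> 0" using False is_aut_inv_simps(2)[OF \<rho>, of r] rhom_0[OF is_aut_rhom[OF is_aut_inv[OF \<rho>]]] by metis
  have pow: "total_deg p * total_deg (\<rho> r) * n \<le> total_deg (\<rho> p) * total_deg r * n + C" for n
  proof -
    have "D (r ^ n) = 0" using deriv_power[OF is_derivation_deriv[OF D(1)], of r n] r by simp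
    from C[OF this] show ?thesis
      using False \<rho>r by (simp add: rhom_power[OF is_aut_rhom[OF \<rho>]] total_deg_power mult_ac)
  qed
  show ?thesis
  proof (rule ccontr)
    assume "\<not> ?thesis"
    then have "total_deg (\<rho> p) * total_deg r + 1 \<le> total_deg p * total_deg (\<rho> r)" by simp
    then have "(total_deg (\<rho> p) * total_deg r + 1) * (C + 1) \<le> total_deg p * total_deg (\<rho> r) * (C + 1)"
      by (rule mult_le_mono1)
    with pow[of "C + 1"] have "(total_deg (\<rho> p) * total_deg r + 1) * (C + 1) \<le> total_deg (\<rho> p) * total_deg r * (C + 1) + C"
      by linarith
    then show False by (simp add: algebra_simps)
  qed
qed

lemma isotropy_inv:
  assumes "\<rho> \<in> isotropy D" shows "ainv \<rho> \<in> isotropy D"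
proof -
  have \<rho>: "is_aut \<rho>" and comm: "\<rho> (D p) = D (\<rho> p)" for p
    using assms by (auto simp: isotropy_def fun_eq_iff)
  have "ainv \<rho> (D p) = D (ainv \<rho> p)" for p
    using comm[of "ainv \<rho> p"] by (metis is_aut_inv_simps[OF \<rho>])
  then show ?thesis using is_aut_inv[OF \<rho>] by (auto simp: isotropy_def)
qed

lemma isotropy_kernel_degree:
  fixes D :: "'a::field_char_0 bpoly \<Rightarrow> 'a bpoly"
  assumes D: "is_derivation D" "D \<noteq> (\<lambda>_. 0)" and f: "D f = 0" "total_deg f \<ge> 1" and \<rho>: "\<rho> \<in> isotropy D"
  shows "total_deg (\<rho> f) = total_deg f"
proof -
  define K where "K g \<longleftrightarrow> D g = 0 \<and> total_deg g \<ge> 1" for g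
  have stable: "K (\<sigma> g)" if \<sigma>: "\<sigma> \<in> isotropy D" and g: "K g" for \<sigma> g
  proof -
    have a: "is_aut \<sigma>" and comm: "\<sigma> (D p) = D (\<sigma> p)" for p using \<sigma> by (auto simp: isotropy_def fun_eq_iff)
    have "D (\<sigma> g) = 0" using comm[of g] g rhom_0[OF is_aut_rhom[OF a]] by (simp add: K_def)
    moreover have "total_deg (\<sigma> g) \<noteq> 0"
    proof
      assume "total_deg (\<sigma> g) = 0"
      then obtain c where "\<sigma> g = kconst c" by (auto simp: total_deg_0_iff)
      then have "g = kconst c" using is_aut_inv_simps(2)[OF a, of g] is_aut_const[OF is_aut_inv[OF a]] by metis
      then show False using g by (simp add: K_def)
    qed
    ultimately show ?thesis by (simp add: K_def)
  qed
  have ratio: "total_deg g * total_deg (\<rho> h) = total_deg (\<rho> g) * total_deg h" if "K g" "K h" for g h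
    using that \<rho> kernel_degree_ratio[OF D, of \<rho> g h] kernel_degree_ratio[OF D, of \<rho> h g]
    by (simp add: K_def isotropy_def mult.commute)
  have Kf: "K f" using f by (simp add: K_def)
  define g where "g = arg_min total_deg K"
  have g: "K g" "\<And>h. K h \<Longrightarrow> total_deg g \<le> total_deg h"
    using arg_min_nat_lemma[of K f total_deg] Kf by (auto simp: g_def)
  define h where "h = ainv \<rho> g"
  have h: "K h" "\<rho> h = g"
    using stable[OF isotropy_inv[OF \<rho>] g(1)] \<rho> by (auto simp: h_def isotropy_def is_aut_inv_simps)
  have ge: "total_deg g \<le> total_deg h" "total_deg g \<le> total_deg (\<rho> g)"
    using g(2) h(1) stable[OF \<rho> g(1)] by auto
  \<comment> \<open>The relation for g and its preimage h writes the square of the least degree as a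
    product of two degrees that are no smaller, so both are equal to it.\<close>
  have "total_deg g * total_deg g = total_deg (\<rho> g) * total_deg h" using ratio[OF g(1) h(1)] h(2) by simp
  moreover have "total_deg (\<rho> g) * total_deg g \<le> total_deg (\<rho> g) * total_deg h" using ge by simp
  ultimately have "total_deg (\<rho> g) * total_deg g \<le> total_deg g * total_deg g" by linarith
  then have "total_deg (\<rho> g) \<le> total_deg g" using g(1) by (simp add: K_def)
  then have eq: "total_deg (\<rho> g) = total_deg g" using ge by simp
  then show ?thesis using ratio[OF g(1) Kf] g(1) by (simp add: K_def)
qed

subsection \<open>Closedness\<close>

text \<open>Polynomials depending on \<rho> whose coefficients are polynomial functions of \<rho>.
  Stability under ring operations and partial derivatives spares expanding the equations of the
  isotropy group.\<close>

definition polyfam :: "(('a::field bpoly \<Rightarrow> 'a bpoly) \<Rightarrow> 'a bpoly) set" where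
  "polyfam = {\<Phi>. \<forall>i j. (\<lambda>\<rho>. bcoeff (\<Phi> \<rho>) i j) \<in> coeff_polyfun}"

lemma coeff_polyfun_sum:
  assumes "finite A" "\<And>a. a \<in> A \<Longrightarrow> F a \<in> coeff_polyfun"
  shows "(\<lambda>\<rho>. \<Sum>a\<in>A. F a \<rho>) \<in> coeff_polyfun"
  using assms by induction (auto intro: coeff_polyfun.intros)

lemma bcoeff_mult: "bcoeff (p * q) i j = (\<Sum>b\<le>j. \<Sum>a\<le>i. bcoeff p a b * bcoeff q (i - a) (j - b))"
  by (simp add: bcoeff_def coeff_mult coeff_sum)

lemma polyfam_const: "(\<lambda>\<rho>. p) \<in> polyfam"
  and polyfam_x: "(\<lambda>\<rho>. \<rho> var_x) \<in> polyfam"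
  and polyfam_y: "(\<lambda>\<rho>. \<rho> var_y) \<in> polyfam"
  unfolding polyfam_def by (auto intro: coeff_polyfun.intros)

lemma polyfam_add: "\<Phi> \<in> polyfam \<Longrightarrow> \<Psi> \<in> polyfam \<Longrightarrow> (\<lambda>\<rho>. \<Phi> \<rho> + \<Psi> \<rho>) \<in> polyfam"
  unfolding polyfam_def by (auto intro: coeff_polyfun.intros)

lemma polyfam_mult:
  assumes "\<Phi> \<in> polyfam" "\<Psi> \<in> polyfam"
  shows "(\<lambda>\<rho>. \<Phi> \<rho> * \<Psi> \<rho>) \<in> polyfam"
proof -
  have "(\<lambda>\<rho>. bcoeff (\<Phi> \<rho> * \<Psi> \<rho>) i j) \<in> coeff_polyfun" for i j
    unfolding bcoeff_mult
    by (intro coeff_polyfun_sum coeff_polyfun.mult) (use assms in \<open>auto simp: polyfam_def\<close>)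
  then show ?thesis by (simp add: polyfam_def)
qed

lemma polyfam_diff:
  assumes "\<Phi> \<in> polyfam" "\<Psi> \<in> polyfam"
  shows "(\<lambda>\<rho>. \<Phi> \<rho> - \<Psi> \<rho>) \<in> polyfam"
proof -
  have "(\<lambda>\<rho>. \<Phi> \<rho> + (- 1) * \<Psi> \<rho>) \<in> polyfam"
    by (rule polyfam_add[OF assms(1) polyfam_mult[OF polyfam_const assms(2)]])
  then show ?thesis by simp
qed

lemma polyfam_dx: assumes "\<Phi> \<in> polyfam" shows "(\<lambda>\<rho>. dx (\<Phi> \<rho>)) \<in> polyfam"
proof -
  have "bcoeff (dx p) i j = of_nat (Suc i) * bcoeff p (Suc i) j" for p :: "'a bpoly" and i j
    by (simp add: bcoeff_def coeff_dx coeff_pderiv)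
  then show ?thesis using assms unfolding polyfam_def by (auto intro!: coeff_polyfun.mult coeff_polyfun.const simp del: of_nat_Suc)
qed

lemma polyfam_dy: assumes "\<Phi> \<in> polyfam" shows "(\<lambda>\<rho>. dy (\<Phi> \<rho>)) \<in> polyfam"
proof -
  have "bcoeff (dy p) i j = of_nat (Suc j) * bcoeff p i (Suc j)" for p :: "'a bpoly" and i j
  proof -
    have "of_nat k * q = smult (of_nat k) q" for k and q :: "'a poly" by (simp add: of_nat_poly)
    then show ?thesis by (simp add: bcoeff_def coeff_pderiv del: of_nat_Suc)
  qed
  then show ?thesis using assms unfolding polyfam_def by (auto intro!: coeff_polyfun.mult coeff_polyfun.const simp del: of_nat_Suc)
qed

lemma polyfam_sub: "(\<lambda>\<rho>. sub (\<rho> var_x) (\<rho> var_y) p) \<in> polyfam"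
proof (induction p rule: bpoly_induct)
  case (const c)
  then show ?case unfolding sub_const by (rule polyfam_const)
next
  case x
  then show ?case unfolding sub_x by (rule polyfam_x)
next
  case y
  then show ?case unfolding sub_y by (rule polyfam_y)
next
  case (add p q)
  then show ?case unfolding rhom_add[OF rhom_sub] by (rule polyfam_add)
next
  case (mult p q)
  then show ?case unfolding rhom_mult[OF rhom_sub] by (rule polyfam_mult)
qed

lemma isotropy_iff:
  assumes D: "is_derivation D" and \<rho>: "is_aut \<rho>"
  shows "\<rho> \<in> isotropy D \<longleftrightarrow> \<rho> (D var_x) = D (\<rho> var_x) \<and> \<rho> (D var_y) = D (\<rho> var_y)"
proof
  assume gen: "\<rho> (D var_x) = D (\<rho> var_x) \<and> \<rho> (D var_y) = D (\<rho> var_y)"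
  note d = is_derivation_deriv[OF D] and h = is_aut_rhom[OF \<rho>]
  have "\<rho> (D p) = D (\<rho> p)" for p
  proof (induction p rule: bpoly_induct)
    case (const c)
    then show ?case by (simp only: is_aut_const[OF \<rho>] derivation_const[OF D] rhom_0[OF h])
  next
    case (add p q)
    then show ?case by (simp only: deriv_add[OF d] rhom_add[OF h])
  next
    case (mult p q)
    then show ?case by (simp only: deriv_mult[OF d] rhom_mult[OF h] rhom_add[OF h])
  qed (use gen in auto)
  then show "\<rho> \<in> isotropy D" using \<rho> by (auto simp: isotropy_def)
qed (auto simp: isotropy_def fun_eq_iff)

lemma isotropy_ind_closed:
  assumes D: "is_derivation D"
  shows "ind_closed (isotropy D)"
proof -
  \<comment> \<open>Polynomial functions live on all maps \<rho>, also on those that are no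
    homomorphisms. So \<open>\<rho> (D v)\<close> is replaced by a substitution that agrees with it
    on automorphisms, and D is expanded through partial derivatives.\<close>
  define F where "F v \<rho> = sub (\<rho> var_x) (\<rho> var_y) (D v) - (dx (\<rho> v) * D var_x + dy (\<rho> v) * D var_y)"
    for v and \<rho> :: "'a bpoly \<Rightarrow> 'a bpoly"
  have F: "F v \<rho> = 0 \<longleftrightarrow> \<rho> (D v) = D (\<rho> v)" if "is_aut \<rho>" for v \<rho>
    unfolding F_def is_aut_sub[OF that, of "D v"] derivation_formula[OF is_derivation_deriv_over[OF D], of "\<rho> v"] by simp
  have "F v \<in> polyfam" if "(\<lambda>\<rho>. \<rho> v) \<in> polyfam" for v
    unfolding F_def[abs_def]
    by (intro polyfam_diff polyfam_add polyfam_mult polyfam_const polyfam_sub polyfam_dx polyfam_dy that)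
  then have poly: "F var_x \<in> polyfam" "F var_y \<in> polyfam" using polyfam_x polyfam_y by auto
  define P where "P = (\<Union>i j. {\<lambda>\<rho>. bcoeff (F var_x \<rho>) i j, \<lambda>\<rho>. bcoeff (F var_y \<rho>) i j})"
  have "P \<subseteq> coeff_polyfun" using poly by (auto simp: P_def polyfam_def)
  moreover have "isotropy D \<inter> aut_upto d = {\<rho> \<in> aut_upto d. \<forall>G\<in>P. G \<rho> = 0}" for d
  proof -
    have "\<rho> \<in> isotropy D \<longleftrightarrow> (\<forall>G\<in>P. G \<rho> = 0)" if \<rho>: "is_aut \<rho>" for \<rho>
    proof -
      have "(\<forall>G\<in>P. G \<rho> = 0) \<longleftrightarrow> (\<forall>i j. bcoeff (F var_x \<rho>) i j = 0) \<and> (\<forall>i j. bcoeff (F var_y \<rho>) i j = 0)"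
        by (auto simp: P_def)
      also have "\<dots> \<longleftrightarrow> F var_x \<rho> = 0 \<and> F var_y \<rho> = 0"
        using bcoeff_eqI[of _ 0] by (metis bcoeff_simps(1))
      finally show ?thesis using isotropy_iff[OF D \<rho>] F[OF \<rho>] by simp
    qed
    then show ?thesis by (auto simp: aut_upto_def)
  qed
  ultimately have "zariski_closed_in d (isotropy D \<inter> aut_upto d)" for d
    unfolding zariski_closed_in_def by blast
  then show ?thesis unfolding ind_closed_def by (auto simp: isotropy_def)
qed

lemma isotropy_subgroup: "subgroup (isotropy D) aut_group"
proof
  show "isotropy D \<subseteq> carrier aut_group" by (auto simp: isotropy_def aut_group_def)
  show "\<one>\<^bsub>aut_group\<^esub> \<in> isotropy D" by (auto simp: isotropy_def aut_group_def is_aut_id)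
  show "\<rho> \<otimes>\<^bsub>aut_group\<^esub> \<sigma> \<in> isotropy D" if "\<rho> \<in> isotropy D" "\<sigma> \<in> isotropy D" for \<rho> \<sigma>
    using that by (auto simp: isotropy_def aut_group_def fun_eq_iff intro: is_aut_comp)
  show "inv\<^bsub>aut_group\<^esub> \<rho> \<in> isotropy D" if "\<rho> \<in> isotropy D" for \<rho>
  proof -
    have \<rho>: "is_aut \<rho>" using that by (simp add: isotropy_def)
    have "inv\<^bsub>aut_group\<^esub> \<rho> = ainv \<rho>"
      unfolding m_inv_def
    proof (rule the_equality)
      show "ainv \<rho> \<in> carrier aut_group \<and> \<rho> \<otimes>\<^bsub>aut_group\<^esub> ainv \<rho> = \<one>\<^bsub>aut_group\<^esub> \<and> ainv \<rho> \<otimes>\<^bsub>aut_group\<^esub> \<rho> = \<one>\<^bsub>aut_group\<^esub>"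
        using is_aut_inv[OF \<rho>] is_aut_inv_simps[OF \<rho>] by (auto simp: aut_group_def fun_eq_iff)
      show "y = ainv \<rho>" if "y \<in> carrier aut_group \<and> \<rho> \<otimes>\<^bsub>aut_group\<^esub> y = \<one>\<^bsub>aut_group\<^esub> \<and> y \<otimes>\<^bsub>aut_group\<^esub> \<rho> = \<one>\<^bsub>aut_group\<^esub>" for y
        using that is_aut_inv_simps[OF \<rho>] by (auto simp: aut_group_def fun_eq_iff) metis
    qed
    then show ?thesis using isotropy_inv[OF that] by simp
  qed
qed

lemma isotropy_algebraic:
  fixes D :: "'a::{alg_closed_field, field_char_0} bpoly \<Rightarrow> 'a bpoly"
  assumes D: "is_derivation D" and f: "\<not> pencil f" and d: "\<And>\<rho>. \<rho> \<in> isotropy D \<Longrightarrow> total_deg (\<rho> f) \<le> d"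
  shows "algebraic_group (isotropy D)"
proof -
  obtain B where "\<And>\<rho>. is_aut \<rho> \<Longrightarrow> total_deg (\<rho> f) \<le> d \<Longrightarrow> aut_degree \<rho> \<le> B"
    using aut_degree_bounded[OF f] by blast
  then have "isotropy D \<subseteq> aut_upto B" using d by (auto simp: aut_upto_def isotropy_def)
  then show ?thesis unfolding algebraic_group_def using isotropy_subgroup isotropy_ind_closed[OF D] by blast
qed

theorem theorem1:
  fixes D :: "'a::{alg_closed_field, field_char_0} bpoly \<Rightarrow> 'a bpoly"
  assumes "is_derivation D"
    and "D \<noteq> (\<lambda>_. 0)"
    and "(0 < eigen_number D \<and> eigen_number D < \<infinity> \<and>
            (\<exists>f. eigenvector D f \<and> \<not> (\<exists>g\<in>poly_in_x. equivalent f g)))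
       \<or> (\<exists>f. eigenvector_with D f 0 \<and> \<not> (\<exists>g\<in>poly_in_x. equivalent f g))"
  shows "algebraic_group (isotropy D) \<and>
    ((\<exists>f. eigenvector_with D f 0 \<and> \<not> (\<exists>g\<in>poly_in_x. equivalent f g))
       \<longrightarrow> eigen_number D = \<infinity>)"
proof
  show "algebraic_group (isotropy D)"
    using assms(3)
  proof (elim disjE conjE exE)
    fix f assume fin: "eigen_number D < \<infinity>" and f: "eigenvector D f" "\<not> (\<exists>g\<in>poly_in_x. equivalent f g)"
    have "finite (eigen_classes D)" using fin by (auto simp: eigen_number_def split: if_splits)
    then obtain d where "\<forall>\<rho>\<in>isotropy D. total_deg (\<rho> f) \<le> d"
      using eigenvector_orbit_bounded[OF assms(1) _ f(1)] by blast
    then show ?thesis using isotropy_algebraic[OF assms(1), of f d] f(2) by (simp add: pencil_def)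
  next
    fix f assume f: "eigenvector_with D f 0" "\<not> (\<exists>g\<in>poly_in_x. equivalent f g)"
    then have "D f = 0" "total_deg f \<ge> 1"
      using total_deg_0_iff[of f] by (auto simp: eigenvector_with_def)
    from isotropy_kernel_degree[OF assms(1,2) this]
    show ?thesis using isotropy_algebraic[OF assms(1), of f "total_deg f"] f(2) by (simp add: pencil_def)
  qed
  show "(\<exists>f. eigenvector_with D f 0 \<and> \<not> (\<exists>g\<in>poly_in_x. equivalent f g)) \<longrightarrow> eigen_number D = \<infinity>"
  proof (intro impI, elim exE conjE)
    fix f assume "eigenvector_with D f 0"
    then have "infinite (eigen_classes D)"
      using infinite_eigen_classes[OF assms(1), of f] by (simp add: eigenvector_with_def)
    then show "eigen_number D = \<infinity>" by (simp add: eigen_number_def)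
  qed
qed

end
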